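(* Let $B$ be the unit ball in $\mathbb R^3$ centered at the origin. (i) There is $c>0$ such that for each $\varepsilon\in(0,1)$ there are a smooth divergence-free vector field $b$ on $B$ with $\|b\|_{L_1(B)}\le c$ and a smooth function $u$ on $B$ with $\|u\|_{L_\infty(B)}\le1$ which solves $-\Delta u+b\cdot\nabla u=0$ in $B$ and satisfies $$u(0,0,\varepsilon)-u(0,0,0)\ge c^{-1}.$$ (ii) There are a divergence-free vector field $b\in L_1(B)$ and a distributional solution $u\in H^1(B)\cap L_\infty(B)$ of $-\Delta u+b\cdot\nabla u=0$ in $B$ such that $u$ is discontinuous at the origin, although $(b,u)$ can be approximated by a smooth sequence in the following sense: there are smooth divergence-free vector fields $b_m\in L_2(B)$ and smooth functions $u_m$, uniformly bounded in $B$, with $-\Delta u_m+b_m\cdot\nabla u_m=0$ in $B$, $b_m\to b$ in $L_1(B)$, and $u_m\overset{\star}{\rightharpoonup}u$ in $L_\infty(B)$.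
   Context: For a vector field $b\in L_1(B)$ and $u\in L_\infty(B)$, $b$ is divergence-free and $u$ is a distributional solution of $-\Delta u+b\cdot\nabla u=0$ in $B$ if $$\int_B b\cdot\nabla v\,dx=0=\int_B(u\Delta v+u\,b\cdot\nabla v)\,dx\qquad\text{for all } v\in C_0^\infty(B).$$ "Discontinuous at the origin" means that no representative of $u$ (in the a.e. sense) is continuous at the origin. $\overset{\star}{\rightharpoonup}$ denotes weak-star convergence. *)

theory Defs
  imports "HOL-Analysis.Analysis" "HOL-Probability.Essential_Supremum"
begin

section \<open>Smooth functions and differential operators\<close>

definition partial_deriv :: "'a::euclidean_space \<Rightarrow> ('a \<Rightarrow> 'b::real_normed_vector) \<Rightarrow> 'a \<Rightarrow> 'b"
  where "partial_deriv e f x = frechet_derivative f (at x) e"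

text \<open>For open \<open>S\<close>, a function is \<open>k\<close> times continuously differentiable iff it is differentiable
  at every point (for \<open>k > 0\<close>) and all its partial derivatives are \<open>k - 1\<close> times continuously
  differentiable. Values outside \<open>S\<close> play no role.\<close>

primrec C_on :: "nat \<Rightarrow> 'a::euclidean_space set \<Rightarrow> ('a \<Rightarrow> 'b::real_normed_vector) \<Rightarrow> bool"
  where
    "C_on 0 S f \<longleftrightarrow> continuous_on S f"
  | "C_on (Suc k) S f \<longleftrightarrow>
       (\<forall>x\<in>S. f differentiable (at x)) \<and> (\<forall>e\<in>Basis. C_on k S (partial_deriv e f))"

definition smooth_on :: "'a::euclidean_space set \<Rightarrow> ('a \<Rightarrow> 'b::real_normed_vector) \<Rightarrow> bool"
  where "smooth_on S f \<longleftrightarrow> (\<forall>k. C_on k S f)"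

definition grad :: "('a::euclidean_space \<Rightarrow> real) \<Rightarrow> 'a \<Rightarrow> 'a"
  where "grad f x = (\<Sum>e\<in>Basis. partial_deriv e f x *\<^sub>R e)"

definition laplacian :: "('a::euclidean_space \<Rightarrow> real) \<Rightarrow> 'a \<Rightarrow> real"
  where "laplacian f x = (\<Sum>e\<in>Basis. partial_deriv e (partial_deriv e f) x)"

text \<open>The space \<open>C\<^sub>0\<^sup>\<infinity>(S)\<close>, each test function being extended by zero to the whole space.\<close>

definition test_fun :: "'a::euclidean_space set \<Rightarrow> ('a \<Rightarrow> real) \<Rightarrow> bool"
  where "test_fun S v \<longleftrightarrow>
    smooth_on UNIV v \<and> compact (closure {x. v x \<noteq> 0}) \<and> closure {x. v x \<noteq> 0} \<subseteq> S"

section \<open>Function spaces\<close>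

text \<open>Elements of Lebesgue spaces are represented by total functions; values outside \<open>S\<close> are
  irrelevant, and nothing is assumed about the choice of the representative.\<close>

definition in_L1 :: "'a::euclidean_space set \<Rightarrow> ('a \<Rightarrow> 'b::euclidean_space) \<Rightarrow> bool"
  where "in_L1 S f \<longleftrightarrow> integrable (lebesgue_on S) f"

definition L1_norm :: "'a::euclidean_space set \<Rightarrow> ('a \<Rightarrow> 'b::euclidean_space) \<Rightarrow> real"
  where "L1_norm S f = integral\<^sup>L (lebesgue_on S) (\<lambda>x. norm (f x))"

definition in_L2 :: "'a::euclidean_space set \<Rightarrow> ('a \<Rightarrow> 'b::euclidean_space) \<Rightarrow> bool"
  where "in_L2 S f \<longleftrightarrow>
    f \<in> borel_measurable (lebesgue_on S) \<and> integrable (lebesgue_on S) (\<lambda>x. (norm (f x))\<^sup>2)"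

text \<open>Since the essential supremum of a non-measurable function is \<open>\<infinity>\<close>, finiteness of the norm
  includes measurability.\<close>

definition Linf_norm :: "'a::euclidean_space set \<Rightarrow> ('a \<Rightarrow> real) \<Rightarrow> ereal"
  where "Linf_norm S u = esssup (lebesgue_on S) (\<lambda>x. ereal \<bar>u x\<bar>)"

definition in_Linf :: "'a::euclidean_space set \<Rightarrow> ('a \<Rightarrow> real) \<Rightarrow> bool"
  where "in_Linf S u \<longleftrightarrow> u \<in> borel_measurable (lebesgue_on S) \<and> Linf_norm S u < \<infinity>"

text \<open>\<open>g\<close> is the weak gradient of \<open>u\<close>; the integrals are vector-valued.\<close>

definition in_H1 :: "'a::euclidean_space set \<Rightarrow> ('a \<Rightarrow> real) \<Rightarrow> bool"
  where "in_H1 S u \<longleftrightarrow> in_L2 S u \<and>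
    (\<exists>g :: 'a \<Rightarrow> 'a. in_L2 S g \<and>
      (\<forall>v. test_fun S v \<longrightarrow>
        integral\<^sup>L (lebesgue_on S) (\<lambda>x. u x *\<^sub>R grad v x) =
        - integral\<^sup>L (lebesgue_on S) (\<lambda>x. v x *\<^sub>R g x)))"

text \<open>Convergence in \<open>L\<^sub>\<infinity>(S)\<close> regarded as the dual of \<open>L\<^sub>1(S)\<close>.\<close>

definition weak_star_conv ::
    "'a::euclidean_space set \<Rightarrow> (nat \<Rightarrow> 'a \<Rightarrow> real) \<Rightarrow> ('a \<Rightarrow> real) \<Rightarrow> bool"
  where "weak_star_conv S us u \<longleftrightarrow>
    (\<forall>m. in_Linf S (us m)) \<and> in_Linf S u \<and>
    (\<forall>\<phi>. in_L1 S \<phi> \<longrightarrow>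
      (\<lambda>m. integral\<^sup>L (lebesgue_on S) (\<lambda>x. us m x * \<phi> x))
        \<longlonglongrightarrow> integral\<^sup>L (lebesgue_on S) (\<lambda>x. u x * \<phi> x))"

section \<open>The drift-diffusion equation\<close>

text \<open>The next two notions are meant for \<open>b \<in> L\<^sub>1(S)\<close> and \<open>u \<in> L\<^sub>\<infinity>(S)\<close>, which makes all
  the integrands integrable.\<close>

definition divergence_free :: "'a::euclidean_space set \<Rightarrow> ('a \<Rightarrow> 'a) \<Rightarrow> bool"
  where "divergence_free S b \<longleftrightarrow>
    (\<forall>v. test_fun S v \<longrightarrow> integral\<^sup>L (lebesgue_on S) (\<lambda>x. b x \<bullet> grad v x) = 0)"

definition distributional_solution ::
    "'a::euclidean_space set \<Rightarrow> ('a \<Rightarrow> 'a) \<Rightarrow> ('a \<Rightarrow> real) \<Rightarrow> bool"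
  where "distributional_solution S b u \<longleftrightarrow>
    (\<forall>v. test_fun S v \<longrightarrow>
      integral\<^sup>L (lebesgue_on S) (\<lambda>x. u x * laplacian v x + u x * (b x \<bullet> grad v x)) = 0)"

definition classical_solution ::
    "'a::euclidean_space set \<Rightarrow> ('a \<Rightarrow> 'a) \<Rightarrow> ('a \<Rightarrow> real) \<Rightarrow> bool"
  where "classical_solution S b u \<longleftrightarrow> (\<forall>x\<in>S. - laplacian u x + b x \<bullet> grad u x = 0)"

text \<open>No representative of \<open>u\<close> on \<open>S\<close> is continuous at \<open>p\<close>. This is meant for open \<open>S\<close> and
  \<open>p \<in> S\<close>, so that continuity at \<open>p\<close> depends on the values in \<open>S\<close> only.\<close>

definition essentially_discontinuous_at ::
    "'a::euclidean_space set \<Rightarrow> ('a \<Rightarrow> real) \<Rightarrow> 'a \<Rightarrow> bool"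
  where "essentially_discontinuous_at S u p \<longleftrightarrow>
    (\<forall>w. (AE x in lebesgue_on S. w x = u x) \<longrightarrow> \<not> isCont w p)"

end

(*
  Take u = arctan(z a(t))/2 with t = x^2 + y^2. The axisymmetric divergence-free b with
  b.grad u = Delta u is found by integrating its stream function along the level sets z = const/a(t)
  of u, starting from the axis, where it vanishes. If a grows like -ln t as t -> 0, then u tends to
  pi/4 or -pi/4 at the axis, according to the sign of z, while |b| <= C / (t (ln t)^2), which is
  integrable; hence u is discontinuous at the origin. Replacing ln t by ln(t + d), and letting the growth of a level off
  at the axis, makes b and u smooth without spoiling this bound. Letting d -> 0 by dominated
  convergence gives (ii), and small d gives (i).
*)
theory Submission
  imports Defs
begin

section \<open>Calculus of smooth functions\<close>

text \<open>Put s = z a and Q = 1 / (1 + s^2). In the variables (t, s) the drift term b.grad u is a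
  Q times the t-derivative of the stream function at fixed s, so the equation can be solved by
  quadrature in t for any profile a. What forces a particular profile is the size of the drift. The
  vertical component contains z (a' + t a'') / a, where a' + t a'' is a quarter of the planar
  Laplacian of a(x^2 + y^2). Its two summands have size 1 / (t |ln t|), which is not integrable, but
  they cancel because ln t is harmonic in the plane; what remains has the extra logarithm.
  Integrability is one-dimensional, since dx dy is dt up to the angle. Regularizing must break the
  harmonicity, because ln t carries a point mass at 0. With ln (t + d) alone this mass becomes a
  bump at scale d, and over all d the bumps divided by a again add up to 1 / (t |ln t|). The
  quadratic correction with k = 1 / (3 - ln d) spreads the mass over all scales between d and 1: the
  Laplacian then has size k / (t + d) everywhere, and k <= 1 / (3 - ln (t + d)) supplies the missing
  logarithm.\<close>

lemma partial_deriv_eq: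
  assumes "(f has_derivative f') (at x)"
  shows "partial_deriv e f x = f' e"
  using frechet_derivative_at[OF assms] by (simp add: partial_deriv_def)

lemma partial_deriv_cong:
  assumes "open S" "x \<in> S" "f differentiable (at x)" "\<And>y. y \<in> S \<Longrightarrow> f y = g y"
  shows "partial_deriv e f x = partial_deriv e g x"
  using frechet_derivative_transform_within_open[of f x S g] assms
  by (simp add: partial_deriv_def)

lemma has_derivative_partial_deriv:
  "f differentiable (at x) \<Longrightarrow> (f has_derivative (\<lambda>e. partial_deriv e f x)) (at x)"
  by (simp add: partial_deriv_def frechet_derivative_works)

lemma has_real_derivative_partial_deriv:
  fixes f :: "real \<Rightarrow> real"
  assumes "f differentiable (at x)"
  shows "(f has_real_derivative partial_deriv 1 f x) (at x)"
proof -
  obtain D where "(f has_real_derivative D) (at x)"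
    using assms real_differentiable_def by blast
  then show ?thesis
    using partial_deriv_eq[of f "(*) D" x 1] by (simp add: has_field_derivative_def)
qed

text \<open>Derivative formulas are known on \<open>S\<close> only, whereas \<open>C_on\<close>
  iterates \<open>partial_deriv\<close> as a total function. Derivatives being local on an open set,
  a formula valid on \<open>S\<close> may replace the derivative at every level.\<close>

lemma C_on_cong:
  assumes "open S" "\<And>x. x \<in> S \<Longrightarrow> f x = g x" "C_on k S f"
  shows "C_on k S g"
  using assms(2,3)
proof (induction k arbitrary: f g)
  case 0
  then show ?case using continuous_on_cong[of S S f g] by simp
next
  case (Suc k)
  have "g differentiable at x" if "x \<in> S" for x
  proof -
    obtain D where "(f has_derivative D) (at x)"
      using Suc.prems(2) \<open>x \<in> S\<close> by (auto simp: differentiable_def)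
    then show ?thesis
      using has_derivative_transform_within_open[of f D x UNIV S g] assms(1) Suc.prems(1) that
      by (auto simp: differentiable_def)
  qed
  moreover have "C_on k S (partial_deriv e g)" if "e \<in> Basis" for e
    using Suc.IH[of "partial_deriv e f" "partial_deriv e g"] Suc.prems that assms(1)
      partial_deriv_cong[of S _ f g e] by auto
  ultimately show ?case by simp
qed

lemma C_on_SucD: "C_on (Suc k) S f \<Longrightarrow> C_on k S f"
proof (induction k arbitrary: f)
  case 0
  then show ?case
    by (auto intro!: continuous_at_imp_continuous_on differentiable_imp_continuous_within)
next
  case (Suc k)
  then show ?case by simp
qed

lemma C_on_subset: "C_on k S f \<Longrightarrow> R \<subseteq> S \<Longrightarrow> C_on k R f"
  by (induction k arbitrary: f) (auto intro: continuous_on_subset)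

lemma C_on_const: "C_on k S (\<lambda>x. c)"
proof (induction k arbitrary: c)
  case (Suc k)
  have "partial_deriv e (\<lambda>x. c) = (\<lambda>x. 0)" for e :: 'a
    by (rule ext, rule partial_deriv_eq) (rule has_derivative_const)
  then show ?case using Suc by simp
qed simp

lemma C_on_linear:
  assumes "bounded_linear f"
  shows "C_on k S f"
proof (cases k)
  case 0
  then show ?thesis using assms by (simp add: linear_continuous_on)
next
  case (Suc n)
  have "(f has_derivative f) (at x)" for x
    using assms bounded_linear_imp_has_derivative by blast
  then have "partial_deriv e f = (\<lambda>x. f e)" "f differentiable (at x)" for e x
    by (auto intro!: partial_deriv_eq simp: differentiable_def)
  then show ?thesis using Suc by (simp add: C_on_const)
qed

lemma C_on_add:
  assumes "open S" "C_on k S f" "C_on k S g"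
  shows "C_on k S (\<lambda>x. f x + g x)"
  using assms(2,3)
proof (induction k arbitrary: f g)
  case (Suc k)
  have "partial_deriv e f x + partial_deriv e g x = partial_deriv e (\<lambda>x. f x + g x) x"
    if "x \<in> S" for x e
    using Suc.prems that by (intro partial_deriv_eq[symmetric])
      (auto simp: partial_deriv_def frechet_derivative_works intro!: has_derivative_add)
  moreover have "C_on k S (\<lambda>x. partial_deriv e f x + partial_deriv e g x)" if "e \<in> Basis" for e
    using Suc that by auto
  ultimately have "C_on k S (partial_deriv e (\<lambda>x. f x + g x))" if "e \<in> Basis" for e
    by (rule C_on_cong[OF assms(1)]) (use that in auto)
  then show ?case using Suc.prems by auto
qed (auto intro: continuous_intros)

lemma C_on_scaleR:
  assumes "open S" "C_on k S f" "C_on k S g"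
  shows "C_on k S (\<lambda>x. f x *\<^sub>R g x)"
  using assms(2,3)
proof (induction k arbitrary: f g)
  case (Suc k)
  have "f x *\<^sub>R partial_deriv e g x + partial_deriv e f x *\<^sub>R g x
      = partial_deriv e (\<lambda>x. f x *\<^sub>R g x) x"
    if "x \<in> S" for x e
    using Suc.prems that by (intro partial_deriv_eq[symmetric])
      (auto simp: partial_deriv_def frechet_derivative_works intro!: has_derivative_scaleR)
  moreover have "C_on k S (\<lambda>x. f x *\<^sub>R partial_deriv e g x + partial_deriv e f x *\<^sub>R g x)"
    if "e \<in> Basis" for e
    using Suc.prems that C_on_SucD[OF Suc.prems(1)] C_on_SucD[OF Suc.prems(2)]
    by (auto intro!: C_on_add[OF assms(1)] Suc.IH)
  ultimately have "C_on k S (partial_deriv e (\<lambda>x. f x *\<^sub>R g x))" if "e \<in> Basis" for e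
    by (rule C_on_cong[OF assms(1)]) (use that in auto)
  then show ?case using Suc.prems by auto
qed (auto intro: continuous_intros)

text \<open>The chain rule yields the derivative of \<open>g\<close> after the same
  \<open>f\<close>, times a partial derivative of \<open>f\<close>. Hence only \<open>g\<close>
  varies in the induction.\<close>

lemma C_on_compose:
  fixes g :: "real \<Rightarrow> real"
  assumes "open S" "C_on k S f" "C_on k R g" "f ` S \<subseteq> R"
  shows "C_on k S (\<lambda>x. g (f x))"
  using assms(2,3)
proof (induction k arbitrary: g)
  case 0
  then show ?case using assms(4) by (auto intro: continuous_on_compose2)
next
  case (Suc k)
  have gd: "(g has_real_derivative partial_deriv 1 g y) (at y)" if "y \<in> R" for y
    using Suc.prems(2) that by (auto intro: has_real_derivative_partial_deriv)
  have fd: "(f has_derivative (\<lambda>e. partial_deriv e f x)) (at x)" if "x \<in> S" for x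
    using Suc.prems(1) that by (auto simp: partial_deriv_def frechet_derivative_works)
  have gf: "((\<lambda>x. g (f x)) has_derivative
      (\<lambda>e. partial_deriv 1 g (f x) * partial_deriv e f x)) (at x)" if "x \<in> S" for x
    using has_derivative_compose[OF fd[OF that]
        gd[unfolded has_field_derivative_def, of "f x"]] that assms(4) by auto
  then have "partial_deriv 1 g (f x) *\<^sub>R partial_deriv e f x
      = partial_deriv e (\<lambda>x. g (f x)) x" if "x \<in> S" for x e
    using partial_deriv_eq[OF gf[OF that]] by simp
  moreover have "C_on k S (\<lambda>x. partial_deriv 1 g (f x) *\<^sub>R partial_deriv e f x)"
    if "e \<in> Basis" for e
    using Suc.prems that by (intro C_on_scaleR[OF assms(1) Suc.IH[OF C_on_SucD[OF Suc.prems(1)]]]) auto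
  ultimately have "C_on k S (partial_deriv e (\<lambda>x. g (f x)))" if "e \<in> Basis" for e
    by (rule C_on_cong[OF assms(1)]) (use that in auto)
  then show ?case using gf by (auto simp: differentiable_def)
qed

text \<open>The derivative is minus the product of \<open>inverse\<close> with itself, so the
  induction closes. One differentiation then reduces \<open>ln\<close> and \<open>arctan\<close> to
  \<open>inverse\<close>.\<close>

lemma C_on_inverse_real: "C_on k {x. x \<noteq> (0::real)} inverse"
proof (induction k)
  case (Suc k)
  have op: "open {x. x \<noteq> (0::real)}" by (simp add: open_Collect_neq continuous_intros)
  have d: "(inverse has_derivative (\<lambda>h. h * - (inverse x * inverse x))) (at x)"
    if "x \<noteq> (0::real)" for x
    using that by (auto intro!: derivative_eq_intros)
  then have "(- 1) *\<^sub>R (inverse x *\<^sub>R inverse x) = partial_deriv 1 inverse x" if "x \<noteq> (0::real)" for x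
    using partial_deriv_eq[OF d[OF that], of 1] by simp
  then have "C_on k {x. x \<noteq> (0::real)} (partial_deriv 1 inverse)"
    by (intro C_on_cong[OF op _ C_on_scaleR[OF op C_on_const[of _ _ "- 1"] C_on_scaleR[OF op Suc Suc]]]) simp
  then show ?case using d by (auto simp: differentiable_def)
qed (auto intro: continuous_intros)

lemma C_on_ln_real: "C_on k {x. x > (0::real)} ln"
proof (cases k)
  case (Suc n)
  have op: "open {x. x > (0::real)}" by (simp add: open_Collect_less continuous_intros)
  have d: "(ln has_derivative (\<lambda>h. h * inverse x)) (at x)" if "x > (0::real)" for x
    using that by (auto intro!: derivative_eq_intros)
  then have "inverse x = partial_deriv 1 ln x" if "x > (0::real)" for x
    using partial_deriv_eq[OF d[OF that], of 1] by simp
  then have "C_on n {x. x > (0::real)} (partial_deriv 1 ln)"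
    by (intro C_on_cong[OF op _ C_on_subset[OF C_on_inverse_real]]) auto
  then show ?thesis using d Suc by (auto simp: differentiable_def)
qed (auto intro: continuous_intros)

lemma C_on_arctan_real: "C_on k (UNIV :: real set) arctan"
proof (cases k)
  case (Suc n)
  have d: "(arctan has_derivative (\<lambda>h. h * inverse (1 + x * x))) (at x)" for x
    by (auto intro!: derivative_eq_intros simp: power2_eq_square)
  then have "inverse (1 + x * x) = partial_deriv 1 arctan x" for x
    using partial_deriv_eq[OF d, of 1] by simp
  moreover have "C_on n (UNIV :: real set) (\<lambda>x. inverse (1 + x * x))"
    using C_on_scaleR[OF open_UNIV C_on_linear[OF bounded_linear_ident] C_on_linear[OF bounded_linear_ident]]
    by (intro C_on_compose[OF open_UNIV C_on_add[OF open_UNIV C_on_const] C_on_inverse_real])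
       (auto simp: add_nonneg_eq_0_iff)
  ultimately have "C_on n (UNIV :: real set) (partial_deriv 1 arctan)"
    by (rule C_on_cong[OF open_UNIV, of "\<lambda>x. inverse (1 + x * x)"])
  then show ?thesis using d Suc by (auto simp: differentiable_def)
qed (auto intro: continuous_intros)

lemma smooth_on_imp_continuous_on: "smooth_on S f \<Longrightarrow> continuous_on S f"
  unfolding smooth_on_def by (metis C_on.simps(1))

lemma smooth_on_imp_differentiable: "smooth_on S f \<Longrightarrow> x \<in> S \<Longrightarrow> f differentiable (at x)"
  unfolding smooth_on_def by (metis C_on.simps(2))

lemma smooth_on_partial_deriv: "smooth_on S f \<Longrightarrow> e \<in> Basis \<Longrightarrow> smooth_on S (partial_deriv e f)"
  unfolding smooth_on_def by (metis C_on.simps(2))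

lemma smooth_on_subset: "smooth_on S f \<Longrightarrow> R \<subseteq> S \<Longrightarrow> smooth_on R f"
  unfolding smooth_on_def by (metis C_on_subset)

section \<open>Closure properties of smooth functions\<close>

named_theorems smooth_intros

lemma smooth_on_const [smooth_intros]: "smooth_on S (\<lambda>x. c)"
  by (simp add: smooth_on_def C_on_const)

lemma smooth_on_id [smooth_intros]: "smooth_on S (\<lambda>x. x)"
  by (simp add: smooth_on_def C_on_linear bounded_linear_ident)

lemma smooth_on_nth [smooth_intros]: "smooth_on S (\<lambda>x :: real^'n. x $ i)"
  by (simp add: smooth_on_def C_on_linear bounded_linear_vec_nth)

lemma smooth_on_add [smooth_intros]:
  "open S \<Longrightarrow> smooth_on S f \<Longrightarrow> smooth_on S g \<Longrightarrow> smooth_on S (\<lambda>x. f x + g x)"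
  by (simp add: smooth_on_def C_on_add)

lemma smooth_on_scaleR [smooth_intros]:
  "open S \<Longrightarrow> smooth_on S f \<Longrightarrow> smooth_on S g \<Longrightarrow> smooth_on S (\<lambda>x. f x *\<^sub>R g x)"
  by (simp add: smooth_on_def C_on_scaleR)

lemma smooth_on_mult [smooth_intros]:
  fixes f g :: "_ \<Rightarrow> real"
  shows "open S \<Longrightarrow> smooth_on S f \<Longrightarrow> smooth_on S g \<Longrightarrow> smooth_on S (\<lambda>x. f x * g x)"
  using smooth_on_scaleR[of S f g] by simp

lemma smooth_on_minus [smooth_intros]:
  fixes f :: "_ \<Rightarrow> real"
  shows "open S \<Longrightarrow> smooth_on S f \<Longrightarrow> smooth_on S (\<lambda>x. - f x)"
  using smooth_on_mult[of S "\<lambda>x. -1" f] smooth_on_const[of S "-1"] by simp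

lemma smooth_on_diff [smooth_intros]:
  fixes f g :: "_ \<Rightarrow> real"
  shows "open S \<Longrightarrow> smooth_on S f \<Longrightarrow> smooth_on S g \<Longrightarrow> smooth_on S (\<lambda>x. f x - g x)"
  using smooth_on_add[of S f "\<lambda>x. - g x"] smooth_on_minus[of S g] by simp

lemma smooth_on_power [smooth_intros]:
  fixes f :: "_ \<Rightarrow> real"
  shows "open S \<Longrightarrow> smooth_on S f \<Longrightarrow> smooth_on S (\<lambda>x. f x ^ n)"
  by (induction n) (auto intro: smooth_intros)

lemma smooth_on_compose:
  fixes g :: "real \<Rightarrow> real"
  shows "open S \<Longrightarrow> smooth_on R g \<Longrightarrow> smooth_on S f \<Longrightarrow> f ` S \<subseteq> R \<Longrightarrow> smooth_on S (\<lambda>x. g (f x))"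
  unfolding smooth_on_def using C_on_compose by metis

lemma smooth_on_divide [smooth_intros]:
  fixes f g :: "_ \<Rightarrow> real"
  assumes "open S" "smooth_on S f" "smooth_on S g" "\<And>x. x \<in> S \<Longrightarrow> g x \<noteq> 0"
  shows "smooth_on S (\<lambda>x. f x / g x)"
  unfolding divide_inverse
  by (intro smooth_intros assms smooth_on_compose[of S "{x. x \<noteq> (0::real)}" inverse])
    (use assms(4) in \<open>auto simp: smooth_on_def C_on_inverse_real\<close>)

lemma smooth_on_ln [smooth_intros]:
  fixes f :: "_ \<Rightarrow> real"
  assumes "open S" "smooth_on S f" "\<And>x. x \<in> S \<Longrightarrow> f x > 0"
  shows "smooth_on S (\<lambda>x. ln (f x))"
  by (intro assms smooth_on_compose[of S "{x. x > (0::real)}" ln])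
    (use assms(3) in \<open>auto simp: smooth_on_def C_on_ln_real\<close>)

lemma smooth_on_arctan [smooth_intros]:
  fixes f :: "_ \<Rightarrow> real"
  assumes "open S" "smooth_on S f"
  shows "smooth_on S (\<lambda>x. arctan (f x))"
  by (intro assms smooth_on_compose[of S UNIV arctan])
    (auto simp: smooth_on_def C_on_arctan_real)

section \<open>Integration by parts\<close>

text \<open>Difference quotients integrate to \<open>0\<close> by translation invariance.\<close>

lemma integral_partial_deriv_eq_0:
  fixes g :: "'a::euclidean_space \<Rightarrow> real"
  assumes diff: "\<And>x. g differentiable (at x)" and cont: "continuous_on UNIV (partial_deriv e g)"
    and K: "compact K" and out: "\<And>x. x \<notin> K \<Longrightarrow> g x = 0"
  shows "integral\<^sup>L lborel (partial_deriv e g) = 0"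
proof -
  have outd: "partial_deriv e g x = 0" if "x \<notin> K" for x
    using partial_deriv_cong[of "- K" x g "\<lambda>x. 0" e] that K diff out
      partial_deriv_eq[OF has_derivative_const[of "0::real" "at x"], of e]
    by (auto simp: compact_imp_closed open_Compl)
  have "compact (partial_deriv e g ` K)"
    using K cont by (intro compact_continuous_image) (auto intro: continuous_on_subset)
  then obtain M0 where "\<And>y. y \<in> partial_deriv e g ` K \<Longrightarrow> norm y \<le> M0"
    using compact_imp_bounded bounded_iff by metis
  then have M: "\<bar>partial_deriv e g x\<bar> \<le> \<bar>M0\<bar>" for x
    using outd[of x] by (cases "x \<in> K") force+
  \<comment> \<open>\<open>K'\<close> consists of the points \<open>x\<close> for which the segment
    from \<open>x\<close> to \<open>x + e\<close> meets \<open>K\<close>. It therefore contains the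
    support of every difference quotient with step \<open>h n <= 1\<close>.\<close>
  define K' where "K' = {x - y |x y. x \<in> K \<and> y \<in> (\<lambda>s. s *\<^sub>R e) ` {0..1::real}}"
  have K': "compact K'" unfolding K'_def
    by (intro compact_differences K compact_continuous_image continuous_intros) auto
  have g_cont: "continuous_on A g" for A
    using diff by (auto intro!: continuous_at_imp_continuous_on differentiable_imp_continuous_within)
  then have g_borel: "g \<in> borel_measurable borel"
    by (intro borel_measurable_continuous_onI)
  have g_int: "integrable lborel g"
  proof -
    have "(\<lambda>x. indicator K x *\<^sub>R g x) = g"
      using out by (intro ext) (auto simp: indicator_def)
    then show ?thesis using borel_integrable_compact[OF K g_cont] by simp
  qed
  define h :: "nat \<Rightarrow> real" where "h = (\<lambda>n. inverse (real (Suc n)))"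
  have h: "0 < h n" "h n \<le> 1" for n by (auto simp: h_def divide_simps)
  have h0: "filterlim h (at 0) sequentially"
    using h(1) LIMSEQ_inverse_real_of_nat
    by (auto simp: filterlim_at h_def intro!: always_eventually)
  have D: "((\<lambda>s. g (x + s *\<^sub>R e)) has_real_derivative partial_deriv e g (x + s *\<^sub>R e)) (at s)" for x s
  proof -
    have "((\<lambda>s. g (x + s *\<^sub>R e)) has_derivative
        (\<lambda>r. partial_deriv (r *\<^sub>R e) g (x + s *\<^sub>R e))) (at s)"
      by (rule has_derivative_compose[OF _ has_derivative_partial_deriv[OF diff]])
         (auto intro!: derivative_eq_intros)
    moreover have "partial_deriv (r *\<^sub>R e) g y = partial_deriv e g y * r" for r y
      using linear_cmul[OF linear_frechet_derivative[OF diff[of y]]]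
      by (simp add: partial_deriv_def)
    ultimately show ?thesis by (simp add: has_field_derivative_def)
  qed
  define q where "q = (\<lambda>n x. (g (x + h n *\<^sub>R e) - g x) / h n)"
  have q_lim: "(\<lambda>n. q n x) \<longlonglongrightarrow> partial_deriv e g x" for x
    using D[of x 0, unfolded DERIV_def] filterlim_compose[OF _ h0]
    by (auto simp: q_def)
  have q_bound: "norm (q n x) \<le> indicator K' x *\<^sub>R \<bar>M0\<bar>" for n x
  proof (cases "x \<in> K'")
    case True
    obtain s where "g (x + h n *\<^sub>R e) - g (x + 0 *\<^sub>R e) = (h n - 0) * partial_deriv e g (x + s *\<^sub>R e)"
      using MVT2[of 0 "h n" "\<lambda>s. g (x + s *\<^sub>R e)" "\<lambda>s. partial_deriv e g (x + s *\<^sub>R e)"] D h(1)[of n]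
      by blast
    then have "q n x = partial_deriv e g (x + s *\<^sub>R e)"
      using h(1)[of n] by (simp add: q_def)
    then show ?thesis using M True by simp
  next
    case False
    have "x \<notin> K"
    proof
      assume *: "x \<in> K"
      have "x = x - 0 *\<^sub>R e" "0 *\<^sub>R e \<in> (\<lambda>s. s *\<^sub>R e) ` {0..1}"
        by (simp, intro imageI) simp
      then show False using False * unfolding K'_def by blast
    qed
    moreover have "x + h n *\<^sub>R e \<notin> K"
    proof
      assume *: "x + h n *\<^sub>R e \<in> K"
      have "x = (x + h n *\<^sub>R e) - h n *\<^sub>R e" "h n *\<^sub>R e \<in> (\<lambda>s. s *\<^sub>R e) ` {0..1}"
        using h[of n] by auto
      then show False using False * unfolding K'_def by blast
    qed
    ultimately show ?thesis using out by (simp add: q_def)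
  qed
  have tr: "integrable lborel (\<lambda>x. g (x + c))" "integral\<^sup>L lborel (\<lambda>x. g (x + c)) = integral\<^sup>L lborel g" for c
  proof -
    have d: "distr lborel borel (\<lambda>x. x + c) = lborel"
      by (subst add.commute) (rule lborel_distr_plus)
    have "integrable (distr lborel borel (\<lambda>x. x + c)) g" unfolding d by (rule g_int)
    then show "integrable lborel (\<lambda>x. g (x + c))"
      by (rule integrable_distr[rotated]) simp
    have "integral\<^sup>L (distr lborel borel (\<lambda>x. x + c)) g = integral\<^sup>L lborel (\<lambda>x. g (x + c))"
      using g_borel by (intro integral_distr) auto
    then show "integral\<^sup>L lborel (\<lambda>x. g (x + c)) = integral\<^sup>L lborel g" by (simp add: d)
  qed
  have "integral\<^sup>L lborel (q n) = 0" for n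
    using tr g_int by (simp add: q_def)
  moreover have "(\<lambda>n. integral\<^sup>L lborel (q n)) \<longlonglongrightarrow> integral\<^sup>L lborel (partial_deriv e g)"
  proof (rule integral_dominated_convergence)
    show "integrable lborel (\<lambda>x. indicator K' x *\<^sub>R \<bar>M0\<bar>)"
      by (intro borel_integrable_compact K' continuous_intros)
    show "partial_deriv e g \<in> borel_measurable lborel"
      using borel_measurable_continuous_onI[OF cont] by simp
    show "q n \<in> borel_measurable lborel" for n
      unfolding q_def using g_borel by measurable
  qed (use q_lim q_bound in auto)
  ultimately show ?thesis by (simp add: LIMSEQ_const_iff)
qed

text \<open>The integrand is controlled on \<open>S\<close> only. The indicator of \<open>K\<close>
  discards its arbitrary values elsewhere, which moves the integral to the whole space, where
  translation invariance is available.\<close>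

lemma integral_lebesgue_on_compact_support:
  fixes f :: "'a::euclidean_space \<Rightarrow> 'b::euclidean_space"
  assumes S: "open S" and cont: "continuous_on S f" and K: "compact K" "K \<subseteq> S"
    and out: "\<And>x. x \<in> S \<Longrightarrow> x \<notin> K \<Longrightarrow> f x = 0"
  shows "integrable (lebesgue_on S) f"
    and "integral\<^sup>L (lebesgue_on S) f = integral\<^sup>L lborel (\<lambda>x. indicator K x *\<^sub>R f x)"
proof -
  have SL: "S \<in> sets lebesgue" using S by (simp add: lmeasurable_open)
  have eq: "(\<lambda>x. indicator S x *\<^sub>R f x) = (\<lambda>x. indicator K x *\<^sub>R f x)"
    using K(2) out by (force simp: indicator_def)
  have i: "integrable lborel (\<lambda>x. indicator K x *\<^sub>R f x)"
    using K cont by (intro borel_integrable_compact) (auto intro: continuous_on_subset)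
  then have m: "(\<lambda>x. indicator K x *\<^sub>R f x) \<in> borel_measurable lborel" by auto
  show "integrable (lebesgue_on S) f"
    using SL i m by (simp add: integrable_restrict_space eq integrable_completion)
  show "integral\<^sup>L (lebesgue_on S) f = integral\<^sup>L lborel (\<lambda>x. indicator K x *\<^sub>R f x)"
    using SL m by (simp add: integral_restrict_space eq integral_completion)
qed

lemma test_fun_outside:
  assumes "test_fun S v" "x \<notin> closure {x. v x \<noteq> 0}"
  shows "v x = 0" "partial_deriv e v x = 0"
proof -
  show *: "v x = 0" using assms(2) closure_subset by force
  have "partial_deriv e v x = partial_deriv e (\<lambda>x. 0 :: real) x"
  proof (rule partial_deriv_cong[of "- closure {x. v x \<noteq> 0}"])
    show "v differentiable at x"
      using assms(1) by (auto simp: test_fun_def intro: smooth_on_imp_differentiable)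
    show "v y = 0" if "y \<in> - closure {x. v x \<noteq> 0}" for y
      using that closure_subset by force
  qed (use assms(2) in auto)
  then show "partial_deriv e v x = 0"
    using partial_deriv_eq[OF has_derivative_const[of "0::real" "at x"], of e] by simp
qed

lemma test_fun_partial_deriv:
  assumes "test_fun S v" "e \<in> Basis"
  shows "test_fun S (partial_deriv e v)"
proof -
  have sub: "closure {x. partial_deriv e v x \<noteq> 0} \<subseteq> closure {x. v x \<noteq> 0}"
    using test_fun_outside(2)[OF assms(1)] by (intro closure_minimal) auto
  then have "compact (closure {x. partial_deriv e v x \<noteq> 0})"
    using assms(1) compact_Int_closed[of "closure {x. v x \<noteq> 0}" "closure {x. partial_deriv e v x \<noteq> 0}"]
    by (simp add: test_fun_def Int_absorb1)
  then show ?thesis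
    using assms sub by (auto simp: test_fun_def intro: smooth_on_partial_deriv)
qed

lemma test_fun_bounded:
  assumes "test_fun S v"
  obtains M where "M \<ge> 0" "\<And>x. \<bar>v x\<bar> \<le> M"
proof -
  let ?K = "closure {x. v x \<noteq> 0}"
  have "compact (v ` ?K)"
    using assms by (intro compact_continuous_image)
      (auto simp: test_fun_def intro: continuous_on_subset[OF smooth_on_imp_continuous_on])
  then obtain M0 where M0: "\<And>y. y \<in> v ` ?K \<Longrightarrow> norm y \<le> M0"
    using compact_imp_bounded bounded_iff by metis
  show ?thesis
  proof
    show "\<bar>v x\<bar> \<le> \<bar>M0\<bar>" for x
      using M0 test_fun_outside(1)[OF assms, of x] by (cases "x \<in> ?K") force+
  qed simp
qed

text \<open>The product \<open>w v\<close> vanishes off the support \<open>K\<close> of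
  \<open>v\<close>, so it is differentiable everywhere although nothing is known of \<open>w\<close>
  outside \<open>S\<close>. Its partial derivative then has integral 0.\<close>

lemma test_fun_integral_by_parts:
  fixes v w :: "'a::euclidean_space \<Rightarrow> real"
  assumes S: "open S" and v: "test_fun S v" and e: "e \<in> Basis"
    and wd: "\<And>x. x \<in> S \<Longrightarrow> w differentiable (at x)" and wc: "continuous_on S (partial_deriv e w)"
  shows "integrable (lebesgue_on S) (\<lambda>x. w x * partial_deriv e v x)"
    and "integrable (lebesgue_on S) (\<lambda>x. v x * partial_deriv e w x)"
    and "integral\<^sup>L (lebesgue_on S) (\<lambda>x. w x * partial_deriv e v x)
       = - integral\<^sup>L (lebesgue_on S) (\<lambda>x. v x * partial_deriv e w x)"
proof -
  define K where "K = closure {x. v x \<noteq> 0}"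
  have K: "compact K" "K \<subseteq> S" using v by (auto simp: test_fun_def K_def)
  have vs: "smooth_on UNIV v" using v by (simp add: test_fun_def)
  have w0: "continuous_on S w"
    using wd by (auto intro!: continuous_at_imp_continuous_on differentiable_imp_continuous_within)
  have v0: "continuous_on A v" "continuous_on A (partial_deriv e v)" for A
    using smooth_on_imp_continuous_on[OF vs] smooth_on_imp_continuous_on[OF smooth_on_partial_deriv[OF vs e]]
    by (auto intro: continuous_on_subset)
  have out: "v x = 0" "partial_deriv e v x = 0" if "x \<notin> K" for x
    using test_fun_outside(1)[OF v, of x] test_fun_outside(2)[OF v, of x e] that by (simp_all add: K_def)
  show i1: "integrable (lebesgue_on S) (\<lambda>x. w x * partial_deriv e v x)"
    by (rule integral_lebesgue_on_compact_support(1)[OF S continuous_on_mult[OF w0 v0(2)] K]) (simp add: out)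
  show i2: "integrable (lebesgue_on S) (\<lambda>x. v x * partial_deriv e w x)"
    by (rule integral_lebesgue_on_compact_support(1)[OF S continuous_on_mult[OF v0(1) wc] K]) (simp add: out)
  let ?g = "\<lambda>x. w x * v x"
  have gS: "(?g has_derivative (\<lambda>h. w x * partial_deriv h v x + partial_deriv h w x * v x)) (at x)"
    if "x \<in> S" for x
    by (intro has_derivative_mult has_derivative_partial_deriv wd that smooth_on_imp_differentiable[OF vs]) auto
  have gK: "(?g has_derivative (\<lambda>h. 0)) (at x)" if "x \<notin> K" for x
    by (rule has_derivative_transform_within_open[OF has_derivative_const[of 0], of "- K"])
       (use that K out in \<open>auto simp: compact_imp_closed open_Compl\<close>)
  have gd: "?g differentiable (at x)" for x
    using gS[of x] gK[of x] K(2) unfolding differentiable_def by (cases "x \<in> K") auto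
  have pS: "partial_deriv e ?g x = w x * partial_deriv e v x + v x * partial_deriv e w x" if "x \<in> S" for x
    using partial_deriv_eq[OF gS[OF that]] by simp
  have pK: "partial_deriv e ?g x = 0" if "x \<notin> K" for x
    using partial_deriv_eq[OF gK[OF that]] by simp
  \<comment> \<open>The open sets \<open>S\<close> and \<open>- K\<close> cover the space, and the
    derivative has a continuous formula on each of them.\<close>
  have "continuous_on (S \<union> - K) (partial_deriv e ?g)"
  proof (rule continuous_on_open_Un[OF S])
    show "continuous_on S (partial_deriv e ?g)"
      by (subst continuous_on_cong[OF refl pS]) (auto intro!: continuous_intros w0 v0 wc)
    show "continuous_on (- K) (partial_deriv e ?g)"
      by (subst continuous_on_cong[OF refl pK]) auto
  qed (use K in \<open>auto simp: compact_imp_closed open_Compl\<close>)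
  moreover have "S \<union> - K = UNIV" using K(2) by auto
  ultimately have "integral\<^sup>L lborel (partial_deriv e ?g) = 0"
    using out by (intro integral_partial_deriv_eq_0[OF gd _ K(1)]) auto
  moreover have "integral\<^sup>L (lebesgue_on S) (\<lambda>x. w x * partial_deriv e v x + v x * partial_deriv e w x)
      = integral\<^sup>L lborel (partial_deriv e ?g)"
  proof (subst integral_lebesgue_on_compact_support(2)[OF S _ K])
    show "continuous_on S (\<lambda>x. w x * partial_deriv e v x + v x * partial_deriv e w x)"
      by (auto intro!: continuous_intros w0 v0 wc)
    show "integral\<^sup>L lborel (\<lambda>x. indicator K x *\<^sub>R (w x * partial_deriv e v x + v x * partial_deriv e w x))
      = integral\<^sup>L lborel (partial_deriv e ?g)"
      using pS pK K(2) by (intro arg_cong[where f="integral\<^sup>L lborel"] ext) (auto simp: indicator_def)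
  qed (use out in auto)
  ultimately show "integral\<^sup>L (lebesgue_on S) (\<lambda>x. w x * partial_deriv e v x)
       = - integral\<^sup>L (lebesgue_on S) (\<lambda>x. v x * partial_deriv e w x)"
    using i1 i2 by simp
qed

section \<open>Averages over dilations and weak formulations\<close>

text \<open>The mean of \<open>F\<close> over the segment from 0 to \<open>t\<close>, written as an
  integral over \<open>{0..1}\<close>, needs no division by \<open>t\<close> and so makes sense at
  \<open>t = 0\<close>. The first part is differentiation under the integral; the second,
  \<open>J + t J' = F\<close> for the mean \<open>J\<close>, integrates the derivative of
  \<open>s F (s t)\<close> in \<open>s\<close>.\<close>

lemma dilation_average:
  fixes F F' :: "real \<Rightarrow> real"
  assumes U: "open U" "convex U" "0 \<in> U" "t \<in> U"
    and D: "\<And>x. x \<in> U \<Longrightarrow> (F has_real_derivative F' x) (at x)"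
    and cont: "continuous_on U F'"
  shows "((\<lambda>t. integral {0..1} (\<lambda>s. s ^ n * F (s * t))) has_real_derivative
      integral {0..1} (\<lambda>s. s ^ Suc n * F' (s * t))) (at t)"
    and "integral {0..1} (\<lambda>s. F (s * t)) + t * integral {0..1} (\<lambda>s. s * F' (s * t)) = F t"
proof -
  have mem: "s * x \<in> U" if "x \<in> U" "s \<in> {0..1}" for s x
    using convexD[OF U(2) \<open>x \<in> U\<close> U(3), of s "1 - s"] that by auto
  have Fc: "continuous_on U F"
    using D by (auto intro!: continuous_at_imp_continuous_on DERIV_isCont)
  have "((\<lambda>t. integral (cbox 0 1) (\<lambda>s. s ^ n * F (s * t))) has_real_derivative
      integral (cbox 0 1) (\<lambda>s. s ^ Suc n * F' (s * t))) (at t within U)"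
  proof (rule leibniz_rule_field_derivative[OF _ _ _ U(4,2)])
    fix x s :: real assume "x \<in> U" "s \<in> cbox 0 1"
    then have "s * x \<in> U" using mem by auto
    then have "((\<lambda>x. s ^ n * F (s * x)) has_real_derivative s ^ n * (F' (s * x) * s)) (at x)"
      by (auto intro!: derivative_eq_intros DERIV_chain2[OF D])
    then show "((\<lambda>x. s ^ n * F (s * x)) has_real_derivative s ^ Suc n * F' (s * x)) (at x within U)"
      by (auto intro: has_field_derivative_at_within simp: mult_ac)
  next
    fix x assume "x \<in> U"
    then show "(\<lambda>s. s ^ n * F (s * x)) integrable_on cbox 0 1"
      using mem by (intro integrable_continuous continuous_intros continuous_on_compose2[OF Fc]) auto
  next
    show "continuous_on (U \<times> cbox 0 1) (\<lambda>(x, s). s ^ Suc n * F' (s * x))"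
      using mem unfolding case_prod_beta
      by (intro continuous_intros continuous_on_compose2[OF cont]) auto
  qed
  then show "((\<lambda>t. integral {0..1} (\<lambda>s. s ^ n * F (s * t))) has_real_derivative
      integral {0..1} (\<lambda>s. s ^ Suc n * F' (s * t))) (at t)"
    by (simp only: at_within_open[OF U(4,1)] cbox_interval)
  have i1: "(\<lambda>s. F (s * t)) integrable_on {0..1}"
    using mem U(4) by (intro integrable_continuous_interval continuous_intros continuous_on_compose2[OF Fc]) auto
  have i2: "(\<lambda>s. s * F' (s * t)) integrable_on {0..1}"
    using mem U(4) by (intro integrable_continuous_interval continuous_intros continuous_on_compose2[OF cont]) auto
  have "((\<lambda>s. F (s * t) + t * (s * F' (s * t))) has_integral (1 * F (1 * t) - 0 * F (0 * t))) {0..1}"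
  proof (rule fundamental_theorem_of_calculus)
    fix s :: real assume "s \<in> {0..1}"
    then have "s * t \<in> U" using mem U(4) by auto
    then have "((\<lambda>s. s * F (s * t)) has_real_derivative F (s * t) + t * (s * F' (s * t))) (at s)"
      by (auto intro!: derivative_eq_intros DERIV_chain2[OF D])
    then show "((\<lambda>s. s * F (s * t)) has_vector_derivative F (s * t) + t * (s * F' (s * t))) (at s within {0..1})"
      by (simp add: has_real_derivative_iff_has_vector_derivative has_vector_derivative_at_within)
  qed simp
  then have "integral {0..1} (\<lambda>s. F (s * t) + t * (s * F' (s * t))) = F t"
    by (simp add: integral_unique)
  then show "integral {0..1} (\<lambda>s. F (s * t)) + t * integral {0..1} (\<lambda>s. s * F' (s * t)) = F t"
    using i1 i2 by (simp add: integral_add integrable_on_mult_right)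
qed

lemma smooth_on_dilation_average:
  fixes F :: "real \<Rightarrow> real"
  assumes U: "open U" "convex U" "0 \<in> U" and F: "smooth_on U F"
  shows "smooth_on U (\<lambda>t. integral {0..1} (\<lambda>s. F (s * t)))"
proof -
  \<comment> \<open>Each differentiation raises the power of \<open>s\<close> by one and replaces
    \<open>F\<close> by its derivative, so the induction has to run over all weights
    \<open>s ^ n\<close>; the claim is the case \<open>n = 0\<close>.\<close>
  have "C_on k U (\<lambda>t. integral {0..1} (\<lambda>s. s ^ n * F (s * t)))"
    if "smooth_on U F" for k n and F :: "real \<Rightarrow> real"
    using that
  proof (induction k arbitrary: n F)
    case (0 n F)
    have D: "(F has_real_derivative partial_deriv 1 F x) (at x)" if "x \<in> U" for x
      using 0 that by (intro has_real_derivative_partial_deriv) (rule smooth_on_imp_differentiable)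
    have c: "continuous_on U (partial_deriv 1 F)"
      using 0 by (intro smooth_on_imp_continuous_on smooth_on_partial_deriv) auto
    show ?case
      using dilation_average(1)[OF U _ D c]
      by (auto intro!: continuous_at_imp_continuous_on DERIV_isCont)
  next
    case (Suc k n F)
    have D: "(F has_real_derivative partial_deriv 1 F x) (at x)" if "x \<in> U" for x
      using Suc.prems that by (intro has_real_derivative_partial_deriv) (rule smooth_on_imp_differentiable)
    have s: "smooth_on U (partial_deriv 1 F)"
      using Suc.prems by (intro smooth_on_partial_deriv) auto
    let ?G = "\<lambda>t. integral {0..1} (\<lambda>s. s ^ n * F (s * t))"
    let ?G' = "\<lambda>t. integral {0..1} (\<lambda>s. s ^ Suc n * partial_deriv 1 F (s * t))"
    have G: "(?G has_real_derivative ?G' t) (at t)" if "t \<in> U" for t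
      using dilation_average(1)[OF U that D smooth_on_imp_continuous_on[OF s]] by blast
    then have eq: "?G' t = partial_deriv 1 ?G t" if "t \<in> U" for t
      using partial_deriv_eq[OF G[OF that, unfolded has_field_derivative_def], of 1] by simp
    have "C_on k U (partial_deriv 1 ?G)"
      by (rule C_on_cong[OF U(1) eq Suc.IH[OF s]])
    moreover have "?G differentiable (at t)" if "t \<in> U" for t
      using G[OF that] real_differentiable_def by blast
    ultimately show ?case by simp
  qed
  from this[OF F, of _ 0] show ?thesis by (simp add: smooth_on_def)
qed

section \<open>Weak formulations for smooth fields\<close>

lemma smooth_on_inner_Basis:
  assumes "open S" "smooth_on S b"
  shows "smooth_on S (\<lambda>x. b x \<bullet> e)"
proof -
  have "C_on k S (\<lambda>x. b x \<bullet> e)" if "C_on k S b" for k and b :: "'a \<Rightarrow> 'b"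
    using that
  proof (induction k arbitrary: b)
    case (Suc k b)
    have d: "((\<lambda>x. b x \<bullet> e) has_derivative (\<lambda>h. partial_deriv h b x \<bullet> e)) (at x)" if "x \<in> S" for x
      using Suc.prems that by (intro has_derivative_inner_left has_derivative_partial_deriv) auto
    have "C_on k S (partial_deriv h (\<lambda>x. b x \<bullet> e))" if "h \<in> Basis" for h
      by (rule C_on_cong[OF assms(1) _ Suc.IH[of "partial_deriv h b"]])
        (use Suc.prems that partial_deriv_eq[OF d] in auto)
    then show ?case using d by (auto simp: differentiable_def)
  qed (auto intro: continuous_intros)
  then show ?thesis using assms(2) by (simp add: smooth_on_def)
qed

lemma divergence_free_smooth:
  fixes b :: "'a::euclidean_space \<Rightarrow> 'a"
  assumes S: "open S" and b: "smooth_on S b"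
    and div: "\<And>x. x \<in> S \<Longrightarrow> (\<Sum>e\<in>Basis. partial_deriv e (\<lambda>x. b x \<bullet> e) x) = 0"
  shows "divergence_free S b"
  unfolding divergence_free_def
proof (intro allI impI)
  fix v assume v: "test_fun S v"
  have be: "smooth_on S (\<lambda>x. b x \<bullet> e)" for e by (rule smooth_on_inner_Basis[OF S b])
  note ibp = test_fun_integral_by_parts[OF S v _ smooth_on_imp_differentiable[OF be]
      smooth_on_imp_continuous_on[OF smooth_on_partial_deriv[OF be]]]
  have "integral\<^sup>L (lebesgue_on S) (\<lambda>x. b x \<bullet> grad v x)
      = integral\<^sup>L (lebesgue_on S) (\<lambda>x. \<Sum>e\<in>Basis. (b x \<bullet> e) * partial_deriv e v x)"
    by (simp add: grad_def inner_sum_right mult.commute)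
  also have "\<dots> = (\<Sum>e\<in>Basis. integral\<^sup>L (lebesgue_on S) (\<lambda>x. (b x \<bullet> e) * partial_deriv e v x))"
    using ibp(1) by (intro Bochner_Integration.integral_sum) auto
  also have "\<dots> = (\<Sum>e\<in>Basis. - integral\<^sup>L (lebesgue_on S) (\<lambda>x. v x * partial_deriv e (\<lambda>x. b x \<bullet> e) x))"
    using ibp(3) by (intro sum.cong) auto
  also have "\<dots> = - integral\<^sup>L (lebesgue_on S) (\<lambda>x. \<Sum>e\<in>Basis. v x * partial_deriv e (\<lambda>x. b x \<bullet> e) x)"
    using ibp(2) by (subst Bochner_Integration.integral_sum) (auto simp: sum_negf)
  also have "\<dots> = - integral\<^sup>L (lebesgue_on S) (\<lambda>x. 0)"
    using div by (intro arg_cong[where f=uminus] Bochner_Integration.integral_cong)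
      (auto simp: sum_distrib_left[symmetric])
  finally show "integral\<^sup>L (lebesgue_on S) (\<lambda>x. b x \<bullet> grad v x) = 0" by simp
qed

text \<open>Two integrations by parts move the Laplacian onto \<open>u\<close>; a third moves the
  gradient onto \<open>u b\<close>, whose divergence is \<open>b . grad u\<close> because
  \<open>b\<close> has divergence 0.\<close>

lemma smooth_classical_imp_distributional_solution:
  fixes b :: "'a::euclidean_space \<Rightarrow> 'a"
  assumes S: "open S" and b: "smooth_on S b" and u: "smooth_on S u"
    and div: "\<And>x. x \<in> S \<Longrightarrow> (\<Sum>e\<in>Basis. partial_deriv e (\<lambda>x. b x \<bullet> e) x) = 0"
    and sol: "classical_solution S b u"
  shows "distributional_solution S b u"
  unfolding distributional_solution_def
proof (intro allI impI)
  fix v assume v: "test_fun S v"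
  have be: "smooth_on S (\<lambda>x. b x \<bullet> e)" for e by (rule smooth_on_inner_Basis[OF S b])
  have ube: "smooth_on S (\<lambda>x. u x * (b x \<bullet> e))" for e by (rule smooth_on_mult[OF S u be])
  have ue: "smooth_on S (partial_deriv e u)" if "e \<in> Basis" for e
    using smooth_on_partial_deriv[OF u that] .
  have i1: "integrable (lebesgue_on S) (\<lambda>x. u x * partial_deriv e (partial_deriv e v) x)"
    "integral\<^sup>L (lebesgue_on S) (\<lambda>x. u x * partial_deriv e (partial_deriv e v) x) =
      - integral\<^sup>L (lebesgue_on S) (\<lambda>x. partial_deriv e v x * partial_deriv e u x)"
    if "e \<in> Basis" for e
    using test_fun_integral_by_parts[OF S test_fun_partial_deriv[OF v that] that
        smooth_on_imp_differentiable[OF u] smooth_on_imp_continuous_on[OF ue[OF that]]] by auto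
  have i2: "integrable (lebesgue_on S) (\<lambda>x. v x * partial_deriv e (partial_deriv e u) x)"
    "integral\<^sup>L (lebesgue_on S) (\<lambda>x. partial_deriv e v x * partial_deriv e u x) =
      - integral\<^sup>L (lebesgue_on S) (\<lambda>x. v x * partial_deriv e (partial_deriv e u) x)"
    if "e \<in> Basis" for e
    using test_fun_integral_by_parts[OF S v that smooth_on_imp_differentiable[OF ue[OF that]]
        smooth_on_imp_continuous_on[OF smooth_on_partial_deriv[OF ue[OF that] that]]]
    by (auto simp: mult.commute)
  note i3 = test_fun_integral_by_parts[OF S v _ smooth_on_imp_differentiable[OF ube]
      smooth_on_imp_continuous_on[OF smooth_on_partial_deriv[OF ube]]]
  have pd: "partial_deriv e (\<lambda>x. u x * (b x \<bullet> e)) x =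
      u x * partial_deriv e (\<lambda>x. b x \<bullet> e) x + partial_deriv e u x * (b x \<bullet> e)" if "x \<in> S" for x e
    by (rule partial_deriv_eq, rule has_derivative_mult)
      (intro has_derivative_partial_deriv smooth_on_imp_differentiable[OF u that]
        smooth_on_imp_differentiable[OF be that])+
  have "integral\<^sup>L (lebesgue_on S) (\<lambda>x. u x * laplacian v x + u x * (b x \<bullet> grad v x))
      = integral\<^sup>L (lebesgue_on S) (\<lambda>x. \<Sum>e\<in>Basis. u x * partial_deriv e (partial_deriv e v) x
          + (u x * (b x \<bullet> e)) * partial_deriv e v x)"
    by (simp add: grad_def laplacian_def inner_sum_right sum.distrib sum_distrib_left mult_ac)
  also have "\<dots> = (\<Sum>e\<in>Basis. integral\<^sup>L (lebesgue_on S) (\<lambda>x. u x * partial_deriv e (partial_deriv e v) x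
          + (u x * (b x \<bullet> e)) * partial_deriv e v x))"
    using i1(1) i3(1) by (intro Bochner_Integration.integral_sum) auto
  also have "\<dots> = (\<Sum>e\<in>Basis. integral\<^sup>L (lebesgue_on S) (\<lambda>x. v x * partial_deriv e (partial_deriv e u) x
        - v x * partial_deriv e (\<lambda>x. u x * (b x \<bullet> e)) x))"
    using i1 i2 i3 by (intro sum.cong) auto
  also have "\<dots> = integral\<^sup>L (lebesgue_on S) (\<lambda>x. \<Sum>e\<in>Basis. v x * partial_deriv e (partial_deriv e u) x
        - v x * partial_deriv e (\<lambda>x. u x * (b x \<bullet> e)) x)"
    using i2(1) i3(2) by (intro Bochner_Integration.integral_sum[symmetric]) auto
  also have "\<dots> = integral\<^sup>L (lebesgue_on S) (\<lambda>x. 0)"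
  proof (intro Bochner_Integration.integral_cong refl)
    fix x assume "x \<in> space (lebesgue_on S)"
    then have x: "x \<in> S" by simp
    have "(\<Sum>e\<in>Basis. v x * partial_deriv e (partial_deriv e u) x
        - v x * partial_deriv e (\<lambda>x. u x * (b x \<bullet> e)) x)
      = v x * (laplacian u x - u x * (\<Sum>e\<in>Basis. partial_deriv e (\<lambda>x. b x \<bullet> e) x) - b x \<bullet> grad u x)"
      by (simp add: pd[OF x] laplacian_def grad_def inner_sum_right sum_subtractf sum.distrib
          sum_distrib_left algebra_simps)
    also have "\<dots> = 0" using sol x div[OF x] by (simp add: classical_solution_def)
    finally show "(\<Sum>e\<in>Basis. v x * partial_deriv e (partial_deriv e u) x
        - v x * partial_deriv e (\<lambda>x. u x * (b x \<bullet> e)) x) = 0" .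
  qed
  finally show "integral\<^sup>L (lebesgue_on S) (\<lambda>x. u x * laplacian v x + u x * (b x \<bullet> grad v x)) = 0"
    by simp
qed

lemma smooth_on_weak_gradient:
  fixes u :: "'a::euclidean_space \<Rightarrow> real"
  assumes S: "open S" and u: "smooth_on S u" and v: "test_fun S v"
  shows "integral\<^sup>L (lebesgue_on S) (\<lambda>x. u x *\<^sub>R grad v x) =
        - integral\<^sup>L (lebesgue_on S) (\<lambda>x. v x *\<^sub>R grad u x)"
proof -
  note ibp = test_fun_integral_by_parts[OF S v _ smooth_on_imp_differentiable[OF u]
      smooth_on_imp_continuous_on[OF smooth_on_partial_deriv[OF u]]]
  have "integral\<^sup>L (lebesgue_on S) (\<lambda>x. u x *\<^sub>R grad v x)
      = (\<Sum>e\<in>Basis. integral\<^sup>L (lebesgue_on S) (\<lambda>x. u x * partial_deriv e v x) *\<^sub>R e)"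
    unfolding grad_def scaleR_sum_right scaleR_scaleR
    using ibp(1) by (subst Bochner_Integration.integral_sum) auto
  also have "\<dots> = - (\<Sum>e\<in>Basis. integral\<^sup>L (lebesgue_on S) (\<lambda>x. v x * partial_deriv e u x) *\<^sub>R e)"
    unfolding sum_negf[symmetric] using ibp(3) by (intro sum.cong) auto
  also have "(\<Sum>e\<in>Basis. integral\<^sup>L (lebesgue_on S) (\<lambda>x. v x * partial_deriv e u x) *\<^sub>R e)
      = integral\<^sup>L (lebesgue_on S) (\<lambda>x. v x *\<^sub>R grad u x)"
    unfolding grad_def scaleR_sum_right scaleR_scaleR
    using ibp(2) by (subst Bochner_Integration.integral_sum) auto
  finally show ?thesis .
qed

section \<open>The explicit solution\<close>

text \<open>Reduces the partial derivatives of the explicit formulas below to derivatives in one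
  real variable. Differentiability is a separate hypothesis because the derivative along a line does
  not give it; it will come from smoothness.\<close>

lemma partial_deriv_line:
  fixes f :: "'a::euclidean_space \<Rightarrow> real"
  assumes "f differentiable (at x)" "((\<lambda>s. f (x + s *\<^sub>R e)) has_real_derivative D) (at 0)"
  shows "partial_deriv e f x = D"
proof -
  have "(f has_derivative (\<lambda>e. partial_deriv e f x)) (at (x + 0 *\<^sub>R e))"
    using has_derivative_partial_deriv[OF assms(1)] by simp
  then have "((\<lambda>s. f (x + s *\<^sub>R e)) has_derivative (\<lambda>s. partial_deriv (s *\<^sub>R e) f x)) (at 0)"
    by (rule has_derivative_compose[rotated]) (auto intro!: derivative_eq_intros)
  then have "(\<lambda>s. partial_deriv (s *\<^sub>R e) f x) = (*) D"
    using assms(2) unfolding has_field_derivative_def by (rule has_derivative_unique)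
  from fun_cong[OF this, of 1] show ?thesis by simp
qed

lemma DERIV_radial_line:
  fixes H :: "real \<Rightarrow> real"
  assumes "(H has_real_derivative D) (at (a\<^sup>2 + b\<^sup>2))"
  shows "((\<lambda>s. H ((a + s)\<^sup>2 + b\<^sup>2)) has_real_derivative D * (2 * a)) (at 0)"
    and "((\<lambda>s. H (a\<^sup>2 + (b + s)\<^sup>2)) has_real_derivative D * (2 * b)) (at 0)"
proof -
  have "((\<lambda>s. (a + s)\<^sup>2 + b\<^sup>2) has_real_derivative 2 * a) (at 0)"
    "((\<lambda>s. a\<^sup>2 + (b + s)\<^sup>2) has_real_derivative 2 * b) (at 0)"
    by (rule derivative_eq_intros refl | simp)+
  from this[THEN DERIV_chain2[rotated]]
  show "((\<lambda>s. H ((a + s)\<^sup>2 + b\<^sup>2)) has_real_derivative D * (2 * a)) (at 0)"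
    "((\<lambda>s. H (a\<^sup>2 + (b + s)\<^sup>2)) has_real_derivative D * (2 * b)) (at 0)"
    using assms by simp_all
qed

lemma axis_nth_3 [simp]:
  "axis 1 (c::real) $ (1::3) = c" "axis 1 (c::real) $ (2::3) = 0" "axis 1 (c::real) $ (3::3) = 0"
  "axis 2 (c::real) $ (1::3) = 0" "axis 2 (c::real) $ (2::3) = c" "axis 2 (c::real) $ (3::3) = 0"
  "axis 3 (c::real) $ (1::3) = 0" "axis 3 (c::real) $ (2::3) = 0" "axis 3 (c::real) $ (3::3) = c"
  by (simp_all add: axis_def)

lemma sum_Basis_3:
  fixes f :: "real^3 \<Rightarrow> 'b::comm_monoid_add"
  shows "sum f Basis = f (axis 1 1) + f (axis 2 1) + f (axis 3 1)"
proof -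
  have B: "(Basis :: (real^3) set) = {axis 1 1, axis 2 1, axis 3 1}"
    by (auto simp: Basis_vec_def UNIV_3)
  have "axis 1 1 \<noteq> (axis 2 1 :: real^3)" "axis 1 1 \<noteq> (axis 3 1 :: real^3)" "axis 2 1 \<noteq> (axis 3 1 :: real^3)"
    by (metis axis_nth_3 zero_neq_one)+
  then show ?thesis unfolding B by (simp add: add.assoc)
qed

lemma axis_Basis_3: "axis i (1::real) \<in> (Basis :: (real^3) set)"
  by (simp add: axis_in_Basis_iff)

section \<open>The profile, the stream function and the drift\<close>

definition rsq :: "real^3 \<Rightarrow> real" where "rsq x = (x$1)\<^sup>2 + (x$2)\<^sup>2"

text \<open>The constant 3 keeps this away from 0: it is at least 2 for
  \<open>0 < t + d <= 2\<close> since ln 2 <= 1, and still positive for \<open>t + d < 3\<close>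
  since ln 3 <= 2.\<close>

definition ell :: "real \<Rightarrow> real \<Rightarrow> real" where "ell d t = 3 - ln (t + d)"

text \<open>The function \<open>a\<close> of the overview. The factor \<open>1 - k ell\<close> of
  its derivative vanishes where \<open>ell = 1 / k\<close>; the limit profile
  \<open>3 - ln t\<close> is the case \<open>k = d = 0\<close>.\<close>

definition prof :: "real \<Rightarrow> real \<Rightarrow> real \<Rightarrow> real"
  where "prof k d t = ell d t - k / 2 * (ell d t)\<^sup>2"

definition prof1 :: "real \<Rightarrow> real \<Rightarrow> real \<Rightarrow> real"
  where "prof1 k d t = - (1 - k * ell d t) / (t + d)"

definition prof2 :: "real \<Rightarrow> real \<Rightarrow> real \<Rightarrow> real"
  where "prof2 k d t = (1 - k * ell d t - k) / (t + d)\<^sup>2"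

text \<open>Write \<open>s = z A\<close> and \<open>Q = 1 / (1 + s^2)\<close>. The Laplacian divided
  by \<open>A Q\<close> must be the derivative in \<open>t\<close> of the stream function at fixed
  \<open>s\<close>. Replacing \<open>s^2 Q\<close> by \<open>1 - Q\<close> splits it into
  \<open>s\<close> times the derivative of \<open>2 t A1 / A^2\<close>, which integrates to
  \<open>2 z t A1 / A\<close>, and \<open>s Q\<close> times the present function.\<close>

definition src :: "real \<Rightarrow> real \<Rightarrow> real \<Rightarrow> real"
  where "src k d t = 4 * t * (prof1 k d t)\<^sup>2 / (prof k d t) ^ 3 - prof k d t"

definition src_avg :: "real \<Rightarrow> real \<Rightarrow> real \<Rightarrow> real"
  where "src_avg k d t = integral {0..1} (\<lambda>s. src k d (s * t))"

text \<open>The stream function is \<open>\<psi> = t J z A / (1 + (z A)\<^sup>2) + 2 z t A1 / A\<close>, where \<open>A1\<close>, \<open>A2\<close> are the derivatives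
  of the profile \<open>A\<close> and \<open>t J\<close> is the primitive of \<open>F = 4 t A1\<^sup>2 / A\<^sup>3 - A\<close> vanishing at \<open>0\<close>.
  The drift has the horizontal part \<open>- (x, y) \<psi>\<^sub>z / t\<close> and the vertical part \<open>2 \<psi>\<^sub>t\<close>. Dividing by \<open>t\<close> is
  smooth since \<open>J\<close> is an average of \<open>F\<close>.\<close>

definition drift_h :: "real \<Rightarrow> real \<Rightarrow> real \<Rightarrow> real \<Rightarrow> real"
  where "drift_h A A1 J z = J * A * (1 - (z * A)\<^sup>2) * (1 / (1 + (z * A)\<^sup>2))\<^sup>2 + 2 * A1 / A"

definition drift_v :: "real \<Rightarrow> real \<Rightarrow> real \<Rightarrow> real \<Rightarrow> real \<Rightarrow> real \<Rightarrow> real \<Rightarrow> real"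
  where "drift_v A A1 A2 J F t z =
    2 * (t * J * z * A1 * (1 - (z * A)\<^sup>2) * (1 / (1 + (z * A)\<^sup>2))\<^sup>2
      + z * A * (1 / (1 + (z * A)\<^sup>2)) * F + 2 * z * (A1 / A + t * A2 / A - t * A1\<^sup>2 / A\<^sup>2))"

definition drift :: "real \<Rightarrow> real \<Rightarrow> real^3 \<Rightarrow> real^3"
  where "drift k d x =
    (let t = rsq x; z = x$3; A = prof k d t; A1 = prof1 k d t; J = src_avg k d t; h = drift_h A A1 J z
     in vector [- (x$1 * h), - (x$2 * h), drift_v A A1 (prof2 k d t) J (src k d t) t z])"

definition pot :: "real \<Rightarrow> real \<Rightarrow> real^3 \<Rightarrow> real"
  where "pot k d x = arctan (x$3 * prof k d (rsq x)) / 2"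

lemma drift_nth:
  "drift k d x $ 1 = - (x$1 * drift_h (prof k d (rsq x)) (prof1 k d (rsq x)) (src_avg k d (rsq x)) (x$3))"
  "drift k d x $ 2 = - (x$2 * drift_h (prof k d (rsq x)) (prof1 k d (rsq x)) (src_avg k d (rsq x)) (x$3))"
  "drift k d x $ 3 = drift_v (prof k d (rsq x)) (prof1 k d (rsq x)) (prof2 k d (rsq x))
     (src_avg k d (rsq x)) (src k d (rsq x)) (rsq x) (x$3)"
  by (simp_all add: drift_def Let_def)

lemma ell_deriv: "t + d > 0 \<Longrightarrow> (ell d has_real_derivative - 1 / (t + d)) (at t)"
  unfolding ell_def[abs_def] by (auto intro!: derivative_eq_intros)

lemma prof_deriv: "t + d > 0 \<Longrightarrow> (prof k d has_real_derivative prof1 k d t) (at t)"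
  unfolding prof_def[abs_def] prof1_def
  by (auto intro!: derivative_eq_intros ell_deriv simp: divide_simps) (auto simp: algebra_simps)

lemma prof1_deriv:
  assumes "t + d > 0"
  shows "(prof1 k d has_real_derivative prof2 k d t) (at t)"
proof -
  have "((\<lambda>t. - (1 - k * ell d t) / (t + d)) has_real_derivative
     (- (0 - k * (- 1 / (t + d))) * (t + d) - - (1 - k * ell d t) * 1) / ((t + d) * (t + d))) (at t)"
    using assms by (auto intro!: derivative_eq_intros ell_deriv)
  also have "(- (0 - k * (- 1 / (t + d))) * (t + d) - - (1 - k * ell d t) * 1) / ((t + d) * (t + d)) = prof2 k d t"
    using assms by (simp add: prof2_def power2_eq_square)
  finally show ?thesis unfolding prof1_def[abs_def] .
qed

lemma one_plus_square_nonzero: "1 + (a::real)\<^sup>2 \<noteq> 0"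
  by (metis add_pos_nonneg less_irrefl zero_less_one zero_le_power2)

lemma DERIV_inverse_one_plus_square:
  fixes f :: "real \<Rightarrow> real"
  assumes "(f has_real_derivative D) (at s)"
  shows "((\<lambda>s. 1 / (1 + (f s)\<^sup>2)) has_real_derivative - ((1 / (1 + (f s)\<^sup>2))\<^sup>2 * (2 * f s * D))) (at s)"
  by (rule derivative_eq_intros assms refl one_plus_square_nonzero)+
    (simp add: power2_eq_square)

lemma arctan_half_deriv:
  fixes f :: "real \<Rightarrow> real"
  assumes "(f has_real_derivative D) (at s)"
  shows "((\<lambda>s. arctan (f s) / 2) has_real_derivative D / 2 * (1 / (1 + (f s)\<^sup>2))) (at s)"
  using DERIV_cdivide[OF DERIV_chain2[OF DERIV_arctan assms], of 2] by (simp add: field_simps)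

lemma drift_v_deriv:
  fixes A A1 A2 J F t z :: real
  defines "Q \<equiv> 1 / (1 + (z * A)\<^sup>2)"
  shows "((\<lambda>z. drift_v A A1 A2 J F t z) has_real_derivative
    2 * (t * J * (A1 * (1 - (z*A)\<^sup>2) * Q\<^sup>2 - 2 * (z*A)\<^sup>2 * A1 * Q\<^sup>2
      - 4 * (z*A)\<^sup>2 * A1 * (1 - (z*A)\<^sup>2) * Q^3)
     + F * A * (Q - 2 * (z*A)\<^sup>2 * Q\<^sup>2) + 2 * (A1 / A + t * A2 / A - t * A1\<^sup>2 / A\<^sup>2))) (at z)"
  unfolding drift_v_def Q_def
  by (rule DERIV_inverse_one_plus_square derivative_eq_intros refl)+
    (unfold Q_def[symmetric], simp add: power2_eq_square power3_eq_cube algebra_simps)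

text \<open>With this choice of \<open>k\<close> the derivative of the profile vanishes on the axis. The plain profile
  \<open>k = 0\<close> would produce a term of size \<open>d / ((t + d)\<^sup>2 ell)\<close> in the drift, which has no integrable
  majorant uniform in \<open>d\<close>.\<close>

locale regularized =
  fixes k d :: real
  assumes d: "0 < d" "d \<le> 1" and k: "k = 1 / ell d 0"
begin

text \<open>An open interval around all values of \<open>rsq\<close> that matter, including 0 on the
  axis, on which \<open>t + d\<close> stays above \<open>d / 2\<close>. The right end 2 makes the
  cylinder \<open>S\<close> contain the closed unit ball, so that smooth functions on
  \<open>S\<close> are bounded on the open ball.\<close>

abbreviation (input) "U \<equiv> {- d / 2 <..< 2}"
abbreviation (input) "S \<equiv> {x :: real^3. rsq x < 2}"

lemma ell_0_ge: "ell d 0 \<ge> 3"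
  using d by (simp add: ell_def)

lemma k_pos: "0 < k" using ell_0_ge by (simp add: k)

lemma U_props: "open U" "convex U" "0 \<in> U"
  using d by auto

text \<open>The profile is \<open>ell (1 - k ell / 2)\<close>, so \<open>2 / k\<close> is its second
  zero. On \<open>U\<close> the value of \<open>ell\<close> exceeds its axis value
  \<open>1 / k\<close> by less than ln 2 <= 1, and \<open>1 / k >= 3\<close>.\<close>

lemma ell_pos: assumes "t \<in> U" shows "0 < ell d t" "ell d t < 2 / k"
proof -
  have t: "0 < t + d" "t + d < 3" "d / 2 < t + d" using assms d by auto
  have "ln (t + d) < ln 3" using t by simp
  also have "ln 3 \<le> (2::real)" using ln_le_minus_one[of 3] by simp
  finally show "0 < ell d t" by (simp add: ell_def)
  have "ln d - ln 2 = ln (d / 2)" using d by (simp add: ln_div)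
  also have "\<dots> < ln (t + d)" using t d by simp
  finally have "ell d t < ell d 0 + ln 2" by (simp add: ell_def)
  also have "ln 2 \<le> (1::real)" using ln_le_minus_one[of 2] by simp
  finally show "ell d t < 2 / k" using ell_0_ge by (simp add: k)
qed

lemma prof_pos: assumes "t \<in> U" shows "prof k d t > 0"
proof -
  have "prof k d t = ell d t * (1 - k * ell d t / 2)"
    by (simp add: prof_def power2_eq_square algebra_simps)
  moreover have "1 - k * ell d t / 2 > 0"
    using ell_pos[OF assms] k_pos by (simp add: field_simps)
  ultimately show ?thesis using ell_pos[OF assms] by simp
qed

lemma shifted_pos: "t \<in> U \<Longrightarrow> t + d > 0"
  using d by auto

lemma smooth_ell: "smooth_on U (ell d)"
  unfolding ell_def[abs_def] using shifted_pos U_props(1) by (auto intro!: smooth_intros)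

lemma smooth_prof: "smooth_on U (prof k d)" "smooth_on U (prof1 k d)" "smooth_on U (prof2 k d)"
  unfolding prof_def[abs_def] prof1_def[abs_def] prof2_def[abs_def]
  using smooth_ell U_props(1)
  by (intro smooth_intros; use shifted_pos in \<open>force simp del: greaterThanLessThan_iff\<close>)+

lemma smooth_src: "smooth_on U (src k d)"
  unfolding src_def[abs_def]
  by (intro smooth_intros smooth_prof U_props(1);
    use prof_pos in \<open>force simp del: greaterThanLessThan_iff\<close>)

lemma smooth_src_avg: "smooth_on U (src_avg k d)"
  unfolding src_avg_def[abs_def] by (rule smooth_on_dilation_average[OF U_props smooth_src])

text \<open>The relation \<open>J + t J' = F\<close> is all that the divergence computation uses
  about the derivative of \<open>J\<close>.\<close>

lemma src_avg_deriv:
  assumes "t \<in> U"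
  obtains D where "(src_avg k d has_real_derivative D) (at t)" "src_avg k d t + t * D = src k d t"
proof -
  have D: "(src k d has_real_derivative partial_deriv 1 (src k d) x) (at x)" if "x \<in> U" for x
    by (rule has_real_derivative_partial_deriv[OF smooth_on_imp_differentiable[OF smooth_src that]])
  have c: "continuous_on U (partial_deriv 1 (src k d))"
    by (intro smooth_on_imp_continuous_on smooth_on_partial_deriv smooth_src) auto
  show ?thesis
    using dilation_average(1)[OF U_props assms D c, where n=0]
      dilation_average(2)[OF U_props assms D c] that
    unfolding src_avg_def[abs_def] by (simp add: mult.commute)
qed

lemma rsq_U: "x \<in> S \<Longrightarrow> rsq x \<in> U"
  using d by (auto simp: rsq_def intro: less_le_trans[of _ 0])

lemma open_S: "open S"
  unfolding rsq_def by (intro open_Collect_less continuous_intros)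

lemma smooth_radial:
  fixes g :: "real \<Rightarrow> real"
  shows "smooth_on U g \<Longrightarrow> smooth_on S (\<lambda>x. g (rsq x))"
  using rsq_U unfolding rsq_def[abs_def]
  by (intro smooth_on_compose[OF open_S[unfolded rsq_def], of U g] smooth_intros open_S[unfolded rsq_def]) auto

lemma smooth_rsq: "smooth_on S rsq"
  using smooth_radial[OF smooth_on_id] .

lemma smooth_pot: "smooth_on S (pot k d)"
  unfolding pot_def[abs_def]
  by (intro smooth_intros open_S smooth_radial smooth_prof) auto

lemma smooth_drift_nth: "smooth_on S (\<lambda>x. drift k d x $ i)"
proof -
  have "smooth_on S (\<lambda>x. drift k d x $ 1)" "smooth_on S (\<lambda>x. drift k d x $ 2)" 
    "smooth_on S (\<lambda>x. drift k d x $ 3)"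
    unfolding drift_nth drift_h_def drift_v_def
    by (intro smooth_intros open_S smooth_radial smooth_prof smooth_src smooth_src_avg smooth_rsq;
      use prof_pos rsq_U one_plus_square_nonzero in fastforce)+
  then show ?thesis using exhaust_3[of i] by auto
qed

lemma smooth_drift: "smooth_on S (drift k d)"
proof -
  have "drift k d = (\<lambda>x. drift k d x $ 1 *\<^sub>R (axis 1 1 :: real^3) + drift k d x $ 2 *\<^sub>R (axis 2 1 :: real^3) + drift k d x $ 3 *\<^sub>R (axis 3 1 :: real^3))"
    by (simp add: fun_eq_iff vec_eq_iff forall_3)
  moreover have "smooth_on S (\<lambda>x. drift k d x $ 1 *\<^sub>R (axis 1 1 :: real^3) + drift k d x $ 2 *\<^sub>R (axis 2 1 :: real^3) + drift k d x $ 3 *\<^sub>R (axis 3 1 :: real^3))"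
    by (intro smooth_intros open_S smooth_drift_nth)
  ultimately show ?thesis by simp
qed

lemma drift_h_deriv:
  fixes z :: real
  assumes t: "t \<in> U" and J: "(src_avg k d has_real_derivative J1) (at t)"
  defines "A \<equiv> prof k d t" and "A1 \<equiv> prof1 k d t" and "A2 \<equiv> prof2 k d t" and "J \<equiv> src_avg k d t"
  defines "Q \<equiv> 1 / (1 + (z * A)\<^sup>2)"
  shows "((\<lambda>t. drift_h (prof k d t) (prof1 k d t) (src_avg k d t) z) has_real_derivative
    J1 * A * (1 - (z * A)\<^sup>2) * Q\<^sup>2 + J * (A1 * (1 - (z*A)\<^sup>2) * Q\<^sup>2 - 2 * (z*A)\<^sup>2 * A1 * Q\<^sup>2
      - 4 * (z*A)\<^sup>2 * A1 * (1 - (z*A)\<^sup>2) * Q^3) + 2 * (A2 / A - A1\<^sup>2 / A\<^sup>2)) (at t)"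
proof -
  have A: "A \<noteq> 0" using prof_pos[OF t] by (simp add: A_def)
  show ?thesis
    unfolding drift_h_def A_def A1_def A2_def J_def Q_def
    by (rule DERIV_inverse_one_plus_square derivative_eq_intros J prof_deriv prof1_deriv shifted_pos t refl A[unfolded A_def])+
      (unfold A_def[symmetric] A1_def[symmetric] A2_def[symmetric] J_def[symmetric], unfold Q_def[symmetric],
        use A in \<open>simp add: power2_eq_square power3_eq_cube field_simps\<close>)
qed

text \<open>Equality of the mixed derivatives of the stream function: the horizontal part
  contributes \<open>- 2 h - 2 t h'\<close>, minus twice the \<open>t\<close>-derivative of
  \<open>t h\<close>, where \<open>t h\<close> is the \<open>z\<close>-derivative of the stream
  function; the vertical part is twice its \<open>t\<close>-derivative.\<close>

lemma divergence_drift: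
  assumes x: "x \<in> S"
  shows "(\<Sum>e\<in>Basis. partial_deriv e (\<lambda>x. drift k d x \<bullet> e) x) = 0"
proof -
  define t where "t = rsq x"
  have t: "t \<in> U" using rsq_U[OF x] by (simp add: t_def)
  obtain J1 where J: "(src_avg k d has_real_derivative J1) (at t)" "src_avg k d t + t * J1 = src k d t"
    using src_avg_deriv[OF t] by blast
  define z where "z = x$3"
  define A A1 A2 J Q F where "A = prof k d t" and "A1 = prof1 k d t" and "A2 = prof2 k d t"
    and "J = src_avg k d t" and "Q = 1 / (1 + (z * A)\<^sup>2)" and "F = src k d t"
  define H where "H = (\<lambda>t. drift_h (prof k d t) (prof1 k d t) (src_avg k d t) z)"
  define Hd where "Hd = J1 * A * (1 - (z * A)\<^sup>2) * Q\<^sup>2 + J * (A1 * (1 - (z*A)\<^sup>2) * Q\<^sup>2 - 2 * (z*A)\<^sup>2 * A1 * Q\<^sup>2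
      - 4 * (z*A)\<^sup>2 * A1 * (1 - (z*A)\<^sup>2) * Q^3) + 2 * (A2 / A - A1\<^sup>2 / A\<^sup>2)"
  have H: "(H has_real_derivative Hd) (at t)"
    using drift_h_deriv[OF t J(1), of z]
    by (simp add: H_def Hd_def A_def A1_def A2_def J_def Q_def)
  have dd: "(\<lambda>x. drift k d x $ i) differentiable (at x)" for i
    by (rule smooth_on_imp_differentiable[OF smooth_drift_nth x])
  have p1: "partial_deriv (axis 1 1) (\<lambda>x. drift k d x $ 1) x = - (H t + x$1 * (Hd * (2 * x$1)))"
  proof (rule partial_deriv_line[OF dd])
    have "((\<lambda>s. - ((x$1 + s) * H ((x$1 + s)\<^sup>2 + (x$2)\<^sup>2))) has_real_derivative
       - (H t + x$1 * (Hd * (2 * x$1)))) (at 0)"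
      by (rule derivative_eq_intros refl DERIV_radial_line[OF H[unfolded t_def rsq_def]])+
        (simp add: t_def rsq_def)
    then show "((\<lambda>s. drift k d (x + s *\<^sub>R axis 1 1) $ 1) has_real_derivative
       - (H t + x$1 * (Hd * (2 * x$1)))) (at 0)"
      by (simp add: drift_nth H_def rsq_def z_def)
  qed
  have p2: "partial_deriv (axis 2 1) (\<lambda>x. drift k d x $ 2) x = - (H t + x$2 * (Hd * (2 * x$2)))"
  proof (rule partial_deriv_line[OF dd])
    have "((\<lambda>s. - ((x$2 + s) * H ((x$1)\<^sup>2 + (x$2 + s)\<^sup>2))) has_real_derivative
       - (H t + x$2 * (Hd * (2 * x$2)))) (at 0)"
      by (rule derivative_eq_intros refl DERIV_radial_line[OF H[unfolded t_def rsq_def]])+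
        (simp add: t_def rsq_def)
    then show "((\<lambda>s. drift k d (x + s *\<^sub>R axis 2 1) $ 2) has_real_derivative
       - (H t + x$2 * (Hd * (2 * x$2)))) (at 0)"
      by (simp add: drift_nth H_def rsq_def z_def)
  qed
  define Vd where "Vd = 2 * (t * J * (A1 * (1 - (z*A)\<^sup>2) * Q\<^sup>2 - 2 * (z*A)\<^sup>2 * A1 * Q\<^sup>2
      - 4 * (z*A)\<^sup>2 * A1 * (1 - (z*A)\<^sup>2) * Q^3)
     + F * A * (Q - 2 * (z*A)\<^sup>2 * Q\<^sup>2) + 2 * (A1 / A + t * A2 / A - t * A1\<^sup>2 / A\<^sup>2))"
  have p3: "partial_deriv (axis 3 1) (\<lambda>x. drift k d x $ 3) x = Vd"
  proof (rule partial_deriv_line[OF dd])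
    have "((\<lambda>s. drift_v A A1 A2 J F t (z + s)) has_real_derivative Vd) (at 0)"
      using DERIV_shift[THEN iffD1, of "\<lambda>z. drift_v A A1 A2 J F t z" Vd 0 z]
        drift_v_deriv[of A A1 A2 J F t z] unfolding Vd_def Q_def
      by (simp add: add.commute)
    then show "((\<lambda>s. drift k d (x + s *\<^sub>R axis 3 1) $ 3) has_real_derivative Vd) (at 0)"
      by (simp add: drift_nth A_def A1_def A2_def J_def F_def t_def rsq_def z_def)
  qed
  have Q: "Q + (z * A)\<^sup>2 * Q = 1" using one_plus_square_nonzero[of "z * A"] by (simp add: Q_def divide_simps)
  have F: "F = J + t * J1" using J(2) by (simp add: J_def F_def)
  \<comment> \<open>Both sides are the derivative of \<open>s / (1 + s^2)\<close> at
    \<open>s = z A\<close>. In the second form the terms of \<open>F = J + t J1\<close> match those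
    of \<open>H t\<close> and \<open>Hd\<close>.\<close>
  have "Q - 2 * (z*A)\<^sup>2 * Q\<^sup>2 = (1 - (z*A)\<^sup>2) * Q\<^sup>2" using Q by algebra
  then have Vd2: "Vd = 2 * (t * J * (A1 * (1 - (z*A)\<^sup>2) * Q\<^sup>2 - 2 * (z*A)\<^sup>2 * A1 * Q\<^sup>2
      - 4 * (z*A)\<^sup>2 * A1 * (1 - (z*A)\<^sup>2) * Q^3)
     + F * A * ((1 - (z*A)\<^sup>2) * Q\<^sup>2) + 2 * (A1 / A + t * A2 / A - t * A1\<^sup>2 / A\<^sup>2))"
    by (simp add: Vd_def)
  have "Vd = 2 * H t + 2 * t * Hd"
    unfolding Vd2 Hd_def H_def drift_h_def F
      A_def[symmetric] A1_def[symmetric] J_def[symmetric] Q_def[symmetric]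
    by (simp add: algebra_simps)
  moreover have "2 * t * Hd = x$1 * (Hd * (2 * x$1)) + x$2 * (Hd * (2 * x$2))"
    by (simp add: t_def rsq_def power2_eq_square algebra_simps)
  ultimately show ?thesis
    by (simp add: sum_Basis_3 inner_axis p1 p2 p3)
qed

lemma pot_partial:
  assumes x: "x \<in> S"
  shows "partial_deriv (axis 1 1) (pot k d) x = x$1 * x$3 * prof1 k d (rsq x) * (1 / (1 + (x$3 * prof k d (rsq x))\<^sup>2))"
    and "partial_deriv (axis 2 1) (pot k d) x = x$2 * x$3 * prof1 k d (rsq x) * (1 / (1 + (x$3 * prof k d (rsq x))\<^sup>2))"
    and "partial_deriv (axis 3 1) (pot k d) x = prof k d (rsq x) / 2 * (1 / (1 + (x$3 * prof k d (rsq x))\<^sup>2))"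
proof -
  note dd = smooth_on_imp_differentiable[OF smooth_pot x]
  note P = prof_deriv[OF shifted_pos[OF rsq_U[OF x]], of k, unfolded rsq_def]
  show "partial_deriv (axis 1 1) (pot k d) x = x$1 * x$3 * prof1 k d (rsq x) * (1 / (1 + (x$3 * prof k d (rsq x))\<^sup>2))"
  proof (rule partial_deriv_line[OF dd])
    have "((\<lambda>s. arctan (x$3 * prof k d ((x$1 + s)\<^sup>2 + (x$2)\<^sup>2)) / 2) has_real_derivative
       x$1 * x$3 * prof1 k d (rsq x) * (1 / (1 + (x$3 * prof k d (rsq x))\<^sup>2))) (at 0)"
      using arctan_half_deriv[OF DERIV_cmult[OF DERIV_radial_line(1)[OF P], of "x$3"]]
      by (simp add: rsq_def mult_ac)
    then show "((\<lambda>s. pot k d (x + s *\<^sub>R axis 1 1)) has_real_derivative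
       x$1 * x$3 * prof1 k d (rsq x) * (1 / (1 + (x$3 * prof k d (rsq x))\<^sup>2))) (at 0)"
      by (simp add: pot_def rsq_def)
  qed
  show "partial_deriv (axis 2 1) (pot k d) x = x$2 * x$3 * prof1 k d (rsq x) * (1 / (1 + (x$3 * prof k d (rsq x))\<^sup>2))"
  proof (rule partial_deriv_line[OF dd])
    have "((\<lambda>s. arctan (x$3 * prof k d ((x$1)\<^sup>2 + (x$2 + s)\<^sup>2)) / 2) has_real_derivative
       x$2 * x$3 * prof1 k d (rsq x) * (1 / (1 + (x$3 * prof k d (rsq x))\<^sup>2))) (at 0)"
      using arctan_half_deriv[OF DERIV_cmult[OF DERIV_radial_line(2)[OF P], of "x$3"]]
      by (simp add: rsq_def mult_ac)
    then show "((\<lambda>s. pot k d (x + s *\<^sub>R axis 2 1)) has_real_derivative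
       x$2 * x$3 * prof1 k d (rsq x) * (1 / (1 + (x$3 * prof k d (rsq x))\<^sup>2))) (at 0)"
      by (simp add: pot_def rsq_def)
  qed
  show "partial_deriv (axis 3 1) (pot k d) x = prof k d (rsq x) / 2 * (1 / (1 + (x$3 * prof k d (rsq x))\<^sup>2))"
  proof (rule partial_deriv_line[OF dd])
    have "((\<lambda>s. arctan ((x$3 + s) * prof k d (rsq x)) / 2) has_real_derivative
       prof k d (rsq x) / 2 * (1 / (1 + (x$3 * prof k d (rsq x))\<^sup>2))) (at 0)"
    proof (rule DERIV_cong[OF arctan_half_deriv])
      show "((\<lambda>s. (x$3 + s) * prof k d (rsq x)) has_real_derivative prof k d (rsq x)) (at 0)"
        by (rule derivative_eq_intros refl)+ simp
    qed simp
    then show "((\<lambda>s. pot k d (x + s *\<^sub>R axis 3 1)) has_real_derivative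
       prof k d (rsq x) / 2 * (1 / (1 + (x$3 * prof k d (rsq x))\<^sup>2))) (at 0)"
      by (simp add: pot_def rsq_def)
  qed
qed

text \<open>The drift term equals \<open>A Q\<close> times the \<open>t\<close>-derivative of the
  stream function at fixed \<open>z A\<close>, and \<open>src\<close> was chosen to make this the
  Laplacian. The stream function itself does not appear; the resulting identity is checked on the
  explicit formulas.\<close>

lemma pot_solution: "classical_solution S (drift k d) (pot k d)"
  unfolding classical_solution_def
proof
  fix x assume x: "x \<in> S"
  define t where "t = rsq x"
  have t: "t \<in> U" using rsq_U[OF x] by (simp add: t_def)
  define z where "z = x$3"
  define A A1 A2 J Q F where "A = prof k d t" and "A1 = prof1 k d t" and "A2 = prof2 k d t"
    and "J = src_avg k d t" and "Q = 1 / (1 + (z * A)\<^sup>2)" and "F = src k d t"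
  have A: "A \<noteq> 0" using prof_pos[OF t] by (simp add: A_def)
  have dd: "partial_deriv (axis i 1) (pot k d) differentiable (at x)" for i
    by (rule smooth_on_imp_differentiable[OF smooth_on_partial_deriv[OF smooth_pot axis_Basis_3] x])
  note P = prof_deriv[OF shifted_pos[OF t], of k, unfolded t_def rsq_def]
  note P1 = prof1_deriv[OF shifted_pos[OF t], of k, unfolded t_def rsq_def]
  let ?G = "\<lambda>t. z * prof1 k d t * (1 / (1 + (z * prof k d t)\<^sup>2))"
  have G: "(?G has_real_derivative z * A2 * Q - 2 * z^3 * A * A1\<^sup>2 * Q\<^sup>2) (at t)"
    by (rule DERIV_inverse_one_plus_square derivative_eq_intros refl prof_deriv prof1_deriv shifted_pos t)+
      (unfold A_def[symmetric] A1_def[symmetric] A2_def[symmetric], unfold Q_def[symmetric],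
        simp add: power2_eq_square power3_eq_cube algebra_simps)
  have p1: "partial_deriv (axis 1 1) (partial_deriv (axis 1 1) (pot k d)) x
      = z * A1 * Q + x$1 * ((z * A2 * Q - 2 * z^3 * A * A1\<^sup>2 * Q\<^sup>2) * (2 * x$1))"
  proof -
    have "partial_deriv (axis 1 1) (partial_deriv (axis 1 1) (pot k d)) x
      = partial_deriv (axis 1 1) (\<lambda>x. x$1 * x$3 * prof1 k d (rsq x) * (1 / (1 + (x$3 * prof k d (rsq x))\<^sup>2))) x"
      by (rule partial_deriv_cong[OF open_S x dd pot_partial(1)])
    also have "\<dots> = z * A1 * Q + x$1 * ((z * A2 * Q - 2 * z^3 * A * A1\<^sup>2 * Q\<^sup>2) * (2 * x$1))"
    proof (rule partial_deriv_line)
      show "(\<lambda>x. x$1 * x$3 * prof1 k d (rsq x) * (1 / (1 + (x$3 * prof k d (rsq x))\<^sup>2))) differentiable (at x)"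
        by (rule smooth_on_imp_differentiable[OF _ x])
          (intro smooth_intros open_S smooth_radial smooth_prof one_plus_square_nonzero)
      have "((\<lambda>s. (x$1 + s) * ?G ((x$1 + s)\<^sup>2 + (x$2)\<^sup>2)) has_real_derivative
         (?G t + x$1 * ((z * A2 * Q - 2 * z^3 * A * A1\<^sup>2 * Q\<^sup>2) * (2 * x$1)))) (at 0)"
        by (rule DERIV_mult[THEN DERIV_cong] DERIV_radial_line[OF G[unfolded t_def rsq_def]] derivative_eq_intros refl)+
          (simp add: t_def rsq_def)
      then show "((\<lambda>s. (x + s *\<^sub>R axis 1 1)$1 * (x + s *\<^sub>R axis 1 1)$3 * prof1 k d (rsq (x + s *\<^sub>R axis 1 1)) *
          (1 / (1 + ((x + s *\<^sub>R axis 1 1)$3 * prof k d (rsq (x + s *\<^sub>R axis 1 1)))\<^sup>2))) has_real_derivative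
         z * A1 * Q + x$1 * ((z * A2 * Q - 2 * z^3 * A * A1\<^sup>2 * Q\<^sup>2) * (2 * x$1))) (at 0)"
        by (simp add: rsq_def z_def A1_def Q_def A_def mult.assoc)
    qed
    finally show ?thesis .
  qed
  have p2: "partial_deriv (axis 2 1) (partial_deriv (axis 2 1) (pot k d)) x
      = z * A1 * Q + x$2 * ((z * A2 * Q - 2 * z^3 * A * A1\<^sup>2 * Q\<^sup>2) * (2 * x$2))"
  proof -
    have "partial_deriv (axis 2 1) (partial_deriv (axis 2 1) (pot k d)) x
      = partial_deriv (axis 2 1) (\<lambda>x. x$2 * x$3 * prof1 k d (rsq x) * (1 / (1 + (x$3 * prof k d (rsq x))\<^sup>2))) x"
      by (rule partial_deriv_cong[OF open_S x dd pot_partial(2)])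
    also have "\<dots> = z * A1 * Q + x$2 * ((z * A2 * Q - 2 * z^3 * A * A1\<^sup>2 * Q\<^sup>2) * (2 * x$2))"
    proof (rule partial_deriv_line)
      show "(\<lambda>x. x$2 * x$3 * prof1 k d (rsq x) * (1 / (1 + (x$3 * prof k d (rsq x))\<^sup>2))) differentiable (at x)"
        by (rule smooth_on_imp_differentiable[OF _ x])
          (intro smooth_intros open_S smooth_radial smooth_prof one_plus_square_nonzero)
      have "((\<lambda>s. (x$2 + s) * ?G ((x$1)\<^sup>2 + (x$2 + s)\<^sup>2)) has_real_derivative
         (?G t + x$2 * ((z * A2 * Q - 2 * z^3 * A * A1\<^sup>2 * Q\<^sup>2) * (2 * x$2)))) (at 0)"
        by (rule DERIV_mult[THEN DERIV_cong] DERIV_radial_line[OF G[unfolded t_def rsq_def]] derivative_eq_intros refl)+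
          (simp add: t_def rsq_def)
      then show "((\<lambda>s. (x + s *\<^sub>R axis 2 1)$2 * (x + s *\<^sub>R axis 2 1)$3 * prof1 k d (rsq (x + s *\<^sub>R axis 2 1)) *
          (1 / (1 + ((x + s *\<^sub>R axis 2 1)$3 * prof k d (rsq (x + s *\<^sub>R axis 2 1)))\<^sup>2))) has_real_derivative
         z * A1 * Q + x$2 * ((z * A2 * Q - 2 * z^3 * A * A1\<^sup>2 * Q\<^sup>2) * (2 * x$2))) (at 0)"
        by (simp add: rsq_def z_def A1_def Q_def A_def mult.assoc)
    qed
    finally show ?thesis .
  qed
  have p3: "partial_deriv (axis 3 1) (partial_deriv (axis 3 1) (pot k d)) x = - (z * A^3 * Q\<^sup>2)"
  proof -
    have "partial_deriv (axis 3 1) (partial_deriv (axis 3 1) (pot k d)) x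
      = partial_deriv (axis 3 1) (\<lambda>x. prof k d (rsq x) / 2 * (1 / (1 + (x$3 * prof k d (rsq x))\<^sup>2))) x"
      by (rule partial_deriv_cong[OF open_S x dd pot_partial(3)])
    also have "\<dots> = - (z * A^3 * Q\<^sup>2)"
    proof (rule partial_deriv_line)
      show "(\<lambda>x. prof k d (rsq x) / 2 * (1 / (1 + (x$3 * prof k d (rsq x))\<^sup>2))) differentiable (at x)"
        by (rule smooth_on_imp_differentiable[OF _ x])
          (intro smooth_intros open_S smooth_radial smooth_prof one_plus_square_nonzero; simp)
      have "((\<lambda>s. A / 2 * (1 / (1 + ((z + s) * A)\<^sup>2))) has_real_derivative - (z * A^3 * Q\<^sup>2)) (at 0)"
        by (rule DERIV_inverse_one_plus_square derivative_eq_intros refl)+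
          (simp add: Q_def power2_eq_square power3_eq_cube)
      then show "((\<lambda>s. prof k d (rsq (x + s *\<^sub>R axis 3 1)) / 2 *
          (1 / (1 + ((x + s *\<^sub>R axis 3 1)$3 * prof k d (rsq (x + s *\<^sub>R axis 3 1)))\<^sup>2))) has_real_derivative
         - (z * A^3 * Q\<^sup>2)) (at 0)"
        by (simp add: rsq_def z_def A_def t_def)
    qed
    finally show ?thesis .
  qed
  have lap: "laplacian (pot k d) x = 2 * z * A1 * Q + 2 * t * (z * A2 * Q - 2 * z^3 * A * A1\<^sup>2 * Q\<^sup>2) - z * A^3 * Q\<^sup>2"
    unfolding laplacian_def sum_Basis_3 p1 p2 p3
    by (simp add: t_def rsq_def power2_eq_square algebra_simps)
  have "drift k d x \<bullet> grad (pot k d) x = drift k d x $ 1 * partial_deriv (axis 1 1) (pot k d) x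
     + drift k d x $ 2 * partial_deriv (axis 2 1) (pot k d) x + drift k d x $ 3 * partial_deriv (axis 3 1) (pot k d) x"
    unfolding grad_def inner_sum_right sum_Basis_3 by (simp add: inner_add_right inner_axis mult.commute)
  also have "\<dots> = - drift_h A A1 J z * t * z * A1 * Q + drift_v A A1 A2 J F t z * (A / 2 * Q)"
    unfolding drift_nth pot_partial[OF x]
    unfolding t_def[symmetric] z_def[symmetric] A_def[symmetric] A1_def[symmetric] A2_def[symmetric]
      J_def[symmetric] F_def[symmetric] Q_def[symmetric]
    by (simp add: t_def rsq_def power2_eq_square algebra_simps)
  also have "\<dots> = 2 * z * A1 * Q + 2 * t * (z * A2 * Q - 2 * z^3 * A * A1\<^sup>2 * Q\<^sup>2) - z * A^3 * Q\<^sup>2"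
  proof -
    \<comment> \<open>With \<open>W\<close> for the inverse of \<open>A\<close>, both sides are
      polynomials, and the relations \<open>A W = 1\<close> and \<open>(1 + (z A)^2) Q = 1\<close>
      suffice to identify them. \<open>J\<close> cancels.\<close>
    define W where "W = 1 / A"
    have W: "A * W = 1" using A by (simp add: W_def)
    have Q: "Q + (z * A)\<^sup>2 * Q = 1" using one_plus_square_nonzero[of "z * A"] by (simp add: Q_def divide_simps)
    have F: "F = 4 * t * A1\<^sup>2 * W^3 - A" by (simp add: F_def src_def A_def A1_def W_def power_divide)
    have h: "drift_h A A1 J z = J * A * (1 - (z * A)\<^sup>2) * Q\<^sup>2 + 2 * A1 * W"
      by (simp add: drift_h_def Q_def W_def)
    have v: "drift_v A A1 A2 J F t z = 2 * (t * J * z * A1 * (1 - (z * A)\<^sup>2) * Q\<^sup>2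
      + z * A * Q * F + 2 * z * (A1 * W + t * A2 * W - t * A1\<^sup>2 * W\<^sup>2))"
      by (simp add: drift_v_def Q_def W_def power_divide)
    show ?thesis unfolding h v unfolding F using W Q by algebra
  qed
  finally show "- laplacian (pot k d) x + drift k d x \<bullet> grad (pot k d) x = 0"
    using lap by simp
qed

end

section \<open>Bounds uniform in the regularization\<close>

text \<open>The derivative of \<open>1 / (3 - ln t)\<close>, hence integrable at 0; composed with
  \<open>rsq\<close> it dominates all the approximations.\<close>

definition majorant :: "real \<Rightarrow> real" where "majorant t = 1 / (t * (3 - ln t)\<^sup>2)"

text \<open>With \<open>l = 3 - ln y\<close> one has \<open>y = exp 3 * exp (- l)\<close>, and the
  fourth power of \<open>l / 4 <= exp (l / 4)\<close> gives \<open>l ^ 4 <= 256 exp l\<close>. So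
  this bounds \<open>y l ^ n\<close> for \<open>n <= 4\<close>.\<close>

definition log_const :: real where "log_const = 256 * exp 3"

lemma log_const_ge: "log_const \<ge> 1"
  using exp_ge_add_one_self[of 3] by (simp add: log_const_def)

lemma mult_log_power_le:
  assumes "y > 0" "3 - ln y \<ge> 1" "n \<le> 4"
  shows "y * (3 - ln y) ^ n \<le> log_const"
proof -
  let ?l = "3 - ln y"
  have "?l / 4 \<le> exp (?l / 4)"
    using exp_ge_add_one_self[of "?l / 4"] by linarith
  then have "(?l / 4) ^ 4 \<le> exp (?l / 4) ^ 4"
    using assms(2) by (intro power_mono) auto
  also have "\<dots> = exp ?l" by (simp add: exp_of_nat_mult[symmetric])
  finally have *: "?l ^ 4 \<le> 256 * exp ?l" by (simp add: power_divide)
  have "?l ^ n \<le> ?l ^ 4" using assms by (intro power_increasing) auto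
  then have "y * ?l ^ n \<le> y * (256 * exp ?l)"
    using * assms by (intro mult_left_mono) auto
  also have "\<dots> = log_const" using assms(1) by (simp add: exp_diff log_const_def)
  finally show ?thesis .
qed

lemma majorant_pos: "0 < t \<Longrightarrow> t < 1 \<Longrightarrow> 0 < majorant t"
proof -
  assume "0 < t" "t < 1"
  then have "0 < 3 - ln t" using ln_less_zero[of t] by linarith
  then show ?thesis using \<open>0 < t\<close> unfolding majorant_def
    by (intro divide_pos_pos mult_pos_pos zero_less_power) auto
qed

text \<open>\<open>y (3 - ln y)^2\<close> increases as long as \<open>3 - ln y >= 2\<close>. Applied
  with \<open>y = t + d <= 2\<close>, this removes \<open>d\<close> from the bounds. With
  \<open>q = sqrt (y / t)\<close> it follows from
  \<open>ln (y / t) = 2 ln q <= 2 (q - 1)\<close>.\<close>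

lemma majorant_mono:
  assumes "0 < t" "t \<le> y" "y \<le> 2"
  shows "1 / (y * (3 - ln y)\<^sup>2) \<le> majorant t"
proof -
  have "ln y \<le> ln 2" using assms by simp
  also have "ln 2 \<le> (1::real)" using ln_le_minus_one[of 2] by simp
  finally have l2: "3 - ln y \<ge> 2" by simp
  define q where "q = sqrt (y / t)"
  have q: "q \<ge> 1" "q\<^sup>2 = y / t" using assms by (auto simp: q_def)
  have "ln (y / t) = 2 * ln q" using q ln_realpow[of q 2] by simp
  also have "\<dots> \<le> 2 * (q - 1)" using q ln_le_minus_one[of q] by simp
  also have "\<dots> \<le> (3 - ln y) * (q - 1)" using q l2 by (intro mult_right_mono) auto
  finally have "3 - ln t \<le> q * (3 - ln y)"
    using assms by (simp add: ln_div algebra_simps)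
  moreover have "0 < 3 - ln t" using l2 assms ln_mono[of t y] by linarith
  ultimately have "(3 - ln t)\<^sup>2 \<le> (q * (3 - ln y))\<^sup>2" by (intro power_mono) auto
  also have "\<dots> = y / t * (3 - ln y)\<^sup>2" using q by (simp add: power_mult_distrib)
  finally have "t * (3 - ln t)\<^sup>2 \<le> y * (3 - ln y)\<^sup>2"
    using assms by (simp add: field_simps)
  then show ?thesis unfolding majorant_def
    using assms \<open>0 < 3 - ln t\<close> l2 by (intro divide_left_mono mult_pos_pos zero_less_power) auto
qed

lemma inverse_one_plus_square_bounds:
  fixes s :: real
  shows "\<bar>(1 - s\<^sup>2) * (1 / (1 + s\<^sup>2))\<^sup>2\<bar> \<le> 1" "\<bar>s * (1 / (1 + s\<^sup>2))\<bar> \<le> 1 / 2" "0 \<le> 1 / (1 + s\<^sup>2)" "1 / (1 + s\<^sup>2) \<le> 1"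
proof -
  have p: "1 + s\<^sup>2 \<ge> 1" by simp
  then have "0 < 1 + s\<^sup>2" by linarith
  with p show "0 \<le> 1 / (1 + s\<^sup>2)" "1 / (1 + s\<^sup>2) \<le> 1" by (simp_all add: divide_le_eq_1_pos)
  have "\<bar>1 - s\<^sup>2\<bar> \<le> 1 + s\<^sup>2" by (simp add: abs_if)
  also have "\<dots> \<le> (1 + s\<^sup>2)\<^sup>2" using p by (rule self_le_power) simp
  finally show "\<bar>(1 - s\<^sup>2) * (1 / (1 + s\<^sup>2))\<^sup>2\<bar> \<le> 1"
    using \<open>0 < 1 + s\<^sup>2\<close> by (simp add: abs_mult power_divide divide_le_eq_1_pos)
  have "2 * \<bar>s\<bar> \<le> 1 + s\<^sup>2" using zero_le_power2[of "\<bar>s\<bar> - 1"] by (simp add: power2_diff)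
  then show "\<bar>s * (1 / (1 + s\<^sup>2))\<bar> \<le> 1 / 2" using \<open>0 < 1 + s\<^sup>2\<close> by (simp add: abs_mult pos_divide_le_eq)
qed

context regularized
begin

lemma in_U: "0 \<le> t \<Longrightarrow> t < 1 \<Longrightarrow> t \<in> U"
  using d by auto

lemma ell_ge: assumes "0 \<le> t" "t < 1" shows "ell d t \<ge> 2" "k * ell d t \<le> 1"
proof -
  have "ln (t + d) \<le> ln 2" using assms d by simp
  also have "ln 2 \<le> (1::real)" using ln_le_minus_one[of 2] by simp
  finally show "ell d t \<ge> 2" by (simp add: ell_def)
  have "ell d t \<le> ell d 0" using assms d by (simp add: ell_def)
  then show "k * ell d t \<le> 1" using ell_0_ge by (simp add: k)
qed

lemma prof_bounds: assumes "0 \<le> t" "t < 1" shows "ell d t / 2 \<le> prof k d t" "prof k d t \<le> ell d t"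
proof -
  have *: "prof k d t = ell d t - (k * ell d t) * ell d t / 2"
    by (simp add: prof_def power2_eq_square)
  have "(k * ell d t) * ell d t \<le> 1 * ell d t" "0 \<le> (k * ell d t) * ell d t"
    using ell_ge[OF assms] k_pos by (intro mult_right_mono mult_nonneg_nonneg; simp)+
  then show "ell d t / 2 \<le> prof k d t" "prof k d t \<le> ell d t" unfolding * by auto
qed

lemma prof1_bound: assumes "0 \<le> t" "t < 1" shows "\<bar>prof1 k d t\<bar> \<le> 1 / (t + d)"
proof -
  have "\<bar>1 - k * ell d t\<bar> \<le> 1"
    using ell_ge[OF assms] k_pos by (auto simp: abs_if)
  then show ?thesis using assms d by (simp add: prof1_def abs_mult abs_minus_commute divide_right_mono)
qed

lemma mult_ell_power_le: assumes "0 \<le> t" "t < 1" "n \<le> 4" shows "(t + d) * ell d t ^ n \<le> log_const"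
  unfolding ell_def using assms ell_ge[OF assms(1,2)] d
  by (intro mult_log_power_le) (auto simp: ell_def)

lemma majorant_ge: assumes "0 < t" "t < 1" shows "1 / ((t + d) * (ell d t)\<^sup>2) \<le> majorant t"
  unfolding ell_def using assms d by (intro majorant_mono) auto

lemma src_bound:
  assumes "0 \<le> t" "t < 1"
  shows "\<bar>src k d t\<bar> \<le> 32 / ((t + d) * ell d t ^ 3) + ell d t"
proof -
  note l = ell_ge[OF assms] and pb = prof_bounds[OF assms]
  have y: "t + d > 0" using assms d by simp
  have "(prof1 k d t)\<^sup>2 \<le> (1 / (t + d))\<^sup>2"
    using power_mono[OF prof1_bound[OF assms], of 2] by simp
  then have "4 * t * (prof1 k d t)\<^sup>2 \<le> 4 * (t + d) * (1 / (t + d))\<^sup>2"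
    using assms d by (intro mult_mono) auto
  also have "\<dots> = 4 / (t + d)" using y by (simp only: power2_eq_square mult.assoc) simp
  \<comment> \<open>Here 32 is 4 times 8, the 8 coming from the cube of
    \<open>A >= ell / 2\<close>.\<close>
  finally have "4 * t * (prof1 k d t)\<^sup>2 / (prof k d t) ^ 3 \<le> (4 / (t + d)) / (ell d t / 2) ^ 3"
    using l pb y assms by (intro frac_le power_mono) auto
  also have "\<dots> = 32 / ((t + d) * ell d t ^ 3)" by (simp add: power_divide)
  finally have "4 * t * (prof1 k d t)\<^sup>2 / (prof k d t) ^ 3 \<le> 32 / ((t + d) * ell d t ^ 3)" .
  moreover have "0 \<le> 4 * t * (prof1 k d t)\<^sup>2 / (prof k d t) ^ 3"
    using assms pb l by (intro divide_nonneg_nonneg) auto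
  ultimately show ?thesis unfolding src_def using pb l by linarith
qed

lemma ell_le_majorant:
  assumes "0 \<le> t" "t < 1"
  shows "ell d t \<le> log_const / ((t + d) * (ell d t)\<^sup>2)"
  using mult_ell_power_le[OF assms, of 3] ell_ge[OF assms] assms d
  by (subst pos_le_divide_eq) (auto simp: power2_eq_square power3_eq_cube mult_ac)

lemma src_bound2:
  assumes "0 \<le> t" "t < 1"
  shows "\<bar>src k d t\<bar> \<le> (32 + log_const) / ((t + d) * (ell d t)\<^sup>2)"
proof -
  note l = ell_ge[OF assms]
  have y: "t + d > 0" using assms d by simp
  have "32 / ((t + d) * ell d t ^ 3) \<le> 32 / ((t + d) * ell d t ^ 2)"
    using l y by (intro divide_left_mono mult_left_mono power_increasing) auto
  then show ?thesis using src_bound[OF assms] ell_le_majorant[OF assms]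
    by (simp add: add_divide_distrib)
qed

text \<open>The bound \<open>src_bound\<close> has an explicit primitive: \<open>16 / ell^2\<close>
  for the first term and \<open>(t + d) (ell + 1)\<close> for the second. The gain
  \<open>1 / ell^2\<close> is what the product with \<open>A1\<close>, of size
  \<open>1 / (t + d)\<close>, requires in the vertical drift.\<close>

lemma src_avg_bound:
  assumes "0 \<le> t" "t < 1"
  shows "t * \<bar>src_avg k d t\<bar> \<le> (16 + 2 * log_const) / (ell d t)\<^sup>2"
proof -
  have mem: "0 \<le> s * t" "s * t < 1" if "s \<in> {0..1}" for s
    using that assms mult_left_le_one_le[of t s] by (auto simp: mult.commute)
  let ?G = "\<lambda>s. 16 / (ell d (s * t))\<^sup>2 + (s * t + d) * (ell d (s * t) + 1)"
  have "((\<lambda>s. t * (32 / ((s * t + d) * ell d (s * t) ^ 3) + ell d (s * t))) has_integral (?G 1 - ?G 0)) {0..1}"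
  proof (rule fundamental_theorem_of_calculus)
    fix s :: real assume s: "s \<in> {0..1}"
    have y: "s * t + d > 0" using mem[OF s] d by simp
    have l: "ell d (s * t) \<ge> 2" using ell_ge[OF mem[OF s]] by simp
    have e: "((\<lambda>s. ell d (s * t)) has_real_derivative - 1 / (s * t + d) * t) (at s)"
      by (rule DERIV_chain2[where f="ell d" and g="\<lambda>s. s * t", OF ell_deriv[OF y]])
        (auto intro!: derivative_eq_intros)
    have "((\<lambda>s. 16 / (ell d (s * t))\<^sup>2) has_real_derivative
        (0 * (ell d (s * t))\<^sup>2 - 16 * (2 * ell d (s * t) * (- 1 / (s * t + d) * t)))
          / ((ell d (s * t))\<^sup>2 * (ell d (s * t))\<^sup>2)) (at s)"
      by (rule derivative_eq_intros e refl)+ (use l in auto)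
    also have "(0 * (ell d (s * t))\<^sup>2 - 16 * (2 * ell d (s * t) * (- 1 / (s * t + d) * t)))
          / ((ell d (s * t))\<^sup>2 * (ell d (s * t))\<^sup>2) = t * (32 / ((s * t + d) * ell d (s * t) ^ 3))"
      using l by (simp add: power2_eq_square power3_eq_cube mult.assoc)
    finally have 1: "((\<lambda>s. 16 / (ell d (s * t))\<^sup>2) has_real_derivative
        t * (32 / ((s * t + d) * ell d (s * t) ^ 3))) (at s)" .
    have "((\<lambda>s. (s * t + d) * (ell d (s * t) + 1)) has_real_derivative
        t * (ell d (s * t) + 1) + (- 1 / (s * t + d) * t) * (s * t + d)) (at s)"
      by (rule derivative_eq_intros e refl)+ simp
    also have "t * (ell d (s * t) + 1) + (- 1 / (s * t + d) * t) * (s * t + d) = t * ell d (s * t)"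
    proof -
      have "(- 1 / Y * t) * Y = - t" if "Y > 0" for Y :: real using that by simp
      from this[OF y] show ?thesis by (simp only:) (simp add: algebra_simps)
    qed
    finally have "(?G has_real_derivative t * (32 / ((s * t + d) * ell d (s * t) ^ 3) + ell d (s * t))) (at s)"
      using DERIV_add[OF 1] by (simp add: distrib_left)
    then show "(?G has_vector_derivative t * (32 / ((s * t + d) * ell d (s * t) ^ 3) + ell d (s * t))) (at s within {0..1})"
      by (simp add: has_real_derivative_iff_has_vector_derivative has_vector_derivative_at_within)
  qed simp
  note hi = this
  have "(\<lambda>s. s * t) ` {0..1} \<subseteq> U" using mem in_U by blast
  then have si: "(\<lambda>s. src k d (s * t)) integrable_on {0..1}"
    by (intro integrable_continuous_interval
        continuous_on_compose2[OF smooth_on_imp_continuous_on[OF smooth_src]] continuous_intros)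
  have "t * src_avg k d t = integral {0..1} (\<lambda>s. t * src k d (s * t))"
    unfolding src_avg_def by simp
  also have "\<bar>\<dots>\<bar> \<le> integral {0..1} (\<lambda>s. t * (32 / ((s * t + d) * ell d (s * t) ^ 3) + ell d (s * t)))"
    unfolding real_norm_def[symmetric]
  proof (rule integral_norm_bound_integral)
    show "(\<lambda>s. t * src k d (s * t)) integrable_on {0..1}" using si by (rule integrable_on_mult_right)
    show "norm (t * src k d (s * t)) \<le> t * (32 / ((s * t + d) * ell d (s * t) ^ 3) + ell d (s * t))"
      if "s \<in> {0..1}" for s
      using src_bound[OF mem[OF that]] assms by (simp add: abs_mult mult_left_mono)
  qed (use hi in blast)
  also have "\<dots> = ?G 1 - ?G 0" using hi by (rule integral_unique)
  also have "\<dots> \<le> ?G 1"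
  proof -
    have "0 \<le> ?G 0" using ell_0_ge d assms by (intro add_nonneg_nonneg mult_nonneg_nonneg divide_nonneg_nonneg) auto
    then show ?thesis by linarith
  qed
  also have "\<dots> \<le> 16 / (ell d t)\<^sup>2 + (t + d) * (2 * ell d t)"
    using ell_ge[OF assms] assms d by (intro add_mono mult_left_mono) auto
  also have "(t + d) * (2 * ell d t) \<le> 2 * log_const / (ell d t)\<^sup>2"
    using mult_ell_power_le[OF assms, of 3] ell_ge[OF assms] 
    by (simp add: field_simps power2_eq_square power3_eq_cube)
  finally show ?thesis using assms by (simp add: abs_mult add_divide_distrib)
qed

text \<open>No logarithm has to be gained here: the horizontal drift carries a further factor
  \<open>x$1\<close> or \<open>x$2\<close>, at most \<open>sqrt t\<close>.\<close>

lemma drift_h_bound: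
  assumes t: "0 < t" "t < 1"
  shows "\<bar>drift_h (prof k d t) (prof1 k d t) (src_avg k d t) z\<bar> \<le> (20 + 2 * log_const) / t"
proof -
  define l A A1 J where "l = ell d t" and "A = prof k d t" and "A1 = prof1 k d t" and "J = src_avg k d t"
  have t0: "0 \<le> t" using t by simp
  have b: "l \<ge> 2" "l / 2 \<le> A" "A \<le> l" "\<bar>A1\<bar> \<le> 1 / (t + d)" "t * \<bar>J\<bar> \<le> (16 + 2 * log_const) / l\<^sup>2"
    using ell_ge[OF t0 t(2)] prof_bounds[OF t0 t(2)] prof1_bound[OF t0 t(2)] src_avg_bound[OF t0 t(2)]
    by (auto simp: l_def A_def A1_def J_def)
  have "\<bar>J * A * ((1 - (z * A)\<^sup>2) * (1 / (1 + (z * A)\<^sup>2))\<^sup>2)\<bar> \<le> \<bar>J\<bar> * A * 1"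
    unfolding abs_mult[of "J * A"] using inverse_one_plus_square_bounds(1)[of "z * A"] b
    by (intro mult_mono) (auto simp: abs_mult)
  also have "\<dots> \<le> ((16 + 2 * log_const) / l\<^sup>2 / t) * l * 1"
  proof (intro mult_right_mono mult_mono)
    show "\<bar>J\<bar> \<le> (16 + 2 * log_const) / l\<^sup>2 / t"
      using b(5) t by (subst pos_le_divide_eq) (auto simp: mult.commute)
  qed (use b t log_const_ge in auto)
  also have "\<dots> = (16 + 2 * log_const) / l / t" using b by (simp add: power2_eq_square divide_simps)
  also have "\<dots> \<le> (16 + 2 * log_const) / 1 / t"
    using b t log_const_ge by (intro divide_right_mono divide_left_mono) auto
  finally have 1: "\<bar>J * A * ((1 - (z * A)\<^sup>2) * (1 / (1 + (z * A)\<^sup>2))\<^sup>2)\<bar> \<le> (16 + 2 * log_const) / t" by simp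
  have "1 / (t + d) \<le> 1 / t" using t d by (intro divide_left_mono) auto
  then have "\<bar>A1\<bar> \<le> 1 / t" using b by linarith
  then have "\<bar>2 * A1 / A\<bar> \<le> 2 * (1 / t) / 1"
    using b t unfolding abs_divide by (intro frac_le) (auto simp: abs_mult)
  then have 2: "\<bar>2 * A1 / A\<bar> \<le> 4 / t" using t by (simp add: field_simps)
  have "(20 + 2 * log_const) / t = (16 + 2 * log_const) / t + 4 / t" by (simp add: add_divide_distrib)
  moreover have "drift_h A A1 J z = J * A * ((1 - (z * A)\<^sup>2) * (1 / (1 + (z * A)\<^sup>2))\<^sup>2) + 2 * A1 / A"
    by (simp add: drift_h_def)
  ultimately have "\<bar>drift_h A A1 J z\<bar> \<le> (20 + 2 * log_const) / t" using 1 2 by linarith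
  then show ?thesis by (simp add: A_def A1_def J_def)
qed

text \<open>Every term must gain \<open>1 / ell^2\<close> over \<open>1 / (t + d)\<close>. The
  bounds on \<open>t J\<close> and on \<open>F\<close> provide it for the first two, and
  \<open>A >= ell / 2\<close> for \<open>t A1^2 / A^2\<close>. The critical term is
  \<open>(A1 + t A2) / A\<close>, which involves the planar Laplacian of the profile.\<close>

lemma drift_v_bound:
  assumes t: "0 < t" "t < 1" and z: "\<bar>z\<bar> \<le> 1"
  shows "\<bar>drift_v (prof k d t) (prof1 k d t) (prof2 k d t) (src_avg k d t) (src k d t) t z\<bar>
    \<le> (128 + 8 * log_const) / ((t + d) * (ell d t)\<^sup>2)"
proof -
  define l y A A1 A2 J F where "l = ell d t" and "y = t + d" and "A = prof k d t" and "A1 = prof1 k d t"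
    and "A2 = prof2 k d t" and "J = src_avg k d t" and "F = src k d t"
  have t0: "0 \<le> t" using t by simp
  have b: "l \<ge> 2" "l / 2 \<le> A" "A \<le> l" "\<bar>A1\<bar> \<le> 1 / y" "t * \<bar>J\<bar> \<le> (16 + 2 * log_const) / l\<^sup>2"
    "\<bar>F\<bar> \<le> (32 + log_const) / (y * l\<^sup>2)" "k * l \<le> 1"
    using ell_ge[OF t0 t(2)] prof_bounds[OF t0 t(2)] prof1_bound[OF t0 t(2)] src_avg_bound[OF t0 t(2)]
      src_bound2[OF t0 t(2)]
    by (auto simp: l_def A_def A1_def J_def F_def y_def)
  have y: "0 < y" "t \<le> y" using t d by (auto simp: y_def)
  have "\<bar>t * J * z * A1 * ((1 - (z * A)\<^sup>2) * (1 / (1 + (z * A)\<^sup>2))\<^sup>2)\<bar>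
      \<le> ((16 + 2 * log_const) / l\<^sup>2) * 1 * (1 / y) * 1"
    unfolding abs_mult[of "t * J * z * A1"] abs_mult[of "t * J * z"] abs_mult[of "t * J"]
    using inverse_one_plus_square_bounds(1)[of "z * A"] b z t log_const_ge y
    by (intro mult_mono) (auto simp: abs_mult)
  then have 1: "\<bar>t * J * z * A1 * ((1 - (z * A)\<^sup>2) * (1 / (1 + (z * A)\<^sup>2))\<^sup>2)\<bar> \<le> (16 + 2 * log_const) / (y * l\<^sup>2)"
    by (simp add: mult.commute)
  have "\<bar>z * A * (1 / (1 + (z * A)\<^sup>2)) * F\<bar> \<le> 1 / 2 * ((32 + log_const) / (y * l\<^sup>2))"
    unfolding abs_mult[of "z * A * (1 / (1 + (z * A)\<^sup>2))"]
    using inverse_one_plus_square_bounds(2)[of "z * A"] b by (intro mult_mono) auto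
  also have "\<dots> = 1 / 2 * (32 + log_const) / (y * l\<^sup>2)" by simp
  also have "\<dots> \<le> (16 + log_const) / (y * l\<^sup>2)" using y log_const_ge by (intro divide_right_mono) auto
  finally have 2: "\<bar>z * A * (1 / (1 + (z * A)\<^sup>2)) * F\<bar> \<le> (16 + log_const) / (y * l\<^sup>2)" .
  define p where "p = 1 - k * l"
  have p: "0 \<le> p" "p \<le> 1" using b k_pos by (auto simp: p_def)
  have "1 = k * ell d 0" using ell_0_ge by (simp add: k)
  \<comment> \<open>Thus \<open>p = k ln (y / d)\<close>, and \<open>ln a <= a\<close> gives
    \<open>d p <= k y\<close>. Hence \<open>A1 + t A2\<close> has size \<open>k / y\<close>, and
    \<open>k l <= 1\<close> turns \<open>k / (y l)\<close> into \<open>1 / (y l^2)\<close>. This is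
    where the choice of \<open>k\<close> enters.\<close>
  then have "p = k * (ell d 0 - l)" by (simp add: p_def algebra_simps)
  also have "ell d 0 - l = ln (y / d)" using y d by (simp add: l_def ell_def y_def ln_div)
  also have "\<dots> \<le> y / d" using ln_le_minus_one[of "y / d"] y d by simp
  finally have "p \<le> k * (y / d)" using k_pos by simp
  then have dp: "d * p \<le> k * y" using d by (simp add: field_simps)
  have A12: "A1 = - p / y" "A2 = (p - k) / y\<^sup>2"
    by (simp_all add: A1_def A2_def prof1_def prof2_def y_def l_def p_def)
  have "- p * y + t * (p - k) = - (d * p + t * k)" by (simp add: y_def algebra_simps)
  moreover have "A1 + t * A2 = (- p * y + t * (p - k)) / y\<^sup>2"
    using y(1) unfolding A12 by (simp add: add_divide_distrib diff_divide_distrib power2_eq_square right_diff_distrib)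
  ultimately have "A1 + t * A2 = - (d * p + t * k) / y\<^sup>2" by simp
  moreover have "0 \<le> d * p + t * k" using p d k_pos t by simp
  ultimately have "\<bar>A1 + t * A2\<bar> = (d * p + t * k) / y\<^sup>2"
    by (simp only: abs_divide abs_minus_cancel abs_of_nonneg abs_power2)
  also have "\<dots> \<le> (k * y + y * k) / y\<^sup>2"
    using dp y k_pos by (intro divide_right_mono add_mono mult_right_mono) auto
  also have "\<dots> = 2 * k / y" using y by (simp add: power2_eq_square)
  finally have "\<bar>(A1 + t * A2) / A\<bar> \<le> (2 * k / y) / (l / 2)"
    unfolding abs_divide using b y k_pos by (intro frac_le) auto
  also have "\<dots> = 4 * (k * l) / (y * l\<^sup>2)" using b by (simp add: power2_eq_square)
  also have "\<dots> \<le> 4 * 1 / (y * l\<^sup>2)" using b y by (intro divide_right_mono mult_left_mono) auto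
  finally have 3: "\<bar>(A1 + t * A2) / A\<bar> \<le> 4 / (y * l\<^sup>2)" by simp
  have "\<bar>A1\<bar>\<^sup>2 \<le> (1 / y)\<^sup>2" using b by (intro power_mono) auto
  then have "t * A1\<^sup>2 \<le> y * (1 / y)\<^sup>2" using t y by (intro mult_mono) auto
  also have "\<dots> = 1 / y" using y by (simp add: power2_eq_square)
  finally have "t * A1\<^sup>2 / A\<^sup>2 \<le> (1 / y) / (l / 2)\<^sup>2"
    using b y t by (intro frac_le power_mono) auto
  then have 4: "t * A1\<^sup>2 / A\<^sup>2 \<le> 4 / (y * l\<^sup>2)" by (simp add: power_divide)
  have "\<bar>A1 / A + t * A2 / A - t * A1\<^sup>2 / A\<^sup>2\<bar> \<le> 8 / (y * l\<^sup>2)"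
  proof -
    have gen: "\<bar>a - c\<bar> \<le> e + e" if "\<bar>a\<bar> \<le> e" "0 \<le> c" "c \<le> e" for a c e :: real
      using that by linarith
    have "0 \<le> t * A1\<^sup>2 / A\<^sup>2" using t by simp
    from gen[OF 3 this 4] show ?thesis by (simp add: add_divide_distrib)
  qed
  then have "\<bar>2 * z\<bar> * \<bar>A1 / A + t * A2 / A - t * A1\<^sup>2 / A\<^sup>2\<bar> \<le> 2 * (8 / (y * l\<^sup>2))"
    using z by (intro mult_mono) auto
  then have 5: "\<bar>2 * z * (A1 / A + t * A2 / A - t * A1\<^sup>2 / A\<^sup>2)\<bar> \<le> 16 / (y * l\<^sup>2)"
    by (simp add: abs_mult)
  have "drift_v A A1 A2 J F t z = 2 * (t * J * z * A1 * ((1 - (z * A)\<^sup>2) * (1 / (1 + (z * A)\<^sup>2))\<^sup>2)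
      + z * A * (1 / (1 + (z * A)\<^sup>2)) * F + 2 * z * (A1 / A + t * A2 / A - t * A1\<^sup>2 / A\<^sup>2))"
    by (simp add: drift_v_def)
  moreover have gen: "\<bar>2 * (a + b + c)\<bar> \<le> 2 * (a' + b' + c')"
    if "\<bar>a\<bar> \<le> a'" "\<bar>b\<bar> \<le> b'" "\<bar>c\<bar> \<le> c'" for a b c a' b' c' :: real
  proof -
    have "\<bar>a + b + c\<bar> \<le> a' + b' + c'" using that by linarith
    then show ?thesis unfolding abs_mult by simp
  qed
  ultimately have "\<bar>drift_v A A1 A2 J F t z\<bar> \<le> 2 * ((16 + 2 * log_const) / (y * l\<^sup>2) + (16 + log_const) / (y * l\<^sup>2) + 16 / (y * l\<^sup>2))"
    using gen[OF 1 2 5] by (simp only:)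
  also have "\<dots> = (96 + 6 * log_const) / (y * l\<^sup>2)" by (simp add: add_divide_distrib)
  also have "\<dots> \<le> (128 + 8 * log_const) / (y * l\<^sup>2)" using log_const_ge y b by (intro divide_right_mono) auto
  finally show ?thesis by (simp add: l_def y_def A_def A1_def A2_def J_def F_def)
qed

end

text \<open>The claim is that \<open>sqrt t (3 - ln t)^2\<close> is bounded; its square is
  \<open>t (3 - ln t)^4\<close>.\<close>

lemma sqrt_le_majorant:
  assumes "0 < t" "t < 1"
  shows "1 / sqrt t \<le> log_const * majorant t"
proof -
  define L r where "L = 3 - ln t" and "r = sqrt t"
  have l: "L \<ge> 1" using assms ln_less_zero[of t] unfolding L_def by linarith
  have r: "r > 0" "r * r = t" using assms by (auto simp: r_def)
  have "(r * L\<^sup>2)\<^sup>2 = (r * r) * L ^ 4"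
    by (simp add: power2_eq_square power4_eq_xxxx mult_ac)
  also have "\<dots> \<le> log_const"
    using mult_log_power_le[OF assms(1) l[unfolded L_def], of 4] unfolding r L_def by simp
  also have "\<dots> \<le> log_const\<^sup>2" using log_const_ge by (rule self_le_power) simp
  finally have "r * L\<^sup>2 \<le> log_const" by (rule power2_le_imp_le) (use log_const_ge in linarith)
  then have "r * L\<^sup>2 / (r * r * L\<^sup>2) \<le> log_const / (r * r * L\<^sup>2)"
    by (intro divide_right_mono) auto
  moreover have "r * L\<^sup>2 / (r * r * L\<^sup>2) = 1 / r" using l r(1) by simp
  ultimately show ?thesis unfolding majorant_def L_def[symmetric] r_def[symmetric] r(2) by simp
qed

definition drift_const :: real where "drift_const = 2 * ((20 + 2 * log_const) * log_const) + (128 + 8 * log_const)"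

lemma ball_rsq: assumes "x \<in> ball 0 (1::real)" shows "rsq x < 1" "\<bar>x$3\<bar> \<le> 1" "rsq x \<ge> 0"
proof -
  have "norm x < 1" using assms by simp
  then have "(norm x)\<^sup>2 < 1" by (simp add: abs_square_less_1)
  then have "(x$1)\<^sup>2 + (x$2)\<^sup>2 + (x$3)\<^sup>2 < 1"
    unfolding power2_norm_eq_inner inner_vec_def by (simp add: sum_3 power2_eq_square)
  then show "rsq x < 1" unfolding rsq_def using zero_le_power2[of "x$3"] by linarith
  show "rsq x \<ge> 0" by (simp add: rsq_def)
  show "\<bar>x$3\<bar> \<le> 1" using component_le_norm_cart[of x 3] \<open>norm x < 1\<close> by linarith
qed

context regularized
begin

text \<open>The right-hand side is free of \<open>k\<close> and \<open>d\<close>: it yields both the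
  uniform L1 bound of (i) and the dominating function for (ii).\<close>

lemma drift_bound:
  assumes x: "x \<in> ball 0 1" "0 < rsq x"
  shows "norm (drift k d x) \<le> drift_const * majorant (rsq x)"
proof -
  note t = ball_rsq(1)[OF x(1)]
  have h: "\<bar>a * drift_h (prof k d (rsq x)) (prof1 k d (rsq x)) (src_avg k d (rsq x)) (x$3)\<bar>
      \<le> (20 + 2 * log_const) * log_const * majorant (rsq x)" if "a\<^sup>2 \<le> rsq x" for a
  proof -
    have "\<bar>a\<bar> \<le> sqrt (rsq x)" using that by (simp add: real_le_rsqrt)
    then have "\<bar>a * drift_h (prof k d (rsq x)) (prof1 k d (rsq x)) (src_avg k d (rsq x)) (x$3)\<bar>
      \<le> sqrt (rsq x) * ((20 + 2 * log_const) / rsq x)"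
      unfolding abs_mult using drift_h_bound[OF x(2) t, of "x$3"] x(2) by (intro mult_mono) auto
    also have "\<dots> = (20 + 2 * log_const) * (sqrt (rsq x) / rsq x)" by simp
    also have "sqrt (rsq x) / rsq x = 1 / sqrt (rsq x)"
      using x(2) real_sqrt_mult_self[of "rsq x"] by (simp add: frac_eq_eq)
    also have "(20 + 2 * log_const) * (1 / sqrt (rsq x)) \<le> (20 + 2 * log_const) * (log_const * majorant (rsq x))"
      using sqrt_le_majorant[OF x(2) t] log_const_ge by (intro mult_left_mono) auto
    finally show ?thesis by (simp add: mult.assoc)
  qed
  have "\<bar>drift k d x $ 3\<bar> \<le> (128 + 8 * log_const) * (1 / ((rsq x + d) * (ell d (rsq x))\<^sup>2))"
    using drift_v_bound[OF x(2) t ball_rsq(2)[OF x(1)]] by (simp add: drift_nth)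
  also have "\<dots> \<le> (128 + 8 * log_const) * majorant (rsq x)"
    using majorant_ge[OF x(2) t] log_const_ge by (intro mult_left_mono) auto
  finally have v: "\<bar>drift k d x $ 3\<bar> \<le> (128 + 8 * log_const) * majorant (rsq x)" .
  have "norm (drift k d x) \<le> \<bar>drift k d x $ 1\<bar> + \<bar>drift k d x $ 2\<bar> + \<bar>drift k d x $ 3\<bar>"
    using norm_le_l1_cart[of "drift k d x"] by (simp add: sum_3)
  also have "\<dots> \<le> (20 + 2 * log_const) * log_const * majorant (rsq x) + (20 + 2 * log_const) * log_const * majorant (rsq x) + (128 + 8 * log_const) * majorant (rsq x)"
    using h[of "x$1"] h[of "x$2"] v unfolding drift_nth(1,2) abs_minus_cancel
    by (intro add_mono) (auto simp: rsq_def)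
  also have "\<dots> = drift_const * majorant (rsq x)" by (simp add: drift_const_def algebra_simps)
  finally show ?thesis .
qed

text \<open>For the horizontal derivatives, \<open>|z A Q| <= 1 / 2\<close> trades the factor
  \<open>z\<close> for \<open>1 / A\<close>, leaving at most \<open>sqrt t / (y l)\<close>. The
  vertical one is at most \<open>l\<close>, and \<open>l^2\<close> is controlled by
  \<open>1 / (y l^2)\<close> because \<open>y l^4\<close> is bounded.\<close>

lemma pot_partial_bound:
  assumes x: "x \<in> ball 0 1" "0 < rsq x"
  shows "(partial_deriv (axis i 1) (pot k d) x)\<^sup>2 \<le> log_const * majorant (rsq x)"
proof -
  note t = ball_rsq(1)[OF x(1)]
  have xS: "x \<in> S" using t by simp
  define t y l A A1 Q where "t = rsq x" and "y = t + d" and "l = ell d t" and "A = prof k d t" and "A1 = prof1 k d t"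
    and "Q = 1 / (1 + (x$3 * A)\<^sup>2)"
  have t01: "0 < t" "t < 1" "0 \<le> t" using x(2) t by (auto simp: t_def)
  have b: "l \<ge> 2" "l / 2 \<le> A" "A \<le> l" "\<bar>A1\<bar> \<le> 1 / y" "y * l ^ 4 \<le> log_const" "1 / (y * l\<^sup>2) \<le> majorant t"
    using ell_ge[OF t01(3,2)] prof_bounds[OF t01(3,2)] prof1_bound[OF t01(3,2)]
      mult_ell_power_le[OF t01(3,2), of 4] majorant_ge[OF t01(1,2)]
    by (auto simp: l_def A_def A1_def y_def)
  have y: "0 < y" "t \<le> y" using t01 d by (auto simp: y_def)
  have Q: "0 \<le> Q" "Q \<le> 1" "\<bar>x$3 * A * Q\<bar> \<le> 1 / 2"
    using inverse_one_plus_square_bounds[of "x$3 * A"] by (auto simp: Q_def)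
  have C0D: "1 / (y * l\<^sup>2) \<le> log_const * majorant t"
    using b log_const_ge majorant_pos[OF t01(1,2)] mult_right_mono[of 1 log_const "majorant t"] by linarith
  have hor: "(a * x$3 * A1 * Q)\<^sup>2 \<le> log_const * majorant t" if "a\<^sup>2 \<le> t" for a
  proof -
    have "\<bar>a * x$3 * A1 * Q\<bar> = \<bar>a\<bar> * \<bar>A1\<bar> * (\<bar>x$3 * A * Q\<bar> / A)"
      using b by (simp add: abs_mult)
    also have "\<dots> \<le> sqrt t * (1 / y) * ((1 / 2) / (l / 2))"
      using b Q y t01 that by (intro mult_mono frac_le) (auto simp: real_le_rsqrt)
    also have "\<dots> = sqrt t / (y * l)" by simp
    finally have "\<bar>a * x$3 * A1 * Q\<bar>\<^sup>2 \<le> (sqrt t / (y * l))\<^sup>2" by (intro power_mono) auto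
    also have "\<dots> = t / y / (y * l\<^sup>2)" using t01 by (simp add: power_divide power_mult_distrib power2_eq_square)
    also have "\<dots> \<le> 1 / (y * l\<^sup>2)" using y t01 b by (intro divide_right_mono) auto
    finally show ?thesis using C0D by simp
  qed
  have "\<bar>A / 2 * Q\<bar> \<le> l * 1" unfolding abs_mult using b Q by (intro mult_mono) auto
  then have "\<bar>A / 2 * Q\<bar>\<^sup>2 \<le> l\<^sup>2" by (intro power_mono) auto
  also have "\<dots> \<le> log_const * (1 / (y * l\<^sup>2))"
    using b(1,5) y by (simp add: field_simps power2_eq_square power4_eq_xxxx)
  also have "\<dots> \<le> log_const * majorant t" using b log_const_ge by (intro mult_left_mono) auto
  finally have ver: "(A / 2 * Q)\<^sup>2 \<le> log_const * majorant t" by (simp only: power2_abs)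
  show ?thesis
    using exhaust_3[of i] hor[of "x$1"] hor[of "x$2"] ver pot_partial[OF xS]
    by (auto simp: A_def A1_def Q_def t_def rsq_def)
qed

end

section \<open>Passage to the limit\<close>

abbreviation (input) "unit_ball \<equiv> ball (0 :: real^3) 1"
abbreviation (input) "leb_ball \<equiv> lebesgue_on unit_ball"

lemma continuous_imp_measurable_unit_ball:
  fixes f :: "real^3 \<Rightarrow> 'b::euclidean_space"
  shows "continuous_on unit_ball f \<Longrightarrow> f \<in> borel_measurable leb_ball"
  by (rule continuous_imp_measurable_on_sets_lebesgue) (auto simp: lmeasurable_open)

lemma continuous_rsq: "continuous_on A rsq"
  unfolding rsq_def[abs_def] by (intro continuous_intros)

lemma borel_rsq: "rsq \<in> borel_measurable borel"
  by (intro borel_measurable_continuous_onI continuous_rsq)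

text \<open>The axis lies in the null plane \<open>x$1 = 0\<close>. All pointwise limits and bounds
  below are stated off the axis.\<close>

lemma AE_off_axis: "AE x in leb_ball. x \<in> unit_ball \<and> 0 < rsq x"
proof -
  have "negligible {x :: real^3. x$1 = 0}"
    by (rule negligible_standard_hyperplane_cart)
  then have "AE x in lebesgue. x \<notin> {x :: real^3. x$1 = 0}"
    by (simp only: AE_not_in negligible_iff_null_sets)
  then have "AE x in lebesgue. x \<in> unit_ball \<longrightarrow> x \<in> unit_ball \<and> 0 < rsq x"
    by eventually_elim (auto simp: rsq_def add_pos_nonneg)
  then show ?thesis by (subst AE_restrict_space_iff) (auto simp: lmeasurable_open)
qed

text \<open>The limit drift contains the parameter integral \<open>src_avg 0 0\<close>;
  measurability is inherited from the continuous approximations instead of being derived from the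
  formula.\<close>

lemma off_axis_limit_measurable:
  fixes f :: "nat \<Rightarrow> real^3 \<Rightarrow> 'b::euclidean_space"
  assumes "\<And>m. f m \<in> borel_measurable leb_ball"
    and "\<And>x. x \<in> unit_ball \<Longrightarrow> 0 < rsq x \<Longrightarrow> (\<lambda>m. f m x) \<longlonglongrightarrow> F x"
  shows "(\<lambda>x. if 0 < rsq x then F x else 0) \<in> borel_measurable leb_ball"
proof (rule borel_measurable_LIMSEQ_metric)
  have "rsq \<in> borel_measurable leb_ball" by (intro continuous_imp_measurable_unit_ball continuous_rsq)
  then show "(\<lambda>x. if 0 < rsq x then f m x else 0) \<in> borel_measurable leb_ball" for m
    using assms(1)[of m] by measurable
  show "(\<lambda>m. if 0 < rsq x then f m x else 0) \<longlonglongrightarrow> (if 0 < rsq x then F x else 0)" if "x \<in> space leb_ball" for x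
    using assms(2) that by auto
qed

lemma off_axis_dominated_convergence:
  fixes f :: "nat \<Rightarrow> real^3 \<Rightarrow> 'b::euclidean_space"
  assumes "\<And>m. f m \<in> borel_measurable leb_ball" "F \<in> borel_measurable leb_ball" "integrable leb_ball w"
    and "\<And>x. x \<in> unit_ball \<Longrightarrow> 0 < rsq x \<Longrightarrow> (\<lambda>m. f m x) \<longlonglongrightarrow> F x"
    and "\<And>m x. x \<in> unit_ball \<Longrightarrow> 0 < rsq x \<Longrightarrow> norm (f m x) \<le> w x"
  shows "integrable leb_ball F" "integrable leb_ball (f m)" "(\<lambda>m. integral\<^sup>L leb_ball (f m)) \<longlonglongrightarrow> integral\<^sup>L leb_ball F"
proof -
  have 1: "AE x in leb_ball. (\<lambda>m. f m x) \<longlonglongrightarrow> F x"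
    using AE_off_axis by eventually_elim (use assms(4) in auto)
  have 2: "AE x in leb_ball. norm (f m x) \<le> w x" for m
    using AE_off_axis by eventually_elim (use assms(5) in auto)
  show "integrable leb_ball F" "integrable leb_ball (f m)" "(\<lambda>m. integral\<^sup>L leb_ball (f m)) \<longlonglongrightarrow> integral\<^sup>L leb_ball F"
    using integrable_dominated_convergence[OF assms(2,1,3) 1 2]
      integrable_dominated_convergence2[OF assms(2,1,3) 1 2]
      integral_dominated_convergence[OF assms(2,1,3) 1 2] by auto
qed

text \<open>On the shell \<open>exp (- k - 1) \<le> t \<le> exp (- k)\<close>, of measure at most \<open>8 exp (- k)\<close>, the function is at
  most \<open>exp (k + 1) / (k + 1)\<^sup>2\<close>.\<close>

lemma integrable_majorant_rsq: "integrable leb_ball (\<lambda>x. majorant (rsq x))"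
proof (rule integrableI_bounded)
  have mb: "(\<lambda>x. majorant (rsq x)) \<in> borel_measurable borel"
    unfolding majorant_def using borel_rsq by measurable
  then show m: "(\<lambda>x. majorant (rsq x)) \<in> borel_measurable leb_ball"
    by (intro measurable_restrict_space1 measurable_completion) simp
  define c :: "nat \<Rightarrow> real" where "c k = exp (real k + 1) / (real k + 1)\<^sup>2" for k
  define r :: "nat \<Rightarrow> real" where "r k = exp (- real k / 2)" for k
  \<comment> \<open>If \<open>t <= exp (- k)\<close>, both horizontal coordinates are at most
    \<open>sqrt t <= r k\<close>, so the shell lies in this box of volume
    \<open>8 exp (- k)\<close>. Multiplied by \<open>c k\<close> this leaves
    \<open>8 e / (k + 1)^2\<close>, which is summable.\<close>
  define E :: "nat \<Rightarrow> (real^3) set" where "E k = cbox (vector [- r k, - r k, - 1]) (vector [r k, r k, 1])" for k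
  have r2: "(r k)\<^sup>2 = exp (- real k)" for k
    by (simp add: r_def power2_eq_square exp_add[symmetric])
  have "emeasure lborel (E k) = ennreal (8 * exp (- real k))" for k
  proof -
    have "r k > 0" by (simp add: r_def)
    then have "vector [0, 0, 0] \<in> E k"
      unfolding E_def mem_box_cart forall_3 vector_3 by (simp only: neg_le_0_iff_le) simp
    then have ne: "cbox (vector [- r k, - r k, - 1]) (vector [r k, r k, 1] :: real^3) \<noteq> {}"
      unfolding E_def by blast
    have prod3: "prod f (UNIV :: 3 set) = f 1 * f 2 * f 3" for f :: "3 \<Rightarrow> real"
      unfolding UNIV_3 by simp
    have "measure lborel (E k) = (r k - - r k) * (r k - - r k) * (1 - - 1)"
      unfolding E_def content_cbox_cart[OF ne] prod3 vector_3 ..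
    also have "\<dots> = 8 * (r k)\<^sup>2" by (simp add: power2_eq_square)
    finally have "measure lborel (E k) = 8 * exp (- real k)" unfolding r2 .
    moreover have "emeasure lborel (E k) = ennreal (measure lborel (E k))"
      unfolding E_def by (intro emeasure_eq_ennreal_measure)
        (metis emeasure_lborel_cbox_finite infinity_ennreal_def order_less_irrefl)
    ultimately show ?thesis by simp
  qed
  note emE = this
  have pt: "ennreal (norm (majorant (rsq x))) * indicator unit_ball x \<le> (\<Sum>k. ennreal (c k) * indicator (E k) x)" for x
  proof (cases "x \<in> unit_ball \<and> rsq x > 0")
    case False
    \<comment> \<open>On the axis the convention for division by 0 gives
      \<open>majorant 0 = 0\<close>.\<close>
    then have "rsq x = 0 \<or> x \<notin> unit_ball" using rsq_def[of x] by (auto simp: not_less sum_power2_le_zero_iff)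
    then show ?thesis by (auto simp: majorant_def)
  next
    case True
    define t where "t = rsq x"
    have t: "0 < t" "t < 1" using True ball_rsq[of x] by (auto simp: t_def)
    define k where "k = nat \<lfloor>- ln t\<rfloor>"
    have "ln t < 0" using t by simp
    then have k: "real k \<le> - ln t" "- ln t < real k + 1" by (auto simp: k_def; linarith)+
    have tk: "t \<le> exp (- real k)" using k(1) t(1) by (metis exp_le_cancel_iff exp_ln le_minus_iff)
    have tk1: "exp (- (real k + 1)) \<le> t"
      using k(2) t(1) by (metis exp_le_cancel_iff exp_ln less_imp_le minus_le_iff)
    have "majorant t \<le> 1 / (exp (- (real k + 1)) * (real k + 1)\<^sup>2)"
      unfolding majorant_def using t k tk1 \<open>ln t < 0\<close>
      by (intro divide_left_mono mult_mono power_mono mult_pos_pos zero_less_power) auto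
    also have "\<dots> = c k" unfolding c_def exp_minus by (simp add: inverse_eq_divide)
    finally have "norm (majorant t) \<le> c k" using majorant_pos[OF t] by simp
    moreover have "x \<in> E k"
    proof -
      have "(x$1)\<^sup>2 \<le> (r k)\<^sup>2" "(x$2)\<^sup>2 \<le> (r k)\<^sup>2"
        using tk zero_le_power2[of "x$1"] zero_le_power2[of "x$2"] unfolding r2 t_def rsq_def by linarith+
      then have "\<bar>x$1\<bar> \<le> r k" "\<bar>x$2\<bar> \<le> r k"
        by (auto simp: r_def intro: power2_le_imp_le[of "\<bar>_\<bar>"])
      moreover have "\<bar>x$3\<bar> \<le> 1" using ball_rsq(2) True by blast
      ultimately show ?thesis unfolding E_def mem_box_cart by (auto simp: forall_3)
    qed
    ultimately have "ennreal (norm (majorant (rsq x))) * indicator unit_ball x \<le> ennreal (c k) * indicator (E k) x"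
      using True by (simp add: t_def ennreal_leI)
    also have "\<dots> \<le> (\<Sum>k. ennreal (c k) * indicator (E k) x)"
    proof -
      have "f k \<le> suminf f" for f :: "nat \<Rightarrow> ennreal"
        using sum_le_suminf[of f "{k}"] by (simp add: summableI)
      then show ?thesis .
    qed
    finally show ?thesis .
  qed
  have "(\<integral>\<^sup>+ x. ennreal (norm (majorant (rsq x))) \<partial>leb_ball) = (\<integral>\<^sup>+ x. ennreal (norm (majorant (rsq x))) * indicator unit_ball x \<partial>lborel)"
    using mb by (subst nn_integral_restrict_space) (auto simp: lmeasurable_open nn_integral_completion)
  also have "\<dots> \<le> (\<integral>\<^sup>+ x. (\<Sum>k. ennreal (c k) * indicator (E k) x) \<partial>lborel)"
    by (intro nn_integral_mono pt)
  also have "\<dots> = (\<Sum>k. \<integral>\<^sup>+ x. ennreal (c k) * indicator (E k) x \<partial>lborel)"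
    by (intro nn_integral_suminf) (auto simp: E_def)
  also have "\<dots> = (\<Sum>k. ennreal (c k) * emeasure lborel (E k))"
    by (intro suminf_cong nn_integral_cmult_indicator) (auto simp: E_def)
  also have "\<dots> = (\<Sum>k. ennreal (8 * exp 1 * inverse (real (Suc k) ^ 2)))"
  proof (intro suminf_cong)
    fix k
    have "c k * (8 * exp (- real k)) = 8 * exp 1 * inverse (real (Suc k) ^ 2)"
      by (simp add: c_def exp_add exp_minus field_simps)
    then show "ennreal (c k) * emeasure lborel (E k) = ennreal (8 * exp 1 * inverse (real (Suc k) ^ 2))"
      unfolding emE by (subst ennreal_mult[symmetric]) (auto simp: c_def)
  qed
  also have "\<dots> < \<infinity>"
  proof -
    have "summable (\<lambda>k. inverse (real k ^ 2))" using inverse_power_summable[of 2, where 'a=real] by simp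
    then have "summable (\<lambda>k. inverse (real (Suc k) ^ 2))" by (subst summable_Suc_iff)
    then have "summable (\<lambda>k. 8 * exp 1 * inverse (real (Suc k) ^ 2))" by (rule summable_mult)
    then have "(\<Sum>k. ennreal (8 * exp 1 * inverse (real (Suc k) ^ 2))) = ennreal (\<Sum>k. 8 * exp 1 * inverse (real (Suc k) ^ 2))"
      by (intro suminf_ennreal2) auto
    then show ?thesis by simp
  qed
  finally show "(\<integral>\<^sup>+ x. ennreal (norm (majorant (rsq x))) \<partial>leb_ball) < \<infinity>" .
qed

text \<open>Provides the dominating function for the convergence of \<open>src_avg\<close>. The
  primitive \<open>1 / (3 - ln (s t)) / t\<close> is continuous up to \<open>s = 0\<close> but
  differentiable only in the interior, hence the interior form of the fundamental theorem.\<close>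

lemma majorant_integrable_dilation:
  assumes "0 < t" "t < 1"
  shows "(\<lambda>s. majorant (s * t)) integrable_on {0..1}"
proof -
  \<comment> \<open>Without the case distinction, \<open>ln 0 = 0\<close> would give the value
    \<open>1 / (3 t)\<close> at \<open>s = 0\<close> in place of the limit 0.\<close>
  let ?g = "\<lambda>s. if s \<le> 0 then 0 else 1 / (3 - ln (s * t)) / t"
  have st: "0 < s * t" "s * t < 1" "3 - ln (s * t) > 0" if "0 < s" "s \<le> 1" for s
  proof -
    show "0 < s * t" using that assms by simp
    have "s * t \<le> 1 * t" using that assms by (intro mult_right_mono) auto
    then show "s * t < 1" using assms by linarith
    then show "3 - ln (s * t) > 0" using ln_less_zero[OF \<open>0 < s * t\<close>] by linarith
  qed
  have "((\<lambda>s. majorant (s * t)) has_integral ?g 1 - ?g 0) {0..1}"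
  proof (rule fundamental_theorem_of_calculus_interior)
    fix s :: real assume "s \<in> {0<..<1}"
    then have s: "0 < s" "s < 1" by auto
    have "((\<lambda>s. 1 / (3 - ln (s * t)) / t) has_real_derivative majorant (s * t)) (at s)"
      using st[of s] s assms unfolding majorant_def
      by (auto intro!: derivative_eq_intros simp: power2_eq_square)
    then have "(?g has_real_derivative majorant (s * t)) (at s)"
      by (rule has_field_derivative_transform_within_open[of _ _ _ "{0<..}"]) (use s in auto)
    then show "(?g has_vector_derivative majorant (s * t)) (at s)"
      by (simp add: has_real_derivative_iff_has_vector_derivative)
  next
    show "continuous_on {0..1} ?g"
    proof (rule continuous_on_eq_continuous_within[THEN iffD2], rule ballI)
      fix s :: real assume s: "s \<in> {0..1}"
      show "continuous (at s within {0..1}) ?g"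
      proof (cases "s = 0")
        case True
        have "((\<lambda>s. s * t) \<longlongrightarrow> 0) (at_right 0)" by (auto intro!: tendsto_eq_intros)
        then have "filterlim (\<lambda>s. s * t) (at_right 0) (at_right 0)"
          using assms(1) by (auto simp: filterlim_at eventually_at_right_less intro: eventually_at_rightI[of 0 1])
        then have "filterlim (\<lambda>s. - ln (s * t)) at_top (at_right 0)"
          unfolding filterlim_uminus_at_top by (simp add: filterlim_compose[OF ln_at_0])
        then have "filterlim (\<lambda>s. 3 + - ln (s * t)) at_top (at_right 0)"
          by (rule filterlim_tendsto_add_at_top[OF tendsto_const])
        from tendsto_inverse_0_at_top[OF this]
        have "((\<lambda>s. 1 / (3 - ln (s * t)) / t) \<longlongrightarrow> 0) (at_right 0)"
          by (intro tendsto_divide_zero) (simp add: inverse_eq_divide)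
        then have "(?g \<longlongrightarrow> 0) (at_right 0)"
          by (rule Lim_transform_eventually) (auto simp: eventually_at_filter)
        then show ?thesis using True
          by (simp add: continuous_within at_within_Icc_at_right)
      next
        case False
        then have s0: "0 < s" "s \<le> 1" using s by auto
        have "isCont (\<lambda>s. 1 / (3 - ln (s * t)) / t) s"
          using st[OF s0] s0 assms by (intro continuous_intros) auto
        then have "isCont ?g s"
          using eventually_nhds_in_open[of "{0<..}" s] s0(1)
          by (subst isCont_cong[of _ "\<lambda>s. 1 / (3 - ln (s * t)) / t"])
             (auto elim!: eventually_mono)
        then show ?thesis by (rule continuous_at_imp_continuous_within)
      qed
    qed
  qed simp
  then show ?thesis by blast
qed

section \<open>The approximating sequence and its pointwise limit off the axis\<close>

definition dseq :: "nat \<Rightarrow> real" where "dseq m = inverse (real (Suc m))"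
definition kseq :: "nat \<Rightarrow> real" where "kseq m = 1 / ell (dseq m) 0"

interpretation reg: regularized "kseq m" "dseq m" for m
  by unfold_locales (auto simp: dseq_def kseq_def divide_simps)

lemma dseq_tendsto: "dseq \<longlonglongrightarrow> 0"
  unfolding dseq_def[abs_def] by (rule LIMSEQ_inverse_real_of_nat)

lemma kseq_tendsto: "kseq \<longlonglongrightarrow> 0"
proof -
  have "filterlim (\<lambda>m. ln (real (Suc m))) at_top sequentially"
    using filterlim_compose[OF ln_at_top filterlim_compose[OF filterlim_real_sequentially filterlim_Suc]] .
  then have "filterlim (\<lambda>m. 3 + ln (real (Suc m))) at_top sequentially"
    by (rule filterlim_tendsto_add_at_top[OF tendsto_const])
  moreover have "kseq = (\<lambda>m. inverse (3 + ln (real (Suc m))))"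
    by (simp add: kseq_def fun_eq_iff ell_def dseq_def ln_inverse inverse_eq_divide del: of_nat_Suc
        flip: inverse_eq_divide)
  ultimately show ?thesis using tendsto_inverse_0_at_top by metis
qed

lemma ell_tendsto: "0 < t \<Longrightarrow> (\<lambda>m. ell (dseq m) t) \<longlonglongrightarrow> ell 0 t"
  unfolding ell_def by (auto intro!: tendsto_eq_intros dseq_tendsto)

lemma prof_limit_pos:
  assumes "0 < t" "t < 1"
  shows "prof 0 0 t > 0"
  unfolding prof_def ell_def using ln_less_zero[OF assms] by simp

lemma prof_tendsto:
  assumes "0 < t"
  shows "(\<lambda>m. prof (kseq m) (dseq m) t) \<longlonglongrightarrow> prof 0 0 t"
    "(\<lambda>m. prof1 (kseq m) (dseq m) t) \<longlonglongrightarrow> prof1 0 0 t"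
    "(\<lambda>m. prof2 (kseq m) (dseq m) t) \<longlonglongrightarrow> prof2 0 0 t"
  unfolding prof_def prof1_def prof2_def
  by (intro tendsto_intros ell_tendsto dseq_tendsto kseq_tendsto assms; use assms in simp)+

lemma src_tendsto:
  assumes "0 < t" "t < 1"
  shows "(\<lambda>m. src (kseq m) (dseq m) t) \<longlonglongrightarrow> src 0 0 t"
  unfolding src_def using assms prof_limit_pos[OF assms] by (intro tendsto_intros prof_tendsto) auto

lemma src_avg_tendsto:
  assumes t: "0 < t" "t < 1"
  shows "(\<lambda>m. src_avg (kseq m) (dseq m) t) \<longlonglongrightarrow> src_avg 0 0 t"
proof -
  \<comment> \<open>At \<open>s = 0\<close> the approximating integrands equal
    \<open>- ell (dseq m) 0 / 2\<close>, which tends to minus infinity. Overwriting this single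
    point restores pointwise convergence and the bound.\<close>
  let ?f = "\<lambda>k d s. if s = 0 then 0 else src k d (s * t)"
  have eq: "integral {0..1} (?f k d) = src_avg k d t" for k d
    unfolding src_avg_def by (rule integral_spike[of "{0}"]) auto
  have st: "0 < s * t" "s * t < 1" if "0 < s" "s \<le> 1" for s
  proof -
    show "0 < s * t" using that t by simp
    have "s * t \<le> 1 * t" using that t by (intro mult_right_mono) auto
    then show "s * t < 1" using t by linarith
  qed
  have "(\<lambda>m. integral {0..1} (?f (kseq m) (dseq m))) \<longlonglongrightarrow> integral {0..1} (?f 0 0)"
  proof (rule dominated_convergence(2))
    show "?f (kseq m) (dseq m) integrable_on {0..1}" for m
    proof -
      have "(\<lambda>s. s * t) ` {0..1} \<subseteq> {- dseq m / 2 <..< 2}"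
      proof (rule image_subsetI)
        fix s :: real assume "s \<in> {0..1}"
        then have "0 \<le> s * t" "s * t < 1" using st[of s] t by (cases "s = 0"; simp)+
        then show "s * t \<in> {- dseq m / 2 <..< 2}" by (rule reg.in_U)
      qed
      then have "(\<lambda>s. src (kseq m) (dseq m) (s * t)) integrable_on {0..1}"
        by (intro integrable_continuous_interval
            continuous_on_compose2[OF smooth_on_imp_continuous_on[OF reg.smooth_src]] continuous_intros)
      then show ?thesis by (rule integrable_spike[of _ _ "{0}"]) auto
    qed
    show "(\<lambda>s. (32 + log_const) * majorant (s * t)) integrable_on {0..1}"
      by (intro integrable_on_mult_right majorant_integrable_dilation t)
    show "norm (?f (kseq m) (dseq m) s) \<le> (32 + log_const) * majorant (s * t)" if "s \<in> {0..1}" for m s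
    proof (cases "s = 0")
      case False
      then have *: "0 < s * t" "s * t < 1" using st[of s] that by auto
      have "\<bar>src (kseq m) (dseq m) (s * t)\<bar> \<le> (32 + log_const) * (1 / ((s * t + dseq m) * (ell (dseq m) (s * t))\<^sup>2))"
        using reg.src_bound2[of "s * t" m] * by simp
      also have "\<dots> \<le> (32 + log_const) * majorant (s * t)"
        using reg.majorant_ge[OF *, of m] log_const_ge by (intro mult_left_mono) auto
      finally show ?thesis using False by simp
    qed (simp add: majorant_def)
    show "(\<lambda>m. ?f (kseq m) (dseq m) s) \<longlonglongrightarrow> ?f 0 0 s" if "s \<in> {0..1}" for s
      using that src_tendsto[of "s * t"] st[of s] by auto
  qed
  then show ?thesis unfolding eq .
qed

lemma drift_tendsto:
  assumes x: "x \<in> unit_ball" "0 < rsq x"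
  shows "(\<lambda>m. drift (kseq m) (dseq m) x) \<longlonglongrightarrow> drift 0 0 x"
proof (rule vec_tendstoI)
  fix i :: 3
  note t = x(2) ball_rsq(1)[OF x(1)]
  note p = prof_limit_pos[OF t]
  have "(\<lambda>m. drift (kseq m) (dseq m) x $ 1) \<longlonglongrightarrow> drift 0 0 x $ 1"
    "(\<lambda>m. drift (kseq m) (dseq m) x $ 2) \<longlonglongrightarrow> drift 0 0 x $ 2"
    "(\<lambda>m. drift (kseq m) (dseq m) x $ 3) \<longlonglongrightarrow> drift 0 0 x $ 3"
    unfolding drift_nth drift_h_def drift_v_def
    by (intro tendsto_intros prof_tendsto src_tendsto src_avg_tendsto t one_plus_square_nonzero;
      use p in simp)+
  then show "(\<lambda>m. drift (kseq m) (dseq m) x $ i) \<longlonglongrightarrow> drift 0 0 x $ i"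
    using exhaust_3[of i] by auto
qed

lemma pot_tendsto: "0 < rsq x \<Longrightarrow> (\<lambda>m. pot (kseq m) (dseq m) x) \<longlonglongrightarrow> pot 0 0 x"
  unfolding pot_def by (intro tendsto_intros prof_tendsto) auto

text \<open>An explicit formula that remains meaningful for \<open>k = d = 0\<close> off the axis,
  so that the candidate for the weak gradient of the limit is obtained without differentiating the
  limit.\<close>

definition grad_pot :: "real \<Rightarrow> real \<Rightarrow> real^3 \<Rightarrow> real^3"
  where "grad_pot k d x =
    (let A = prof k d (rsq x); Q = 1 / (1 + (x$3 * A)\<^sup>2)
     in vector [x$1 * x$3 * prof1 k d (rsq x) * Q, x$2 * x$3 * prof1 k d (rsq x) * Q, A / 2 * Q])"

lemma (in regularized) grad_pot: "x \<in> S \<Longrightarrow> grad (pot k d) x = grad_pot k d x"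
  by (simp add: vec_eq_iff forall_3 grad_def grad_pot_def Let_def sum_Basis_3 pot_partial)

lemma grad_pot_tendsto:
  assumes "0 < rsq x"
  shows "(\<lambda>m. grad_pot (kseq m) (dseq m) x) \<longlonglongrightarrow> grad_pot 0 0 x"
proof (rule vec_tendstoI)
  fix i :: 3
  have "(\<lambda>m. grad_pot (kseq m) (dseq m) x $ 1) \<longlonglongrightarrow> grad_pot 0 0 x $ 1"
    "(\<lambda>m. grad_pot (kseq m) (dseq m) x $ 2) \<longlonglongrightarrow> grad_pot 0 0 x $ 2"
    "(\<lambda>m. grad_pot (kseq m) (dseq m) x $ 3) \<longlonglongrightarrow> grad_pot 0 0 x $ 3"
    unfolding grad_pot_def Let_def vector_3
    by (intro tendsto_intros prof_tendsto assms one_plus_square_nonzero; simp)+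
  then show "(\<lambda>m. grad_pot (kseq m) (dseq m) x $ i) \<longlonglongrightarrow> grad_pot 0 0 x $ i"
    using exhaust_3[of i] by auto
qed

lemma (in regularized) grad_pot_bound:
  assumes "x \<in> ball 0 1" "0 < rsq x"
  shows "(norm (grad_pot k d x))\<^sup>2 \<le> 3 * log_const * majorant (rsq x)"
proof -
  have x: "x \<in> S" using ball_rsq[OF assms(1)] by simp
  have "grad_pot k d x $ 1 = partial_deriv (axis 1 1) (pot k d) x"
    "grad_pot k d x $ 2 = partial_deriv (axis 2 1) (pot k d) x"
    "grad_pot k d x $ 3 = partial_deriv (axis 3 1) (pot k d) x"
    unfolding grad_pot_def Let_def vector_3 pot_partial[OF x] by (rule refl)+
  then have "(grad_pot k d x $ i)\<^sup>2 \<le> log_const * majorant (rsq x)" for i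
    using pot_partial_bound[OF assms, of i] exhaust_3[of i] by auto
  from this[of 1] this[of 2] this[of 3] show ?thesis
    unfolding power2_norm_eq_inner inner_vec_def by (simp add: sum_3 power2_eq_square)
qed

abbreviation (input) "drift_seq m \<equiv> drift (kseq m) (dseq m)"
abbreviation (input) "pot_seq m \<equiv> pot (kseq m) (dseq m)"

text \<open>The case distinction discards the values on the axis, where \<open>ln 0 = 0\<close> makes the formulas meaningless.\<close>

definition drift_lim :: "real^3 \<Rightarrow> real^3" where "drift_lim x = (if 0 < rsq x then drift 0 0 x else 0)"
definition pot_lim :: "real^3 \<Rightarrow> real" where "pot_lim x = (if 0 < rsq x then pot 0 0 x else 0)"
definition grad_lim :: "real^3 \<Rightarrow> real^3" where "grad_lim x = (if 0 < rsq x then grad_pot 0 0 x else 0)"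

section \<open>Convergence of the approximations and properties of the limit pair\<close>

lemma cball_subset_cylinder: "cball 0 1 \<subseteq> {x :: real^3. rsq x < 2}"
proof
  fix x :: "real^3" assume "x \<in> cball 0 1"
  then have "(norm x)\<^sup>2 \<le> 1" by (simp add: power_le_one)
  then have "(x$1)\<^sup>2 + (x$2)\<^sup>2 + (x$3)\<^sup>2 \<le> 1"
    unfolding power2_norm_eq_inner inner_vec_def by (simp add: sum_3 power2_eq_square)
  then have "rsq x \<le> 1" unfolding rsq_def using zero_le_power2[of "x$3"] by linarith
  then show "x \<in> {x. rsq x < 2}" by simp
qed

lemma ball_subset_cylinder: "unit_ball \<subseteq> {x :: real^3. rsq x < 2}"
  using cball_subset_cylinder ball_subset_cball by blast

lemma finite_measure_leb_ball: "finite_measure leb_ball"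
  by (rule finite_measure_lebesgue_on[OF lmeasurable_ball])

lemma pot_seq_bound: "\<bar>pot_seq m x\<bar> \<le> 1" 
  using arctan_bounded[of "x$3 * prof (kseq m) (dseq m) (rsq x)"] pi_less_4 by (simp add: pot_def abs_if)

lemma pot_lim_bound: "\<bar>pot_lim x\<bar> \<le> 1"
  using arctan_bounded[of "x$3 * prof 0 0 (rsq x)"] pi_less_4 by (simp add: pot_lim_def pot_def abs_if)

lemma smooth_drift_seq: "smooth_on unit_ball (drift_seq m)" and smooth_pot_seq: "smooth_on unit_ball (pot_seq m)"
  using reg.smooth_drift reg.smooth_pot ball_subset_cylinder by (auto intro: smooth_on_subset)

lemma meas_drift_seq: "drift_seq m \<in> borel_measurable leb_ball" and meas_pot_seq: "pot_seq m \<in> borel_measurable leb_ball"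
  using smooth_drift_seq smooth_pot_seq smooth_on_imp_continuous_on continuous_imp_measurable_unit_ball by blast+

lemma continuous_on_grad:
  assumes "open S" "smooth_on S u"
  shows "continuous_on S (grad u)"
  unfolding grad_def[abs_def] using assms
  by (intro continuous_intros smooth_on_imp_continuous_on smooth_on_partial_deriv) auto

lemma meas_grad_pot_seq: "grad (pot_seq m) \<in> borel_measurable leb_ball"
  by (intro continuous_imp_measurable_unit_ball continuous_on_grad smooth_pot_seq) auto

lemma drift_seq_tendsto: "0 < rsq x \<Longrightarrow> x \<in> unit_ball \<Longrightarrow> (\<lambda>m. drift_seq m x) \<longlonglongrightarrow> drift_lim x"
  using drift_tendsto by (simp add: drift_lim_def)

lemma pot_seq_tendsto: "0 < rsq x \<Longrightarrow> (\<lambda>m. pot_seq m x) \<longlonglongrightarrow> pot_lim x"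
  using pot_tendsto by (simp add: pot_lim_def)

lemma grad_pot_seq: "x \<in> unit_ball \<Longrightarrow> grad (pot_seq m) x = grad_pot (kseq m) (dseq m) x"
  using reg.grad_pot ball_subset_cylinder by blast

lemma grad_pot_seq_tendsto: "0 < rsq x \<Longrightarrow> x \<in> unit_ball \<Longrightarrow> (\<lambda>m. grad (pot_seq m) x) \<longlonglongrightarrow> grad_lim x"
  using grad_pot_tendsto by (simp add: grad_lim_def grad_pot_seq)

lemma meas_drift_lim: "drift_lim \<in> borel_measurable leb_ball"
  unfolding drift_lim_def[abs_def] by (rule off_axis_limit_measurable[OF meas_drift_seq drift_tendsto])

lemma meas_pot_lim: "pot_lim \<in> borel_measurable leb_ball"
  unfolding pot_lim_def[abs_def] by (rule off_axis_limit_measurable[OF meas_pot_seq pot_tendsto])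

lemma meas_grad_lim: "grad_lim \<in> borel_measurable leb_ball"
  unfolding grad_lim_def[abs_def]
  by (rule off_axis_limit_measurable[OF meas_grad_pot_seq]) (use grad_pot_tendsto grad_pot_seq in simp)

lemma drift_seq_bound: "x \<in> unit_ball \<Longrightarrow> 0 < rsq x \<Longrightarrow> norm (drift_seq m x) \<le> drift_const * majorant (rsq x)"
  by (rule reg.drift_bound)

lemma drift_lim_bound: "x \<in> unit_ball \<Longrightarrow> 0 < rsq x \<Longrightarrow> norm (drift_lim x) \<le> drift_const * majorant (rsq x)"
  using LIMSEQ_le_const2[OF tendsto_norm[OF drift_seq_tendsto]] drift_seq_bound by blast

lemma integrable_mult_majorant: "integrable leb_ball (\<lambda>x. c * majorant (rsq x))"
  using integrable_majorant_rsq by simp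

lemma integrable_const_leb_ball: "integrable leb_ball (\<lambda>x. c :: real)"
  using finite_measure.integrable_const[OF finite_measure_leb_ball] .

lemmas drift_seq_dominated = off_axis_dominated_convergence[OF meas_drift_seq meas_drift_lim integrable_mult_majorant drift_seq_tendsto drift_seq_bound]

lemma in_L1_drift: "in_L1 unit_ball (drift_seq m)" "in_L1 unit_ball drift_lim"
  using drift_seq_dominated(1,2) by (auto simp: in_L1_def)

lemma L1_norm_drift_seq: "L1_norm unit_ball (drift_seq m) \<le> integral\<^sup>L leb_ball (\<lambda>x. drift_const * majorant (rsq x))"
  unfolding L1_norm_def
proof (rule integral_mono_AE)
  show "integrable leb_ball (\<lambda>x. norm (drift_seq m x))" using in_L1_drift by (simp add: in_L1_def)
  show "AE x in leb_ball. norm (drift_seq m x) \<le> drift_const * majorant (rsq x)"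
    using AE_off_axis by eventually_elim (use drift_seq_bound in auto)
qed (rule integrable_mult_majorant)

lemma L1_norm_drift_tendsto: "(\<lambda>m. L1_norm unit_ball (\<lambda>x. drift_seq m x - drift_lim x)) \<longlonglongrightarrow> 0"
proof -
  have "(\<lambda>m. integral\<^sup>L leb_ball (\<lambda>x. norm (drift_seq m x - drift_lim x))) \<longlonglongrightarrow> integral\<^sup>L leb_ball (\<lambda>x. 0)"
  proof (rule off_axis_dominated_convergence(3)[OF _ _ integrable_mult_majorant[of "2 * drift_const"]])
    show "(\<lambda>x. norm (drift_seq m x - drift_lim x)) \<in> borel_measurable leb_ball" for m
      using meas_drift_seq[of m] meas_drift_lim by measurable
    show "(\<lambda>m. norm (drift_seq m x - drift_lim x)) \<longlonglongrightarrow> 0" if "x \<in> unit_ball" "0 < rsq x" for x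
      using tendsto_norm_zero[OF LIM_zero[OF drift_seq_tendsto[OF that(2,1)]]] .
    show "norm (norm (drift_seq m x - drift_lim x)) \<le> 2 * drift_const * majorant (rsq x)" if "x \<in> unit_ball" "0 < rsq x" for m x
      using drift_seq_bound[OF that, of m] drift_lim_bound[OF that] norm_triangle_ineq4[of "drift_seq m x" "drift_lim x"] by simp
  qed simp
  then show ?thesis by (simp add: L1_norm_def)
qed

lemma divergence_drift_seq: "(\<Sum>e\<in>Basis. partial_deriv e (\<lambda>x. drift_seq m x \<bullet> e) x) = 0" if "x \<in> unit_ball"
  using reg.divergence_drift that ball_subset_cylinder by blast

lemma divergence_free_drift_seq: "divergence_free unit_ball (drift_seq m)"
  by (rule divergence_free_smooth[OF open_ball smooth_drift_seq divergence_drift_seq])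

lemma solution_pot_seq: "classical_solution unit_ball (drift_seq m) (pot_seq m)"
  using reg.pot_solution[of m] ball_subset_cylinder unfolding classical_solution_def by blast

text \<open>The drift is continuous on the closed ball, which the cylinder contains, hence bounded;
  the bound depends on \<open>m\<close>.\<close>

lemma L2_drift_seq: "in_L2 unit_ball (drift_seq m)"
proof -
  have "compact (drift_seq m ` cball 0 1)"
    using smooth_on_imp_continuous_on[OF reg.smooth_drift] cball_subset_cylinder
    by (intro compact_continuous_image) (auto intro: continuous_on_subset)
  then obtain M where "\<And>y. y \<in> drift_seq m ` cball 0 1 \<Longrightarrow> norm y \<le> M"
    using compact_imp_bounded bounded_iff by metis
  then have M: "norm (drift_seq m x) \<le> M" if "x \<in> unit_ball" for x using that by force
  have "integrable leb_ball (\<lambda>x. (norm (drift_seq m x))\<^sup>2)"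
  proof (rule Bochner_Integration.integrable_bound[OF integrable_const_leb_ball[of "M\<^sup>2"]])
    show "(\<lambda>x. (norm (drift_seq m x))\<^sup>2) \<in> borel_measurable leb_ball" using meas_drift_seq[of m] by measurable
    show "AE x in leb_ball. norm ((norm (drift_seq m x))\<^sup>2) \<le> norm (M\<^sup>2)"
      using AE_off_axis by eventually_elim (use M in \<open>auto intro!: power_mono\<close>)
  qed
  then show ?thesis using meas_drift_seq by (simp add: in_L2_def)
qed

lemma test_fun_derivatives_bounded:
  fixes v :: "'a::euclidean_space \<Rightarrow> real"
  assumes v: "test_fun S v"
  obtains M where "\<And>x. norm (grad v x) \<le> M" "\<And>x. \<bar>laplacian v x\<bar> \<le> M" "\<And>x. \<bar>v x\<bar> \<le> M" "M \<ge> 0"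
    "continuous_on UNIV (grad v)" "continuous_on UNIV (laplacian v)" "continuous_on UNIV v"
proof -
  obtain M0 where M0: "M0 \<ge> 0" "\<And>x. \<bar>v x\<bar> \<le> M0" using test_fun_bounded[OF v] by blast
  have "\<exists>M\<ge>0. \<forall>x. \<bar>partial_deriv e v x\<bar> \<le> M" if "e \<in> Basis" for e
    using test_fun_bounded[OF test_fun_partial_deriv[OF v that]] by metis
  then obtain M1 where M1: "\<And>e x. e \<in> Basis \<Longrightarrow> M1 e \<ge> 0 \<and> \<bar>partial_deriv e v x\<bar> \<le> M1 e"
    by metis
  have "\<exists>M\<ge>0. \<forall>x. \<bar>partial_deriv e (partial_deriv e v) x\<bar> \<le> M" if "e \<in> Basis" for e
    using test_fun_bounded[OF test_fun_partial_deriv[OF test_fun_partial_deriv[OF v that] that]] by metis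
  then obtain M2 where M2: "\<And>e x. e \<in> Basis \<Longrightarrow> M2 e \<ge> 0 \<and> \<bar>partial_deriv e (partial_deriv e v) x\<bar> \<le> M2 e"
    by metis
  have s: "smooth_on UNIV v" using v by (simp add: test_fun_def)
  have S1: "0 \<le> sum M1 Basis" "0 \<le> sum M2 Basis" using M1 M2 by (auto intro!: sum_nonneg)
  show ?thesis
  proof (rule that[of "M0 + sum M1 Basis + sum M2 Basis"])
    fix x
    have "norm (grad v x) \<le> (\<Sum>e\<in>Basis. norm (partial_deriv e v x *\<^sub>R e))"
      unfolding grad_def by (rule norm_sum)
    also have "\<dots> \<le> sum M1 Basis" using M1 by (intro sum_mono) auto
    finally show "norm (grad v x) \<le> M0 + sum M1 Basis + sum M2 Basis" using M0 S1 by linarith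
    have "\<bar>laplacian v x\<bar> \<le> (\<Sum>e\<in>Basis. \<bar>partial_deriv e (partial_deriv e v) x\<bar>)"
      unfolding laplacian_def by (rule sum_abs)
    also have "\<dots> \<le> sum M2 Basis" using M2 by (intro sum_mono) auto
    finally show "\<bar>laplacian v x\<bar> \<le> M0 + sum M1 Basis + sum M2 Basis" using M0 S1 by linarith
    show "\<bar>v x\<bar> \<le> M0 + sum M1 Basis + sum M2 Basis" using M0(2)[of x] S1 by linarith
  next
    show "continuous_on UNIV (grad v)" by (rule continuous_on_grad[OF open_UNIV s])
    show "continuous_on UNIV v" by (rule smooth_on_imp_continuous_on[OF s])
    show "continuous_on UNIV (laplacian v)" unfolding laplacian_def[abs_def] using s
      by (intro continuous_intros smooth_on_imp_continuous_on smooth_on_partial_deriv)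
  qed (use M0 S1 in auto)
qed

lemma continuous_UNIV_measurable:
  fixes f :: "real^3 \<Rightarrow> 'b::euclidean_space"
  shows "continuous_on UNIV f \<Longrightarrow> f \<in> borel_measurable leb_ball"
  by (intro continuous_imp_measurable_unit_ball) (auto intro: continuous_on_subset)

lemma divergence_free_drift_lim: "divergence_free unit_ball drift_lim"
  unfolding divergence_free_def
proof (intro allI impI)
  fix v assume v: "test_fun unit_ball v"
  obtain M where M: "\<And>x. norm (grad v x) \<le> M" "M \<ge> 0" "continuous_on UNIV (grad v)"
    using test_fun_derivatives_bounded[OF v] by metis
  note mg = continuous_UNIV_measurable[OF M(3)]
  have "(\<lambda>m. integral\<^sup>L leb_ball (\<lambda>x. drift_seq m x \<bullet> grad v x)) \<longlonglongrightarrow> integral\<^sup>L leb_ball (\<lambda>x. drift_lim x \<bullet> grad v x)"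
  proof (rule off_axis_dominated_convergence(3)[OF _ _ integrable_mult_majorant[of "drift_const * M"]])
    show "(\<lambda>x. drift_seq m x \<bullet> grad v x) \<in> borel_measurable leb_ball" for m using meas_drift_seq[of m] mg by measurable
    show "(\<lambda>x. drift_lim x \<bullet> grad v x) \<in> borel_measurable leb_ball" using meas_drift_lim mg by measurable
    show "(\<lambda>m. drift_seq m x \<bullet> grad v x) \<longlonglongrightarrow> drift_lim x \<bullet> grad v x" if "x \<in> unit_ball" "0 < rsq x" for x
      by (intro tendsto_intros drift_seq_tendsto that)
    show "norm (drift_seq m x \<bullet> grad v x) \<le> drift_const * M * majorant (rsq x)" if "x \<in> unit_ball" "0 < rsq x" for m x
    proof -
      have "\<bar>drift_seq m x \<bullet> grad v x\<bar> \<le> norm (drift_seq m x) * norm (grad v x)" by (rule Cauchy_Schwarz_ineq2)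
      also have "\<dots> \<le> (drift_const * majorant (rsq x)) * M"
        using drift_seq_bound[OF that, of m] M(1)[of x] order.trans[OF norm_ge_zero drift_seq_bound[OF that, of m]]
        by (intro mult_mono) auto
      finally show ?thesis by (simp add: mult_ac)
    qed
  qed
  then have "(\<lambda>m. 0) \<longlonglongrightarrow> integral\<^sup>L leb_ball (\<lambda>x. drift_lim x \<bullet> grad v x)"
    using divergence_free_drift_seq v by (simp add: divergence_free_def)
  then show "integral\<^sup>L leb_ball (\<lambda>x. drift_lim x \<bullet> grad v x) = 0" by (simp add: LIMSEQ_const_iff)
qed

text \<open>Both factors of the product \<open>u b\<close> converge pointwise off the axis, and
  \<open>|u| <= 1\<close>, so the majorant of the drift dominates the weak form, which is 0 for each
  smooth pair.\<close>

lemma distributional_pot_lim: "distributional_solution unit_ball drift_lim pot_lim"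
  unfolding distributional_solution_def
proof (intro allI impI)
  fix v assume v: "test_fun unit_ball v"
  obtain M where M: "\<And>x. norm (grad v x) \<le> M" "\<And>x. \<bar>laplacian v x\<bar> \<le> M" "M \<ge> 0"
    "continuous_on UNIV (grad v)" "continuous_on UNIV (laplacian v)"
    using test_fun_derivatives_bounded[OF v] by metis
  note mg = continuous_UNIV_measurable[OF M(4)] continuous_UNIV_measurable[OF M(5)]
  have "(\<lambda>m. integral\<^sup>L leb_ball (\<lambda>x. pot_seq m x * laplacian v x + pot_seq m x * (drift_seq m x \<bullet> grad v x)))
      \<longlonglongrightarrow> integral\<^sup>L leb_ball (\<lambda>x. pot_lim x * laplacian v x + pot_lim x * (drift_lim x \<bullet> grad v x))"
  proof (rule off_axis_dominated_convergence(3))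
    show "integrable leb_ball (\<lambda>x. M + drift_const * M * majorant (rsq x))"
      by (intro Bochner_Integration.integrable_add integrable_mult_majorant integrable_const_leb_ball)
    show "(\<lambda>x. pot_seq m x * laplacian v x + pot_seq m x * (drift_seq m x \<bullet> grad v x)) \<in> borel_measurable leb_ball" for m
      using meas_drift_seq[of m] meas_pot_seq[of m] mg by measurable
    show "(\<lambda>x. pot_lim x * laplacian v x + pot_lim x * (drift_lim x \<bullet> grad v x)) \<in> borel_measurable leb_ball"
      using meas_drift_lim meas_pot_lim mg by measurable
    show "(\<lambda>m. pot_seq m x * laplacian v x + pot_seq m x * (drift_seq m x \<bullet> grad v x))
        \<longlonglongrightarrow> pot_lim x * laplacian v x + pot_lim x * (drift_lim x \<bullet> grad v x)" if "x \<in> unit_ball" "0 < rsq x" for x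
      by (intro tendsto_intros drift_seq_tendsto pot_seq_tendsto that)
    show "norm (pot_seq m x * laplacian v x + pot_seq m x * (drift_seq m x \<bullet> grad v x)) \<le> M + drift_const * M * majorant (rsq x)"
      if "x \<in> unit_ball" "0 < rsq x" for m x
    proof -
      have "\<bar>drift_seq m x \<bullet> grad v x\<bar> \<le> norm (drift_seq m x) * norm (grad v x)" by (rule Cauchy_Schwarz_ineq2)
      also have "\<dots> \<le> (drift_const * majorant (rsq x)) * M"
        using drift_seq_bound[OF that, of m] M(1)[of x] order.trans[OF norm_ge_zero drift_seq_bound[OF that, of m]]
        by (intro mult_mono) auto
      finally have 1: "\<bar>drift_seq m x \<bullet> grad v x\<bar> \<le> drift_const * M * majorant (rsq x)" by (simp add: mult_ac)
      have "\<bar>pot_seq m x * laplacian v x\<bar> \<le> 1 * M"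
        unfolding abs_mult using pot_seq_bound[of m x] M(2)[of x] by (intro mult_mono) auto
      moreover have "\<bar>pot_seq m x * (drift_seq m x \<bullet> grad v x)\<bar> \<le> 1 * (drift_const * M * majorant (rsq x))"
        unfolding abs_mult using pot_seq_bound[of m x] 1 by (intro mult_mono) auto
      ultimately show ?thesis
        using abs_triangle_ineq[of "pot_seq m x * laplacian v x" "pot_seq m x * (drift_seq m x \<bullet> grad v x)"] by simp
    qed
  qed
  moreover have "distributional_solution unit_ball (drift_seq m) (pot_seq m)" for m
    by (rule smooth_classical_imp_distributional_solution[OF open_ball smooth_drift_seq smooth_pot_seq divergence_drift_seq solution_pot_seq])
  ultimately have "(\<lambda>m. 0) \<longlonglongrightarrow> integral\<^sup>L leb_ball (\<lambda>x. pot_lim x * laplacian v x + pot_lim x * (drift_lim x \<bullet> grad v x))"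
    using v by (simp add: distributional_solution_def)
  then show "integral\<^sup>L leb_ball (\<lambda>x. pot_lim x * laplacian v x + pot_lim x * (drift_lim x \<bullet> grad v x)) = 0"
    by (simp add: LIMSEQ_const_iff)
qed

lemma Linf_le_1:
  assumes "u \<in> borel_measurable leb_ball" "\<And>x. \<bar>u x\<bar> \<le> 1"
  shows "Linf_norm unit_ball u \<le> 1" "in_Linf unit_ball u"
proof -
  show *: "Linf_norm unit_ball u \<le> 1"
    unfolding Linf_norm_def using assms by (intro esssup_I) auto
  have "(1::ereal) < \<infinity>" by simp
  from order.strict_trans1[OF * this] show "in_Linf unit_ball u" using assms(1) by (simp add: in_Linf_def)
qed

lemma grad_lim_bound: "x \<in> unit_ball \<Longrightarrow> 0 < rsq x \<Longrightarrow> (norm (grad_lim x))\<^sup>2 \<le> 3 * log_const * majorant (rsq x)"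
  using LIMSEQ_le_const2[OF tendsto_power[OF tendsto_norm[OF grad_pot_seq_tendsto]]] reg.grad_pot_bound grad_pot_seq by metis

lemma H1_pot_lim: "in_H1 unit_ball pot_lim"
  unfolding in_H1_def
proof (intro conjI exI[of _ grad_lim] allI impI)
  have "integrable leb_ball (\<lambda>x. (norm (pot_lim x))\<^sup>2)"
  proof (rule Bochner_Integration.integrable_bound[OF integrable_const_leb_ball[of 1]])
    show "(\<lambda>x. (norm (pot_lim x))\<^sup>2) \<in> borel_measurable leb_ball" using meas_pot_lim by measurable
  qed (use pot_lim_bound in \<open>auto simp: abs_square_le_1\<close>)
  then show "in_L2 unit_ball pot_lim" using meas_pot_lim by (simp add: in_L2_def)
  have "integrable leb_ball (\<lambda>x. (norm (grad_lim x))\<^sup>2)"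
  proof (rule Bochner_Integration.integrable_bound[OF integrable_mult_majorant[of "3 * log_const"]])
    show "(\<lambda>x. (norm (grad_lim x))\<^sup>2) \<in> borel_measurable leb_ball" using meas_grad_lim by measurable
    show "AE x in leb_ball. norm ((norm (grad_lim x))\<^sup>2) \<le> norm (3 * log_const * majorant (rsq x))"
      using AE_off_axis by eventually_elim (use grad_lim_bound in force)
  qed
  then show "in_L2 unit_ball grad_lim" using meas_grad_lim by (simp add: in_L2_def)
next
  fix v assume v: "test_fun unit_ball v"
  obtain M where M: "\<And>x. norm (grad v x) \<le> M" "\<And>x. \<bar>v x\<bar> \<le> M" "M \<ge> 0"
    "continuous_on UNIV (grad v)" "continuous_on UNIV v"
    using test_fun_derivatives_bounded[OF v] by metis
  note mg = continuous_UNIV_measurable[OF M(4)] continuous_UNIV_measurable[OF M(5)]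
  have 1: "(\<lambda>m. integral\<^sup>L leb_ball (\<lambda>x. pot_seq m x *\<^sub>R grad v x)) \<longlonglongrightarrow> integral\<^sup>L leb_ball (\<lambda>x. pot_lim x *\<^sub>R grad v x)"
  proof (rule off_axis_dominated_convergence(3)[OF _ _ integrable_const_leb_ball[of "1 * M"]])
    show "(\<lambda>x. pot_seq m x *\<^sub>R grad v x) \<in> borel_measurable leb_ball" for m using meas_pot_seq[of m] mg by measurable
    show "(\<lambda>x. pot_lim x *\<^sub>R grad v x) \<in> borel_measurable leb_ball" using meas_pot_lim mg by measurable
    show "(\<lambda>m. pot_seq m x *\<^sub>R grad v x) \<longlonglongrightarrow> pot_lim x *\<^sub>R grad v x" if "x \<in> unit_ball" "0 < rsq x" for x
      by (intro tendsto_intros pot_seq_tendsto that)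
    show "norm (pot_seq m x *\<^sub>R grad v x) \<le> 1 * M" for m x
      unfolding norm_scaleR using pot_seq_bound[of m x] M(1)[of x] by (intro mult_mono) auto
  qed
  have 2: "(\<lambda>m. integral\<^sup>L leb_ball (\<lambda>x. v x *\<^sub>R grad (pot_seq m) x)) \<longlonglongrightarrow> integral\<^sup>L leb_ball (\<lambda>x. v x *\<^sub>R grad_lim x)"
  proof (rule off_axis_dominated_convergence(3))
    show "integrable leb_ball (\<lambda>x. M + M * (3 * log_const) * majorant (rsq x))"
      by (intro Bochner_Integration.integrable_add integrable_mult_majorant integrable_const_leb_ball)
    show "(\<lambda>x. v x *\<^sub>R grad (pot_seq m) x) \<in> borel_measurable leb_ball" for m using meas_grad_pot_seq[of m] mg by measurable
    show "(\<lambda>x. v x *\<^sub>R grad_lim x) \<in> borel_measurable leb_ball" using meas_grad_lim mg by measurable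
    show "(\<lambda>m. v x *\<^sub>R grad (pot_seq m) x) \<longlonglongrightarrow> v x *\<^sub>R grad_lim x" if "x \<in> unit_ball" "0 < rsq x" for x
      by (intro tendsto_intros grad_pot_seq_tendsto that)
    show "norm (v x *\<^sub>R grad (pot_seq m) x) \<le> M + M * (3 * log_const) * majorant (rsq x)" if "x \<in> unit_ball" "0 < rsq x" for m x
    proof -
      let ?n = "norm (grad (pot_seq m) x)"
      \<comment> \<open>Only the square of the gradient has been bounded;
        \<open>n <= 1 + n^2\<close> turns this into an integrable bound for the gradient
        itself.\<close>
      have "2 * ?n \<le> 1 + ?n\<^sup>2" using zero_le_power2[of "?n - 1"] by (simp add: power2_diff)
      then have "?n \<le> 1 + ?n\<^sup>2" using norm_ge_zero[of "grad (pot_seq m) x"] by linarith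
      also have "\<dots> \<le> 1 + 3 * log_const * majorant (rsq x)"
        using reg.grad_pot_bound[OF that, of m] grad_pot_seq[OF that(1)] by simp
      finally have "\<bar>v x\<bar> * ?n \<le> M * (1 + 3 * log_const * majorant (rsq x))"
        using M(2)[of x] M(3) by (intro mult_mono) auto
      then show ?thesis by (simp add: algebra_simps)
    qed
  qed
  have "integral\<^sup>L leb_ball (\<lambda>x. pot_seq m x *\<^sub>R grad v x) = - integral\<^sup>L leb_ball (\<lambda>x. v x *\<^sub>R grad (pot_seq m) x)" for m
    by (rule smooth_on_weak_gradient[OF open_ball smooth_pot_seq v])
  then show "integral\<^sup>L leb_ball (\<lambda>x. pot_lim x *\<^sub>R grad v x) = - integral\<^sup>L leb_ball (\<lambda>x. v x *\<^sub>R grad_lim x)"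
    using LIMSEQ_unique[OF 1] tendsto_minus[OF 2] by simp
qed

lemma weak_star_pot_seq: "weak_star_conv unit_ball pot_seq pot_lim"
  unfolding weak_star_conv_def
proof (intro conjI allI impI)
  show "in_Linf unit_ball (pot_seq m)" for m by (rule Linf_le_1[OF meas_pot_seq pot_seq_bound])
  show "in_Linf unit_ball pot_lim" by (rule Linf_le_1[OF meas_pot_lim pot_lim_bound])
  fix \<phi> :: "real^3 \<Rightarrow> real" assume p: "in_L1 unit_ball \<phi>"
  then have mp: "\<phi> \<in> borel_measurable leb_ball" by (auto simp: in_L1_def)
  show "(\<lambda>m. integral\<^sup>L leb_ball (\<lambda>x. pot_seq m x * \<phi> x)) \<longlonglongrightarrow> integral\<^sup>L leb_ball (\<lambda>x. pot_lim x * \<phi> x)"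
  proof (rule off_axis_dominated_convergence(3))
    show "integrable leb_ball (\<lambda>x. \<bar>\<phi> x\<bar>)" using p by (auto simp: in_L1_def)
    show "(\<lambda>x. pot_seq m x * \<phi> x) \<in> borel_measurable leb_ball" for m using meas_pot_seq[of m] mp by measurable
    show "(\<lambda>x. pot_lim x * \<phi> x) \<in> borel_measurable leb_ball" using meas_pot_lim mp by measurable
    show "(\<lambda>m. pot_seq m x * \<phi> x) \<longlonglongrightarrow> pot_lim x * \<phi> x" if "x \<in> unit_ball" "0 < rsq x" for x
      by (intro tendsto_intros pot_seq_tendsto that)
    show "norm (pot_seq m x * \<phi> x) \<le> \<bar>\<phi> x\<bar>" for m x
      using pot_seq_bound[of m x] by (simp add: abs_mult mult_left_le_one_le)
  qed
qed

section \<open>Discontinuity at the origin and the jump of the approximations\<close>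

lemma AE_unit_ball_open:
  assumes "AE x in leb_ball. P x" "open G" "G \<subseteq> unit_ball" "G \<noteq> {}"
  obtains x where "x \<in> G" "P x"
proof -
  have "AE x in lebesgue. x \<in> unit_ball \<longrightarrow> P x"
    using assms(1) by (subst (asm) AE_restrict_space_iff) (auto simp: lmeasurable_open)
  then obtain N where N: "N \<in> null_sets lebesgue" "{x. \<not> (x \<in> unit_ball \<longrightarrow> P x)} \<subseteq> N"
    unfolding eventually_ae_filter by auto
  have "\<exists>x\<in>G. P x"
  proof (rule ccontr)
    assume "\<not> (\<exists>x\<in>G. P x)"
    then have "G \<subseteq> N" using N(2) assms(3) by blast
    then have "negligible G" using N(1) negligible_iff_null_sets negligible_subset by blast
    then show False using open_not_negligible assms(2,4) by blast
  qed
  then show ?thesis using that by blast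
qed

text \<open>The sign \<sigma> selects the half-space. On \<open>G\<close> one has
  \<open>|z| > \<rho> / 4\<close>, and \<open>rsq x < exp (- 4 / \<rho>)\<close> makes the profile
  at least \<open>4 / \<rho>\<close>; so \<open>|z A| >= 1\<close>, and half of
  \<open>arctan 1\<close> is pi / 8. An open set is needed, since single points say nothing about
  other representatives.\<close>

lemma axis_neighbourhood:
  fixes \<sigma> \<rho> :: real
  assumes \<sigma>: "\<bar>\<sigma>\<bar> = 1" and \<rho>: "0 < \<rho>" "\<rho> \<le> 1"
  obtains G where "open G" "G \<noteq> {}" "G \<subseteq> ball 0 \<rho>" "\<And>x. x \<in> G \<Longrightarrow> \<sigma> * pot_lim x \<ge> pi / 8"
proof
  define \<tau> where "\<tau> = exp (- 4 / \<rho>)"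
  define G where "G = {x :: real^3. \<rho> / 4 < \<sigma> * x$3} \<inter> {x. rsq x < \<tau>} \<inter> {x. 0 < rsq x} \<inter> ball 0 \<rho>"
  show "open G" unfolding G_def rsq_def
    by (intro open_Int open_Collect_less continuous_intros open_ball)
  show "G \<subseteq> ball 0 \<rho>" by (auto simp: G_def)
  have "\<tau> > 0" by (simp add: \<tau>_def)
  \<comment> \<open>Chosen so that the point \<open>(r, 0, \<sigma> * \<rho> / 2)\<close> is off the
    axis, in the thin cylinder and in the ball, which shows \<open>G\<close> nonempty.\<close>
  define r where "r = min (sqrt \<tau> / 2) (\<rho> / 4)"
  have r: "0 < r" "r \<le> \<rho> / 4" "r \<le> sqrt \<tau> / 2" using \<open>\<tau> > 0\<close> \<rho> by (auto simp: r_def)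
  have "r\<^sup>2 \<le> (sqrt \<tau> / 2)\<^sup>2" using r by (intro power_mono) auto
  also have "\<dots> < \<tau>" using \<open>\<tau> > 0\<close> by (simp add: power_divide)
  finally have r\<tau>: "r\<^sup>2 < \<tau>" .
  let ?p = "vector [r, 0, \<sigma> * \<rho> / 2] :: real^3"
  have ss: "\<sigma> * \<sigma> = 1" using \<sigma> by (metis abs_mult_self_eq mult.left_neutral)
  have "norm ?p \<le> \<bar>?p $ 1\<bar> + \<bar>?p $ 2\<bar> + \<bar>?p $ 3\<bar>"
    using norm_le_l1_cart[of ?p] by (simp add: sum_3)
  also have "\<dots> < \<rho>" using r \<rho> \<sigma> by (simp add: abs_mult)
  finally have "norm ?p < \<rho>" .
  moreover have "\<sigma> * ?p $ 3 = \<rho> / 2" using ss by (simp add: mult.assoc[symmetric])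
  moreover have "rsq ?p = r\<^sup>2" by (simp add: rsq_def)
  ultimately have "?p \<in> G"
    using r(1) r\<tau> \<rho> unfolding G_def Int_iff mem_Collect_eq by (simp only: mem_ball_0) simp
  then show "G \<noteq> {}" by blast
  fix x assume x: "x \<in> G"
  then have t: "0 < rsq x" "rsq x < \<tau>" "\<rho> / 4 < \<sigma> * x$3" by (auto simp: G_def)
  have "ln (rsq x) < - 4 / \<rho>" using t \<open>\<tau> > 0\<close> by (metis \<tau>_def ln_exp ln_less_cancel_iff)
  then have l: "4 / \<rho> \<le> prof 0 0 (rsq x)" by (simp add: prof_def ell_def)
  have "1 = \<rho> / 4 * (4 / \<rho>)" using \<rho> by simp
  also have "\<dots> \<le> (\<sigma> * x$3) * prof 0 0 (rsq x)" using t l \<rho> by (intro mult_mono) auto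
  finally have "arctan 1 \<le> arctan (\<sigma> * (x$3 * prof 0 0 (rsq x)))"
    unfolding arctan_le_iff by (simp only: mult.assoc)
  moreover have "arctan (\<sigma> * y) = \<sigma> * arctan y" for y
  proof -
    have "\<sigma> = 1 \<or> \<sigma> = - 1" using \<sigma> by linarith
    then show ?thesis by (auto simp: arctan_minus)
  qed
  ultimately have "pi / 4 \<le> \<sigma> * arctan (x$3 * prof 0 0 (rsq x))" by (simp only: arctan_one)
  then show "\<sigma> * pot_lim x \<ge> pi / 8" using t(1) by (simp add: pot_lim_def pot_def)
qed

lemma discontinuous_pot_lim: "essentially_discontinuous_at unit_ball pot_lim 0"
  unfolding essentially_discontinuous_at_def
proof (intro allI impI notI)
  fix w assume w: "AE x in leb_ball. w x = pot_lim x" and c: "isCont w 0"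
  \<comment> \<open>Two values within 1/4 of \<open>w 0\<close> differ by less than 1/2, whereas
    values of both signs of size at least pi / 8 differ by at least pi / 4.\<close>
  obtain \<delta> where \<delta>: "\<delta> > 0" "\<And>x. dist x 0 < \<delta> \<Longrightarrow> dist (w x) (w 0) < 1 / 4"
    using c unfolding continuous_at_eps_delta by (metis zero_less_divide_1_iff zero_less_numeral)
  define \<rho> where "\<rho> = min \<delta> 1"
  have \<rho>: "0 < \<rho>" "\<rho> \<le> 1" "\<rho> \<le> \<delta>" using \<delta> by (auto simp: \<rho>_def)
  have *: "\<exists>x. \<sigma> * w x \<ge> pi / 8 \<and> \<bar>w x - w 0\<bar> < 1 / 4" if \<sigma>: "\<bar>\<sigma>\<bar> = 1" for \<sigma> :: real
  proof -
    obtain G where G: "open G" "G \<noteq> {}" "G \<subseteq> ball 0 \<rho>" "\<And>x. x \<in> G \<Longrightarrow> \<sigma> * pot_lim x \<ge> pi / 8"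
      using axis_neighbourhood[OF \<sigma> \<rho>(1,2)] by metis
    have "G \<subseteq> unit_ball" using G(3) \<rho> by force
    then obtain x where x: "x \<in> G" "w x = pot_lim x" using AE_unit_ball_open[OF w G(1) _ G(2)] by blast
    have "dist x 0 < \<delta>" using x(1) G(3) \<rho>(3) by (auto simp: dist_commute)
    then have "\<bar>w x - w 0\<bar> < 1 / 4" using \<delta>(2) by (simp add: dist_real_def)
    moreover have "\<sigma> * w x \<ge> pi / 8" using G(4)[OF x(1)] x(2) by simp
    ultimately show ?thesis by blast
  qed
  obtain x where x: "w x \<ge> pi / 8" "\<bar>w x - w 0\<bar> < 1 / 4" using *[of 1] by auto
  obtain y where y: "- w y \<ge> pi / 8" "\<bar>w y - w 0\<bar> < 1 / 4" using *[of "-1"] by auto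
  show False using x y pi_gt3 by linarith
qed

text \<open>On the axis \<open>k ell = 1\<close>, so the profile is exactly
  \<open>ell / 2 = (3 + ln (m + 1)) / 2\<close>. Any \<open>m >= exp (2 / \<epsilon>)\<close> makes
  it at least \<open>1 / \<epsilon>\<close>, so the value at height \<epsilon> is at least pi / 8,
  while the value at the origin is 0.\<close>

lemma pot_seq_jump:
  assumes "0 < \<epsilon>"
  obtains m where "pot_seq m (vector [0, 0, \<epsilon>]) - pot_seq m (vector [0, 0, 0]) \<ge> 1 / 8"
proof -
  obtain m :: nat where m: "exp (2 / \<epsilon>) \<le> real m" using real_arch_simple by blast
  then have "exp (2 / \<epsilon>) \<le> real (Suc m)" by simp
  then have "2 / \<epsilon> \<le> ln (real (Suc m))" by (subst ln_ge_iff) auto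
  moreover have e: "ell (dseq m) 0 = 3 + ln (real (Suc m))"
    by (simp add: ell_def dseq_def ln_inverse del: of_nat_Suc)
  moreover have "prof (kseq m) (dseq m) 0 = ell (dseq m) 0 / 2"
    using reg.ell_0_ge[of m] by (simp add: prof_def kseq_def power2_eq_square)
  ultimately have "1 / \<epsilon> \<le> prof (kseq m) (dseq m) 0" by simp
  then have "1 \<le> \<epsilon> * prof (kseq m) (dseq m) 0" using assms by (simp add: field_simps)
  then have "arctan 1 \<le> arctan (\<epsilon> * prof (kseq m) (dseq m) 0)" by (simp only: arctan_le_iff)
  then have "1 / 8 \<le> arctan (\<epsilon> * prof (kseq m) (dseq m) 0) / 2" unfolding arctan_one using pi_gt3 by linarith
  then show ?thesis by (intro that[of m]) (simp add: pot_def rsq_def)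
qed

theorem theorem1p5:
  fixes B :: "(real^3) set"
  defines "B \<equiv> ball 0 1"
  shows
    "(\<exists>c::real. c > 0 \<and>
       (\<forall>\<epsilon>::real. 0 < \<epsilon> \<and> \<epsilon> < 1 \<longrightarrow>
         (\<exists>(b :: real^3 \<Rightarrow> real^3) (u :: real^3 \<Rightarrow> real).
            smooth_on B b \<and> in_L1 B b \<and> divergence_free B b \<and> L1_norm B b \<le> c \<and>
            smooth_on B u \<and> Linf_norm B u \<le> 1 \<and>
            classical_solution B b u \<and>
            u (vector [0, 0, \<epsilon>]) - u (vector [0, 0, 0]) \<ge> inverse c)))
     \<and>
     (\<exists>(b :: real^3 \<Rightarrow> real^3) (u :: real^3 \<Rightarrow> real).
        in_L1 B b \<and> divergence_free B b \<and>
        in_H1 B u \<and> in_Linf B u \<and> distributional_solution B b u \<and>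
        essentially_discontinuous_at B u 0 \<and>
        (\<exists>(bs :: nat \<Rightarrow> real^3 \<Rightarrow> real^3) (us :: nat \<Rightarrow> real^3 \<Rightarrow> real).
           (\<forall>m. smooth_on B (bs m) \<and> in_L2 B (bs m) \<and> divergence_free B (bs m) \<and>
                smooth_on B (us m) \<and> classical_solution B (bs m) (us m)) \<and>
           (\<exists>C::real. \<forall>m. \<forall>x\<in>B. \<bar>us m x\<bar> \<le> C) \<and>
           (\<lambda>m. L1_norm B (\<lambda>x. bs m x - b x)) \<longlonglongrightarrow> 0 \<and>
           weak_star_conv B us u))"
  unfolding B_def
proof (rule conjI)
  \<comment> \<open>One constant plays two roles: 8 accounts for the jump 1/8, and the integral of
    the majorant for the L1 norm, uniformly in \<open>m\<close> and hence in \<epsilon>.\<close>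
  define c where "c = 8 + \<bar>integral\<^sup>L leb_ball (\<lambda>x. drift_const * majorant (rsq x))\<bar>"
  have c: "c \<ge> 8" "integral\<^sup>L leb_ball (\<lambda>x. drift_const * majorant (rsq x)) \<le> c" by (auto simp: c_def)
  then have inv: "inverse c \<le> 1 / 8" by (simp add: field_simps)
  have "\<exists>b u. smooth_on unit_ball b \<and> in_L1 unit_ball b \<and> divergence_free unit_ball b \<and> L1_norm unit_ball b \<le> c \<and>
      smooth_on unit_ball u \<and> Linf_norm unit_ball u \<le> 1 \<and> classical_solution unit_ball b u \<and>
      u (vector [0, 0, \<epsilon>]) - u (vector [0, 0, 0]) \<ge> inverse c" if \<epsilon>: "0 < \<epsilon> \<and> \<epsilon> < 1" for \<epsilon> :: real
  proof -
    obtain m where m: "pot_seq m (vector [0, 0, \<epsilon>]) - pot_seq m (vector [0, 0, 0]) \<ge> 1 / 8"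
      using pot_seq_jump[OF conjunct1[OF \<epsilon>]] by blast
    show ?thesis
      by (intro exI[of _ "drift_seq m"] exI[of _ "pot_seq m"] conjI smooth_drift_seq in_L1_drift(1) divergence_free_drift_seq
          order.trans[OF L1_norm_drift_seq c(2)] smooth_pot_seq Linf_le_1[OF meas_pot_seq pot_seq_bound] solution_pot_seq
          order.trans[OF inv m])
  qed
  then show "\<exists>c::real. c > 0 \<and> (\<forall>\<epsilon>::real. 0 < \<epsilon> \<and> \<epsilon> < 1 \<longrightarrow>
      (\<exists>b u. smooth_on unit_ball b \<and> in_L1 unit_ball b \<and> divergence_free unit_ball b \<and> L1_norm unit_ball b \<le> c \<and>
        smooth_on unit_ball u \<and> Linf_norm unit_ball u \<le> 1 \<and> classical_solution unit_ball b u \<and>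
        u (vector [0, 0, \<epsilon>]) - u (vector [0, 0, 0]) \<ge> inverse c))"
    using c(1) by (intro exI[of _ c]) auto
next
  show "\<exists>b u. in_L1 unit_ball b \<and> divergence_free unit_ball b \<and>
        in_H1 unit_ball u \<and> in_Linf unit_ball u \<and> distributional_solution unit_ball b u \<and>
        essentially_discontinuous_at unit_ball u 0 \<and>
        (\<exists>bs us.
           (\<forall>m. smooth_on unit_ball (bs m) \<and> in_L2 unit_ball (bs m) \<and> divergence_free unit_ball (bs m) \<and>
                smooth_on unit_ball (us m) \<and> classical_solution unit_ball (bs m) (us m)) \<and>
           (\<exists>C::real. \<forall>m. \<forall>x\<in>unit_ball. \<bar>us m x\<bar> \<le> C) \<and>
           (\<lambda>m. L1_norm unit_ball (\<lambda>x. bs m x - b x)) \<longlonglongrightarrow> 0 \<and>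
           weak_star_conv unit_ball us u)"
    by (intro exI[of _ drift_lim] exI[of _ pot_lim] exI[of _ drift_seq] exI[of _ pot_seq] exI[of _ 1] conjI allI ballI
        in_L1_drift divergence_free_drift_lim H1_pot_lim Linf_le_1(2)[OF meas_pot_lim pot_lim_bound] distributional_pot_lim
        discontinuous_pot_lim smooth_drift_seq L2_drift_seq divergence_free_drift_seq smooth_pot_seq solution_pot_seq pot_seq_bound
        L1_norm_drift_tendsto weak_star_pot_seq)
qed

end
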